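(* Let $d\ge2$ and let $\nu$ be a radius law with exponentially small tail: there exists $c>0$ such that $\nu([r,+\infty[)\le\exp(-cr)$ for all $r\ge1$. Let $\lambda_c=\lambda_c(\nu,d)>0$ be the associated critical density and let $\sigma_{\nu,\lambda_c}:\mathbb{R}^d\to\{0,1\}$ be the associated critical Boolean colouring. For $R>1$ let $\mathrm{Cross}_0(A_R)$ be the event that there exists a continuous path included in $\{\sigma_{\nu,\lambda_c}=0\}$ crossing $A_R=B(0,R)\setminus B(0,1)$, i.e. joining $S(0,1)$ to $S(0,R)$. Then $$\forall\eta>0,\quad\limsup_{R\to\infty}R^{d-1+\eta}\,\mathbb{P}[\mathrm{Cross}_0(A_R)]>0.$$
   Context: Boolean percolation: given a probability measure $\nu$ on $(0,+\infty)$ (the radius law) and $\lambda>0$, take a Poisson point process of intensity $\lambda$ on $\mathbb{R}^d$, and around each of its points draw a Euclidean ball with random radius of law $\nu$, the radii being independent of each other and of the process. The union of the balls is painted white (value $0$) and its complement black (value $1$); this defines $\sigma_{\nu,\lambda}:\mathbb{R}^d\to\{0,1\}$. The critical density is $$\lambda_c(\nu,d)=\sup\{\lambda\ge0:\text{a.s. there is no infinite (unbounded) white component}\}.$$ $B(0,r)$ and $S(0,r)$ are the Euclidean ball and sphere. *)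

theory Defs
  imports "HOL-Probability.Probability"
begin

definition radius_law :: "real measure \<Rightarrow> bool" where
  "radius_law nu \<longleftrightarrow> prob_space nu \<and> sets nu = sets borel \<and> (AE r in nu. 0 < r)"

definition exp_small_tail :: "real measure \<Rightarrow> bool" where
  "exp_small_tail nu \<longleftrightarrow> (\<exists>c>0. \<forall>r\<ge>1. measure nu {r..} \<le> exp (- c * r))"

text \<open>
  A point process is given by an enumeration: its points are \<open>X i \<omega>\<close> for the indices
  \<open>i < K \<omega>\<close>. The number \<open>K \<omega>\<close> of points is in general infinite; allowing it to be finite
  covers intensity \<open>0\<close>, where it vanishes almost surely.
\<close>

definition point_indices ::
  "('w \<Rightarrow> enat) \<Rightarrow> (nat \<Rightarrow> 'w \<Rightarrow> 'a) \<Rightarrow> 'a set \<Rightarrow> 'w \<Rightarrow> nat set" where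
  "point_indices K X A \<omega> = {i. enat i < K \<omega> \<and> X i \<omega> \<in> A}"

definition point_count ::
  "('w \<Rightarrow> enat) \<Rightarrow> (nat \<Rightarrow> 'w \<Rightarrow> 'a) \<Rightarrow> 'a set \<Rightarrow> 'w \<Rightarrow> nat" where
  "point_count K X A \<omega> = card (point_indices K X A \<omega>)"

text \<open>
  The Poisson weights are written out because \<open>poisson_pmf\<close> does not cover the rate \<open>0\<close>,
  which occurs for Lebesgue-null sets and for intensity \<open>0\<close>. In \<open>poisson_indep\<close> members of the
  sequence may be empty, so finite families of disjoint sets are included.
\<close>

locale poisson_process = prob_space M
  for M :: "'w measure" +
  fixes lam :: real
    and K :: "'w \<Rightarrow> enat"
    and X :: "nat \<Rightarrow> 'w \<Rightarrow> 'a::euclidean_space"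
  assumes intensity_nonneg: "0 \<le> lam"
    and measurable_K: "K \<in> measurable M (count_space UNIV)"
    and measurable_X: "\<And>i. X i \<in> borel_measurable M"
    and locally_finite:
      "\<And>A. A \<in> sets borel \<Longrightarrow> bounded A \<Longrightarrow> AE \<omega> in M. finite (point_indices K X A \<omega>)"
    and poisson_counts:
      "\<And>A k. A \<in> sets borel \<Longrightarrow> bounded A \<Longrightarrow>
        prob {\<omega> \<in> space M. point_count K X A \<omega> = k} =
          exp (- (lam * measure lborel A)) * (lam * measure lborel A) ^ k / fact k"
    and poisson_indep:
      "\<And>A :: nat \<Rightarrow> 'a set.
        (\<And>n. A n \<in> sets borel) \<Longrightarrow> (\<And>n. bounded (A n)) \<Longrightarrow> disjoint_family A \<Longrightarrow>
        indep_vars (\<lambda>_. count_space UNIV) (\<lambda>n. point_count K X (A n)) UNIV"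

locale boolean_model = poisson_process M lam K X
  for M :: "'w measure"
    and lam :: real
    and K :: "'w \<Rightarrow> enat"
    and X :: "nat \<Rightarrow> 'w \<Rightarrow> 'a::euclidean_space" +
  fixes nu :: "real measure"
    and rho :: "nat \<Rightarrow> 'w \<Rightarrow> real"
  assumes radii_indep: "indep_vars (\<lambda>_. borel) rho UNIV"
    and radii_law: "\<And>i. distr M borel (rho i) = nu"
    and radii_indep_process:
      "indep_set
        (sets (vimage_algebra (space M) (\<lambda>\<omega>. (K \<omega>, \<lambda>i. X i \<omega>))
          (count_space UNIV \<Otimes>\<^sub>M (\<Pi>\<^sub>M i\<in>UNIV. borel))))
        (sets (vimage_algebra (space M) (\<lambda>\<omega> i. rho i \<omega>) (\<Pi>\<^sub>M i\<in>UNIV. borel)))"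

text \<open>
  The balls are open. Almost surely no two balls are tangent to each other and none is tangent to
  a given sphere, so closed balls would give the same almost sure properties and the same
  crossing probabilities.
\<close>

definition boolean_colouring ::
  "('w \<Rightarrow> enat) \<Rightarrow> (nat \<Rightarrow> 'w \<Rightarrow> 'a::euclidean_space) \<Rightarrow> (nat \<Rightarrow> 'w \<Rightarrow> real) \<Rightarrow> 'w \<Rightarrow> 'a \<Rightarrow> nat" where
  "boolean_colouring K X rho \<omega> x =
    (if x \<in> (\<Union>i\<in>{i. enat i < K \<omega>}. ball (X i \<omega>) (rho i \<omega>)) then 0 else 1)"

definition no_unbounded_white :: "('a::euclidean_space \<Rightarrow> nat) \<Rightarrow> bool" where
  "no_unbounded_white \<sigma> \<longleftrightarrow> (\<forall>C \<in> components {x. \<sigma> x = 0}. bounded C)"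

text \<open>
  The almost sure statement depends only on the law of the marked process, so the choice of the
  probability space is immaterial. The one fixed type below is rich enough to carry the joint law
  of \<open>K\<close>, \<open>X\<close> and \<open>rho\<close> for every Boolean model, hence a model of every intensity.
\<close>

type_synonym 'a marked_sequence = "enat \<times> (nat \<Rightarrow> 'a) \<times> (nat \<Rightarrow> real)"

definition as_no_unbounded_white ::
  "'a::euclidean_space itself \<Rightarrow> real measure \<Rightarrow> real \<Rightarrow> bool" where
  "as_no_unbounded_white _ nu lam \<longleftrightarrow>
    (\<forall>(P :: 'a marked_sequence measure) K (X :: nat \<Rightarrow> 'a marked_sequence \<Rightarrow> 'a) rho.
      boolean_model P lam K X nu rho \<longrightarrow>
      (AE \<omega> in P. no_unbounded_white (boolean_colouring K X rho \<omega>)))"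

definition critical_density :: "'a::euclidean_space itself \<Rightarrow> real measure \<Rightarrow> ennreal" where
  "critical_density T nu = (SUP lam \<in> {lam. 0 \<le> lam \<and> as_no_unbounded_white T nu lam}. ennreal lam)"

definition white_crossing :: "('a::euclidean_space \<Rightarrow> nat) \<Rightarrow> real \<Rightarrow> bool" where
  "white_crossing \<sigma> R \<longleftrightarrow>
    (\<exists>\<gamma>. path \<gamma> \<and> path_image \<gamma> \<subseteq> {x. \<sigma> x = 0} \<and>
         pathstart \<gamma> \<in> sphere 0 1 \<and> pathfinish \<gamma> \<in> sphere 0 R)"

end

theory Submission
  imports Defs
begin

text \<open>
  Let \<open>pi R\<close> be the probability that balls centred in \<open>ball 0 (4 R)\<close> join the spheres of radii \<open>R\<close>
  and \<open>2 R\<close>. If no radius exceeds \<open>R\<close>, a crossing at scale \<open>10 R\<close> contains two crossings at scale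
  \<open>R\<close> in disjoint regions, whence \<open>pi (10 R) \<le> C (pi R)^2 + error\<close> with an error that the tail
  of the radii controls. So a single large scale \<open>R\<close> with \<open>C * pi R \<le> 1/4\<close> excludes unbounded components.
  Covering the sphere of radius \<open>R\<close> by \<open>O(R^(d-1))\<close> unit balls bounds \<open>pi R\<close> by \<open>O(R^(d-1))\<close> times
  the probability of crossing \<open>A_R\<close>. If the latter were \<open>o(R^(-(d-1)-\<eta>))\<close> at the critical density, the
  criterion would hold with room to spare at some scale; since \<open>pi R\<close> depends continuously on the
  intensity, it would still hold slightly above the critical density, a contradiction.

  At high intensity, call a block of the next level good if at most one of its 3 x 3 sub-blocks is bad.
  Adjacent good blocks are connected, and the probability of a bad block is at most squared, up to a
  factor, from one level to the next; so with positive probability all the blocks at a corner are good.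

  The law of the configuration is handled through its void probabilities, which determine it.
\<close>

section \<open>White regions and paths\<close>


text \<open>The predicate \<open>as_no_unbounded_white\<close> quantifies over all models of one
  intensity and would hold vacuously if there were none. An upper bound on the critical density
  therefore requires a model of every high intensity, on the very type fixed in the definition;
  raising the intensity slightly also requires a law of the added intensity to superpose. This is
  why models are constructed at length. Finiteness has a second role: \<open>enn2real\<close> sends
  infinity to 0, so the given model is critical only if the critical density is finite.

  A crossing is an uncountable union over paths. Its measurability and its dependence on the points
  of a window alone are obtained together, by describing connections through finite chains of cells
  taken from a countable family.

  The exponent \<open>d - 1\<close> is the cost of covering a sphere by unit balls: volume has to be
  compared with a shell of thickness 1, not with a full ball. The extra \<eta> leaves a factor
  \<open>R powr (- \<eta>)\<close>, which beats every constant of the recursion at some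
  scale.\<close>

definition white :: "('a::real_normed_vector \<times> real) set \<Rightarrow> 'a set" where
  "white \<Phi> = (\<Union>(x, r)\<in>\<Phi>. ball x r)"

text \<open>Depends on the configuration only as a set of marked points and is monotone in it;
  restriction to windows and superposition rely on this.\<close>

definition joined :: "('a::real_normed_vector \<times> real) set \<Rightarrow> 'a set \<Rightarrow> 'a set \<Rightarrow> bool" where
  "joined \<Phi> A B \<longleftrightarrow> (\<exists>p\<in>A. \<exists>q\<in>B. path_component (white \<Phi>) p q)"

lemma mem_white: "p \<in> white \<Phi> \<longleftrightarrow> (\<exists>x r. (x, r) \<in> \<Phi> \<and> dist x p < r)"
  by (force simp: white_def)

lemma open_white: "open (white \<Phi>)"
  unfolding white_def by (intro open_UN) auto

lemma white_mono: "\<Phi> \<subseteq> \<Psi> \<Longrightarrow> white \<Phi> \<subseteq> white \<Psi>"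
  by (auto simp: white_def)

lemma joined_mono: "joined \<Phi> A B \<Longrightarrow> \<Phi> \<subseteq> \<Psi> \<Longrightarrow> joined \<Psi> A B"
  unfolding joined_def by (meson path_component_of_subset white_mono)

text \<open>The path is cut at the first time \<open>t2\<close> at which the distance to
  \<open>c\<close> reaches \<open>b\<close>, and before that at a time where it equals
  \<open>a\<close>. Up to \<open>t2\<close> the path stays in \<open>cball c b\<close>, which makes
  the extracted crossing local.\<close>

lemma path_crosses_annulus:
  fixes \<gamma> :: "real \<Rightarrow> 'a::real_normed_vector"
  assumes "path \<gamma>" "dist c (pathstart \<gamma>) \<le> a" "b \<le> dist c (pathfinish \<gamma>)" "a \<le> b"
  obtains \<delta> where "path \<delta>" "path_image \<delta> \<subseteq> path_image \<gamma> \<inter> cball c b"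
    "pathstart \<delta> \<in> sphere c a" "pathfinish \<delta> \<in> sphere c b"
proof -
  define f where "f t = dist c (\<gamma> t)" for t
  have cont: "continuous_on {0..1} f"
    using assms(1) unfolding f_def path_def by (intro continuous_intros)
  define T where "T = {t \<in> {0..1}. b \<le> f t}"
  have "closed T"
    unfolding T_def using continuous_closed_preimage[OF cont, of "{b..}"]
    by (auto simp: vimage_def Int_def conj_commute)
  moreover have "bounded T"
    by (rule bounded_subset[OF bounded_closed_interval[of 0 1]]) (auto simp: T_def)
  ultimately have "compact T"
    by (simp add: compact_eq_bounded_closed)
  moreover have "1 \<in> T"
    using assms(3) by (auto simp: T_def f_def pathfinish_def)
  ultimately obtain t2 where t2: "t2 \<in> T" "\<And>t. t \<in> T \<Longrightarrow> t2 \<le> t"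
    using compact_attains_inf[of T] by blast
  have t2': "0 \<le> t2" "t2 \<le> 1" "b \<le> f t2"
    using t2(1) by (auto simp: T_def)
  have c2: "continuous_on {0..t2} f"
    using t2' by (intro continuous_on_subset[OF cont]) auto
  have f0: "f 0 \<le> a"
    using assms(2) by (simp add: f_def pathstart_def)
  \<comment> \<open>The distance at \<open>t2\<close> is exactly \<open>b\<close>: the intermediate
    value theorem gives a time \<open>s \<le> t2\<close> at level \<open>b\<close>, and minimality
    of \<open>t2\<close> forces \<open>s = t2\<close>.\<close>
  obtain s where s: "0 \<le> s" "s \<le> t2" "f s = b"
    using IVT'[of f 0 b t2] f0 assms(4) t2' c2 by auto
  then have "s = t2"
    using t2(2)[of s] t2' by (auto simp: T_def)
  with s have ft2: "f t2 = b" by simp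
  obtain t1 where t1: "0 \<le> t1" "t1 \<le> t2" "f t1 = a"
    using IVT'[of f 0 a t2] f0 assms(4) ft2 t2' c2 by auto
  have le: "f t \<le> b" if "t \<in> {t1..t2}" for t
  proof (rule ccontr)
    assume "\<not> f t \<le> b"
    then have "t \<in> T" using that t1 t2' by (auto simp: T_def)
    then show False using t2(2)[of t] that ft2 \<open>\<not> f t \<le> b\<close> by (cases "t = t2") auto
  qed
  show thesis
  proof
    show "path (subpath t1 t2 \<gamma>)"
      using assms(1) t1 t2' by (intro path_subpath) auto
    show "path_image (subpath t1 t2 \<gamma>) \<subseteq> path_image \<gamma> \<inter> cball c b"
      using le t1 t2' by (auto simp: path_image_subpath f_def) (auto simp: path_image_def)
    show "pathstart (subpath t1 t2 \<gamma>) \<in> sphere c a" "pathfinish (subpath t1 t2 \<gamma>) \<in> sphere c b"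
      using t1 ft2 by (auto simp: f_def)
  qed
qed

text \<open>A ball of radius \<open>r\<close> that meets \<open>cball c b\<close> has its centre at
  distance less than \<open>r + b\<close> from \<open>c\<close>. By \<open>loc\<close>, only balls
  centred in \<open>W\<close> can thus cover the part of the path that remains in
  \<open>cball c b\<close>.\<close>

lemma joined_annulus:
  assumes "path_component (white \<Phi>) p q" "dist c p \<le> a" "b \<le> dist c q" "a \<le> b"
    and loc: "\<And>x r. (x, r) \<in> \<Phi> \<Longrightarrow> dist c x < r + b \<Longrightarrow> x \<in> W"
  shows "joined (\<Phi> \<inter> (W \<times> UNIV)) (sphere c a) (sphere c b)"
proof -
  obtain \<gamma> where g: "path \<gamma>" "path_image \<gamma> \<subseteq> white \<Phi>" "pathstart \<gamma> = p" "pathfinish \<gamma> = q"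
    using assms(1) unfolding path_component_def by blast
  then obtain \<delta> where d: "path \<delta>" "path_image \<delta> \<subseteq> path_image \<gamma> \<inter> cball c b"
    "pathstart \<delta> \<in> sphere c a" "pathfinish \<delta> \<in> sphere c b"
    using path_crosses_annulus[of \<gamma> c a b] assms by metis
  have "path_image \<delta> \<subseteq> white (\<Phi> \<inter> (W \<times> UNIV))"
  proof
    fix y assume y: "y \<in> path_image \<delta>"
    with d(2) g(2) have "y \<in> white \<Phi>" and yb: "dist c y \<le> b" by auto
    then obtain x r where x: "(x, r) \<in> \<Phi>" "dist x y < r"
      by (auto simp: mem_white)
    have "dist c x < r + b"
      using dist_triangle[of c x y] x yb by (simp add: dist_commute)
    with loc x show "y \<in> white (\<Phi> \<inter> (W \<times> UNIV))"
      by (auto simp: mem_white)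
  qed
  with d show ?thesis
    unfolding joined_def path_component_def by blast
qed

text \<open>The point dividing the segment from \<open>x\<close> to \<open>y\<close> in the ratio
  \<open>r : s\<close> lies in both balls.\<close>

lemma intersecting_balls:
  fixes x y :: "'a::real_normed_vector"
  assumes "0 < r" "0 < s" "dist x y < r + s"
  obtains z where "z \<in> ball x r" "z \<in> ball y s"
proof
  let ?z = "x + (r / (r + s)) *\<^sub>R (y - x)"
  have "dist x ?z = (r / (r + s)) * dist x y"
    using assms by (simp add: dist_norm norm_minus_commute)
  also have "\<dots> < (r / (r + s)) * (r + s)"
    using assms by (intro mult_strict_left_mono) auto
  finally show "?z \<in> ball x r" using assms by simp
  have "y - ?z = (1 - r / (r + s)) *\<^sub>R (y - x)"
    by (simp add: scaleR_left_diff_distrib)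
  also have "1 - r / (r + s) = s / (r + s)"
    using assms by (simp add: field_simps)
  finally have "y - ?z = (s / (r + s)) *\<^sub>R (y - x)" .
  then have "dist y ?z = (s / (r + s)) * dist x y"
    using assms by (simp add: dist_norm norm_minus_commute)
  also have "\<dots> < (s / (r + s)) * (r + s)"
    using assms by (intro mult_strict_left_mono) auto
  finally show "?z \<in> ball y s" using assms by simp
qed

lemma path_component_in_ball:
  fixes x :: "'a::real_normed_vector"
  assumes "(x, r) \<in> \<Phi>" "p \<in> ball x r" "q \<in> ball x r"
  shows "path_component (white \<Phi>) p q"
proof -
  have "path_component (ball x r) p q"
    using assms convex_imp_path_connected[OF convex_ball[of x r]]
    by (simp add: path_connected_component)
  then show ?thesis
    by (rule path_component_of_subset[rotated]) (use assms in \<open>auto simp: white_def\<close>)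
qed

lemma path_component_centres:
  fixes x y :: "'a::real_normed_vector"
  assumes "(x, r) \<in> \<Phi>" "(y, s) \<in> \<Phi>" "0 < r" "0 < s" "dist x y < r + s"
  shows "path_component (white \<Phi>) x y"
proof -
  obtain z where "z \<in> ball x r" "z \<in> ball y s"
    using intersecting_balls assms by metis
  then have "path_component (white \<Phi>) x z" "path_component (white \<Phi>) z y"
    using assms path_component_in_ball[of x r \<Phi> x z] path_component_in_ball[of y s \<Phi> z y] by auto
  then show ?thesis by (rule path_component_trans)
qed

text \<open>Only the target is required to lie in \<open>\<Phi>\<close>: chains start at a known
  member, and membership propagates along them.\<close>

definition overlap :: "('a::metric_space \<times> real) set \<Rightarrow> 'a \<times> real \<Rightarrow> 'a \<times> real \<Rightarrow> bool" where
  "overlap \<Phi> b b' \<longleftrightarrow> b' \<in> \<Phi> \<and> 0 < snd b \<and> 0 < snd b' \<and> dist (fst b) (fst b') < snd b + snd b'"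

text \<open>The balls reachable from \<open>(x, r)\<close> and the remaining balls cover two
  disjoint open sets. The image of a path is connected and starts in the first set, so it never
  leaves it; finiteness of the chain comes from the reflexive transitive closure.\<close>

lemma path_component_overlap_chain:
  fixes \<Phi> :: "('a::real_normed_vector \<times> real) set"
  assumes pc: "path_component (white \<Phi>) p q" and b: "(x, r) \<in> \<Phi>" "p \<in> ball x r"
  obtains b' where "(overlap \<Phi>)\<^sup>*\<^sup>* (x, r) b'" "b' \<in> \<Phi>" "q \<in> ball (fst b') (snd b')"
proof -
  define R where "R = {b' \<in> \<Phi>. (overlap \<Phi>)\<^sup>*\<^sup>* (x, r) b'}"
  have disj: "white R \<inter> white (\<Phi> - R) = {}"
  proof (rule ccontr)
    assume "white R \<inter> white (\<Phi> - R) \<noteq> {}"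
    then obtain y where "y \<in> white R" "y \<in> white (\<Phi> - R)" by blast
    then obtain u s v t where *: "(u, s) \<in> R" "(v, t) \<in> \<Phi> - R" "dist u y < s" "dist v y < t"
      unfolding mem_white by blast
    have "dist u v < s + t"
      using dist_triangle2[of u v y] * by simp
    moreover have "0 < s" "0 < t"
      using * zero_le_dist le_less_trans by blast+
    ultimately have "overlap \<Phi> (u, s) (v, t)"
      using * by (auto simp: overlap_def)
    then have "(v, t) \<in> R"
      using * by (auto simp: R_def intro: rtranclp.rtrancl_into_rtrancl)
    with * show False by simp
  qed
  have un: "white R \<union> white (\<Phi> - R) = white \<Phi>"
    by (auto simp: white_def R_def)
  obtain \<gamma> where g: "path \<gamma>" "path_image \<gamma> \<subseteq> white \<Phi>" "pathstart \<gamma> = p" "pathfinish \<gamma> = q"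
    using pc unfolding path_component_def by blast
  have "p \<in> white R"
    using b by (auto simp: mem_white R_def)
  then have "path_image \<gamma> \<inter> white (\<Phi> - R) = {}"
    using connectedD[OF connected_path_image[OF g(1)] open_white[of R] open_white[of "\<Phi> - R"]]
      disj un g pathstart_in_path_image[of \<gamma>] by auto
  then have "q \<in> white R"
    using un g pathfinish_in_path_image[of \<gamma>] by auto
  then show thesis
    by (auto simp: mem_white R_def intro: that)
qed

section \<open>Countable description of connections by cells\<close>

definition cell :: "'a::metric_space \<times> real \<times> real \<Rightarrow> ('a \<times> real) set" where
  "cell = (\<lambda>(q, s, t). ball q s \<times> {t<..})"

text \<open>By the triangle inequality this forces any ball of the first cell to overlap any ball of
  the second, whichever members the configuration happens to contain.\<close>

definition linked :: "'a::metric_space \<times> real \<times> real \<Rightarrow> 'a \<times> real \<times> real \<Rightarrow> bool" where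
  "linked = (\<lambda>(q, s, t) (q', s', t'). dist q q' + s + s' < t + t')"

text \<open>Forces all balls of the cell to contain one common point of \<open>A\<close>.\<close>

definition reaches :: "'a::metric_space set \<Rightarrow> 'a \<times> real \<times> real \<Rightarrow> bool" where
  "reaches A = (\<lambda>(q, s, t). \<exists>p\<in>A. dist q p + s < t)"

definition cells :: "'a::metric_space set \<Rightarrow> ('a \<times> real \<times> real) set" where
  "cells D = D \<times> (\<rat> \<inter> {0<..}) \<times> (\<rat> \<inter> {0<..})"

text \<open>A property of the cells alone; the configuration enters only through the requirement
  that each cell of the chain be hit.\<close>

definition good_chain :: "'a::metric_space set \<Rightarrow> 'a set \<Rightarrow> ('a \<times> real \<times> real) list \<Rightarrow> bool" where
  "good_chain A B cs \<longleftrightarrow> cs \<noteq> [] \<and> reaches A (hd cs) \<and> reaches B (last cs) \<and> successively linked cs"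

lemma chain_path_component:
  fixes \<Phi> :: "('a::real_normed_vector \<times> real) set"
  assumes "successively linked cs" "cs \<noteq> []"
    and "\<And>c. c \<in> set cs \<Longrightarrow> pick c \<in> \<Phi> \<inter> cell c" "\<And>c. c \<in> set cs \<Longrightarrow> 0 < snd (snd c)"
  shows "path_component (white \<Phi>) (fst (pick (hd cs))) (fst (pick (last cs)))"
  using assms
proof (induction cs rule: induct_list012)
  case (2 c)
  then obtain x r where x: "pick c = (x, r)" "(x, r) \<in> \<Phi>" "r > 0"
    by (cases "pick c"; cases c) (force simp: cell_def)
  then have "x \<in> white \<Phi>" using x unfolding mem_white by (metis dist_self)
  then show ?case using x by (simp add: path_component_refl)
next
  case (3 c c' cs)
  obtain q s t q' s' t' where c: "c = (q, s, t)" "c' = (q', s', t')"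
    using prod_cases3 by metis
  obtain x r where x: "pick c = (x, r)" "(x, r) \<in> \<Phi>" "dist q x < s" "t < r" "0 < t"
    using "3.prems"(3)[of c] "3.prems"(4)[of c] c by (cases "pick c") (auto simp: cell_def)
  obtain x' r' where x': "pick c' = (x', r')" "(x', r') \<in> \<Phi>" "dist q' x' < s'" "t' < r'" "0 < t'"
    using "3.prems"(3)[of c'] "3.prems"(4)[of c'] c by (cases "pick c'") (auto simp: cell_def)
  have "dist x x' \<le> dist q x + dist q q' + dist q' x'"
    using dist_triangle[of x x' q] dist_triangle[of q x' q'] by (simp add: dist_commute)
  also have "\<dots> < r + r'"
    using x x' "3.prems"(1) c by (auto simp: linked_def)
  finally have "path_component (white \<Phi>) x x'"
    using x x' by (intro path_component_centres) auto
  moreover have "path_component (white \<Phi>) (fst (pick (hd (c' # cs)))) (fst (pick (last (c' # cs))))"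
    using 3 by (intro "3.IH"(2)) auto
  ultimately show ?case
    using x x' by (auto intro: path_component_trans)
qed simp

text \<open>The precision is arbitrary so that the last cell of a chain can be linked to a new one.\<close>

lemma overlap_chain_cells:
  fixes \<Phi> :: "('a::real_normed_vector \<times> real) set"
  assumes chain: "(overlap \<Phi>)\<^sup>*\<^sup>* b0 b" and b0: "b0 \<in> \<Phi>" "0 < snd b0"
    and p: "p \<in> A" "dist (fst b0) p < snd b0"
    and D: "\<And>U. open U \<Longrightarrow> U \<noteq> {} \<Longrightarrow> \<exists>d\<in>D. d \<in> (U::'a set)"
    and "0 < (e::real)"
  shows "\<exists>cs\<in>lists (cells D). cs \<noteq> [] \<and> reaches A (hd cs) \<and> successively linked cs \<and>
    (\<forall>c\<in>set cs. \<Phi> \<inter> cell c \<noteq> {}) \<and> b \<in> cell (last cs) \<and>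
    fst (snd (last cs)) < e \<and> snd b - snd (snd (last cs)) < e"
  using chain \<open>0 < e\<close>
proof (induction arbitrary: e rule: rtranclp_induct)
  have cell_ex: "\<exists>q s t. (q, s, t) \<in> cells D \<and> b \<in> cell (q, s, t) \<and> s < e \<and> snd b - t < e"
    if "0 < e" "0 < snd b" for b :: "'a \<times> real" and e
  proof -
    obtain s where s: "s \<in> \<rat>" "0 < s" "s < e"
      using Rats_dense_in_real[of 0 e] \<open>0 < e\<close> by auto
    have "max 0 (snd b - e) < snd b" using that by simp
    then obtain t where t: "t \<in> \<rat>" "max 0 (snd b - e) < t" "t < snd b"
      using Rats_dense_in_real by blast
    obtain q where q: "q \<in> D" "q \<in> ball (fst b) s"
      using D[of "ball (fst b) s"] s by auto
    show ?thesis
      using s t q by (intro exI[of _ q] exI[of _ s] exI[of _ t])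
        (auto simp: cells_def cell_def dist_commute mem_Times_iff)
  qed
  {
    case base
    \<comment> \<open>The slack with which the ball \<open>b0\<close> covers \<open>p\<close>.
      Passing to the cell loses \<open>2 * s\<close> in the centre and \<open>snd b0 - t\<close> in
      the radius: three errors below \<open>g/4\<close>.\<close>
    define g where "g = snd b0 - dist (fst b0) p"
    have "0 < g" using p by (simp add: g_def)
    obtain q s t where c: "(q, s, t) \<in> cells D" "b0 \<in> cell (q, s, t)"
      "s < min e (g/4)" "snd b0 - t < min e (g/4)"
      using cell_ex[of "min e (g/4)" b0] base \<open>0 < g\<close> b0 by auto
    have "dist q p + s < t"
      using dist_triangle[of q p "fst b0"] c p by (auto simp: cell_def g_def mem_Times_iff)
    then show ?case
      using c b0 p by (intro bexI[of _ "[(q, s, t)]"]) (auto simp: reaches_def)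
  next
    case (step b b')
    \<comment> \<open>The slack of the overlap. Passing to the two cells loses
      \<open>2 * s + 2 * s'\<close> in the distance and one error in each radius: six errors below
      \<open>g/8\<close>.\<close>
    define g where "g = snd b + snd b' - dist (fst b) (fst b')"
    have ov: "0 < g" "b' \<in> \<Phi>" "0 < snd b" "0 < snd b'"
      using step by (auto simp: g_def overlap_def)
    obtain cs where cs: "cs \<in> lists (cells D)" "cs \<noteq> []" "reaches A (hd cs)" "successively linked cs"
      "\<forall>c\<in>set cs. \<Phi> \<inter> cell c \<noteq> {}" "b \<in> cell (last cs)"
      "fst (snd (last cs)) < g/8" "snd b - snd (snd (last cs)) < g/8"
      using step.IH[of "g/8"] ov by auto
    obtain q s t where l: "last cs = (q, s, t)"
      using prod_cases3 by metis
    obtain q' s' t' where c: "(q', s', t') \<in> cells D" "b' \<in> cell (q', s', t')"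
      "s' < min e (g/8)" "snd b' - t' < min e (g/8)"
      using cell_ex[of "min e (g/8)" b'] step ov by auto
    have "dist q q' \<le> dist q (fst b) + dist (fst b) (fst b') + dist q' (fst b')"
      using dist_triangle[of q q' "fst b"] dist_triangle[of "fst b" q' "fst b'"]
      by (simp add: dist_commute)
    then have "linked (last cs) (q', s', t')"
      using cs l c by (auto simp: linked_def cell_def g_def mem_Times_iff)
    then show ?case
      using cs c ov by (intro bexI[of _ "cs @ [(q', s', t')]"])
        (auto simp: successively_append_iff)
  }
qed

text \<open>For countable \<open>D\<close> the right-hand side ranges over countably many chains. In
  one direction a chain of overlapping balls is approximated by cells so fine that the strict
  inequalities survive; in the other one member is picked in each cell, and linked cells make the
  picked balls overlap.\<close>

lemma joined_iff_cells:
  fixes \<Phi> :: "('a::real_normed_vector \<times> real) set"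
  assumes D: "\<And>U. open U \<Longrightarrow> U \<noteq> {} \<Longrightarrow> \<exists>d\<in>D. d \<in> (U::'a set)"
  shows "joined \<Phi> A B \<longleftrightarrow>
    (\<exists>cs\<in>lists (cells D). good_chain A B cs \<and> (\<forall>c\<in>set cs. \<Phi> \<inter> cell c \<noteq> {}))"
proof
  assume "joined \<Phi> A B"
  then obtain p q where pq: "p \<in> A" "q \<in> B" "path_component (white \<Phi>) p q"
    by (auto simp: joined_def)
  then obtain x r where x: "(x, r) \<in> \<Phi>" "dist x p < r"
    using path_component_mem(1) by (fastforce simp: mem_white)
  then have r: "0 < r" using zero_le_dist le_less_trans by blast
  obtain b where b: "(overlap \<Phi>)\<^sup>*\<^sup>* (x, r) b" "b \<in> \<Phi>" "q \<in> ball (fst b) (snd b)"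
    using path_component_overlap_chain[OF pq(3), of x r] x by auto
  define g where "g = snd b - dist (fst b) q"
  have g: "0 < g" using b by (simp add: g_def)
  obtain cs where cs: "cs \<in> lists (cells D)" "cs \<noteq> []" "reaches A (hd cs)" "successively linked cs"
      "\<forall>c\<in>set cs. \<Phi> \<inter> cell c \<noteq> {}" "b \<in> cell (last cs)"
      "fst (snd (last cs)) < g/4" "snd b - snd (snd (last cs)) < g/4"
    using overlap_chain_cells[OF b(1), of p A D "g/4"] x r pq D g by auto
  obtain q' s t where l: "last cs = (q', s, t)"
    using prod_cases3 by metis
  have "reaches B (last cs)"
    using cs l pq dist_triangle[of q' q "fst b"]
    by (auto simp: reaches_def cell_def g_def mem_Times_iff intro!: bexI[of _ q])
  then show "\<exists>cs\<in>lists (cells D). good_chain A B cs \<and> (\<forall>c\<in>set cs. \<Phi> \<inter> cell c \<noteq> {})"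
    using cs by (auto simp: good_chain_def)
next
  assume "\<exists>cs\<in>lists (cells D). good_chain A B cs \<and> (\<forall>c\<in>set cs. \<Phi> \<inter> cell c \<noteq> {})"
  then obtain cs where cs: "cs \<in> lists (cells D)" "good_chain A B cs" "\<forall>c\<in>set cs. \<Phi> \<inter> cell c \<noteq> {}"
    by auto
  define pick where "pick c = (SOME b. b \<in> \<Phi> \<inter> cell c)" for c
  have pick: "pick c \<in> \<Phi> \<inter> cell c" if "c \<in> set cs" for c
    unfolding pick_def by (rule someI_ex) (use cs(3) that in blast)
  have pc: "path_component (white \<Phi>) (fst (pick (hd cs))) (fst (pick (last cs)))"
    using cs pick by (intro chain_path_component) (auto simp: good_chain_def cells_def)
  have end_pt: "\<exists>p\<in>A. path_component (white \<Phi>) (fst (pick c)) p"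
    if c_in: "c \<in> set cs" and c_reach: "reaches A c" for c A
  proof -
    obtain q s t where c: "c = (q, s, t)" using prod_cases3 by metis
    obtain x r where x: "pick c = (x, r)" "(x, r) \<in> \<Phi>" "dist q x < s" "t < r"
      using pick[OF c_in] c by (cases "pick c") (auto simp: cell_def)
    have "0 < t" using c_in cs(1) c by (auto simp: cells_def)
    obtain p where p: "p \<in> A" "dist q p + s < t"
      using c_reach c by (auto simp: reaches_def)
    then have "dist x p < r"
      using dist_triangle[of x p q] x by (simp add: dist_commute)
    then show ?thesis
      using p x \<open>0 < t\<close> by (intro bexI[of _ p]) (auto intro!: path_component_in_ball[of x r])
  qed
  show "joined \<Phi> A B"
    using end_pt[of "hd cs" A] end_pt[of "last cs" B] pc cs(2)
    unfolding joined_def good_chain_def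
    by (meson hd_in_set last_in_set path_component_sym path_component_trans)
qed

section \<open>Laws of marked Poisson configurations\<close>


text \<open>Finite unions make the void events stable under intersection; bounded bases in
  \<open>W\<close> keep the measure finite and the events local.\<close>

definition rects :: "'a::euclidean_space set \<Rightarrow> ('a \<times> real) set set" where
  "rects W = {(\<Union>(A, C)\<in>F. A \<times> C) | F. finite F \<and>
     (\<forall>(A, C)\<in>F. A \<in> sets borel \<and> bounded A \<and> A \<subseteq> W \<and> C \<in> sets borel)}"

definition void :: "('a \<times> real) set \<Rightarrow> ('a \<times> real) set set" where
  "void D = {\<Phi>. \<Phi> \<inter> D = {}}"

text \<open>Encodes locality: the generators depend only on the marked points located in
  \<open>W\<close>, hence so do all events of \<open>sets (conf W)\<close>.\<close>

definition conf :: "'a::euclidean_space set \<Rightarrow> ('a \<times> real) set measure" where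
  "conf W = sigma UNIV (void ` rects W)"

lemma space_conf [simp]: "space (conf W) = UNIV"
  by (simp add: conf_def space_measure_of_conv)

lemma sets_conf: "sets (conf W) = sigma_sets UNIV (void ` rects W)"
  by (simp add: conf_def)

lemma void_Un: "void D \<inter> void D' = void (D \<union> D')"
  by (auto simp: void_def)

lemma void_empty [simp]: "void {} = UNIV"
  by (simp add: void_def)

lemma rects_Un: "D \<in> rects W \<Longrightarrow> D' \<in> rects W \<Longrightarrow> D \<union> D' \<in> rects W"
proof -
  assume "D \<in> rects W" "D' \<in> rects W"
  then obtain F F' where *: "finite F" "\<forall>(A, C)\<in>F. A \<in> sets borel \<and> bounded A \<and> A \<subseteq> W \<and> C \<in> sets borel"
    "D = (\<Union>(A, C)\<in>F. A \<times> C)" "finite F'"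
    "\<forall>(A, C)\<in>F'. A \<in> sets borel \<and> bounded A \<and> A \<subseteq> W \<and> C \<in> sets borel" "D' = (\<Union>(A, C)\<in>F'. A \<times> C)"
    unfolding rects_def by blast
  then show ?thesis
    unfolding rects_def by (intro CollectI exI[of _ "F \<union> F'"]) auto
qed

lemma rects_Times:
  "A \<in> sets borel \<Longrightarrow> bounded A \<Longrightarrow> A \<subseteq> W \<Longrightarrow> C \<in> sets borel \<Longrightarrow> A \<times> C \<in> rects W"
  unfolding rects_def by (intro CollectI exI[of _ "{(A, C)}"]) auto

lemma rects_empty: "{} \<in> rects W"
  unfolding rects_def by (intro CollectI exI[of _ "{}"]) auto

lemma rects_mono: "W \<subseteq> W' \<Longrightarrow> rects W \<subseteq> rects W'"
proof
  fix D assume "W \<subseteq> W'" "D \<in> rects W"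
  then obtain F where "finite F" "\<forall>(A, C)\<in>F. A \<in> sets borel \<and> bounded A \<and> A \<subseteq> W \<and> C \<in> sets borel"
    "D = (\<Union>(A, C)\<in>F. A \<times> C)"
    unfolding rects_def by auto
  then show "D \<in> rects W'"
    using \<open>W \<subseteq> W'\<close> unfolding rects_def by (intro CollectI exI[of _ F]) (auto, blast)
qed

lemma rects_subset: "D \<in> rects W \<Longrightarrow> D \<subseteq> W \<times> UNIV"
  unfolding rects_def by auto

lemma rects_bounded:
  assumes "D \<in> rects W"
  obtains A where "A \<in> sets borel" "bounded A" "D \<subseteq> A \<times> UNIV"
proof -
  obtain F where F: "finite F" "\<And>A C. (A, C) \<in> F \<Longrightarrow> A \<in> sets borel \<and> bounded A"
    "D = (\<Union>(A, C)\<in>F. A \<times> C)"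
    using assms unfolding rects_def by auto
  show thesis
  proof
    show "(\<Union>p\<in>F. fst p) \<in> sets borel" "bounded (\<Union>p\<in>F. fst p)"
      using F by (auto intro!: sets.finite_UN)
    show "D \<subseteq> (\<Union>p\<in>F. fst p) \<times> UNIV"
    proof
      fix z assume "z \<in> D"
      then obtain p where "p \<in> F" "z \<in> fst p \<times> snd p" by (auto simp: F(3))
      then show "z \<in> (\<Union>p\<in>F. fst p) \<times> UNIV" by auto
    qed
  qed
qed

lemma sets_rects:
  fixes nu :: "real measure"
  assumes "D \<in> rects W" "sets nu = sets borel"
  shows "D \<in> sets (lborel \<Otimes>\<^sub>M nu)"
proof -
  obtain F where F: "finite F" "\<And>A C. (A, C) \<in> F \<Longrightarrow> A \<in> sets borel \<and> C \<in> sets borel"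
    "D = (\<Union>(A, C)\<in>F. A \<times> C)"
    using assms(1) unfolding rects_def by auto
  have "(\<Union>p\<in>F. fst p \<times> snd p) \<in> sets (lborel \<Otimes>\<^sub>M nu)"
  proof (rule sets.finite_UN[OF F(1)])
    fix p assume "p \<in> F"
    then have "fst p \<in> sets borel" "snd p \<in> sets borel"
      using F(2)[of "fst p" "snd p"] by simp_all
    then show "fst p \<times> snd p \<in> sets (lborel \<Otimes>\<^sub>M nu)"
      by (intro pair_measureI) (simp_all add: assms(2))
  qed
  then show ?thesis
    by (simp add: F(3) case_prod_unfold)
qed

lemma Int_stable_void: "Int_stable (void ` rects W)"
  by (auto intro!: Int_stableI simp: void_Un rects_Un)

lemma void_in_conf: "D \<in> rects W \<Longrightarrow> void D \<in> sets (conf W)"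
  by (simp add: sets_conf)

lemma hits_in_conf: "D \<in> rects W \<Longrightarrow> {\<Phi>. \<Phi> \<inter> D \<noteq> {}} \<in> sets (conf W)"
  using sets.compl_sets[OF void_in_conf, of D W] by (simp add: void_def Collect_neg_eq Compl_eq_Diff_UNIV)

lemma sets_conf_mono: "W \<subseteq> W' \<Longrightarrow> sets (conf W) \<subseteq> sets (conf W')"
  unfolding sets_conf by (intro sigma_sets_mono') (use rects_mono in blast)

text \<open>By the cell criterion the event is a countable union, over good chains, of finite
  intersections of hitting events of rectangles inside the window.\<close>

lemma joined_in_conf:
  assumes "W \<in> sets borel"
  shows "{\<Phi>. joined (\<Phi> \<inter> (W \<times> UNIV)) A B} \<in> sets (conf W)"
proof -
  obtain D :: "'a set" where D: "countable D" "\<And>U. open U \<Longrightarrow> U \<noteq> {} \<Longrightarrow> \<exists>d\<in>D. d \<in> U"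
    using countable_dense_exists by blast
  have c: "countable (lists (cells D))"
    unfolding cells_def using D(1) by (intro countable_lists countable_SIGMA) (auto intro: countable_subset[OF _ countable_rat])
  have iff: "joined \<Phi> A B \<longleftrightarrow>
    (\<exists>cs\<in>lists (cells D). good_chain A B cs \<and> (\<forall>c\<in>set cs. \<Phi> \<inter> cell c \<noteq> {}))" for \<Phi>
    using D(2) by (rule joined_iff_cells)
  have hit: "{\<Phi>. \<Phi> \<inter> (W \<times> UNIV) \<inter> cell c \<noteq> {}} \<in> sets (conf W)" for c
  proof -
    obtain q s t where c: "c = (q, s, t)" using prod_cases3 by metis
    have "{\<Phi>. \<Phi> \<inter> ((W \<inter> ball q s) \<times> {t<..}) \<noteq> {}} \<in> sets (conf W)"
      using assms by (intro hits_in_conf rects_Times) (auto intro: bounded_subset)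
    moreover have "\<Phi> \<inter> (W \<times> UNIV) \<inter> cell c = \<Phi> \<inter> ((W \<inter> ball q s) \<times> {t<..})" for \<Phi>
      by (auto simp: c cell_def)
    ultimately show ?thesis by simp
  qed
  have "{\<Phi>. joined (\<Phi> \<inter> (W \<times> UNIV)) A B} =
    (\<Union>cs\<in>lists (cells D). if good_chain A B cs
      then {\<Phi>. \<forall>c\<in>set cs. \<Phi> \<inter> (W \<times> UNIV) \<inter> cell c \<noteq> {}} else {})"
    using iff by auto
  also have "\<dots> \<in> sets (conf W)"
  proof (intro sets.countable_UN''[OF c])
    fix cs
    have "{\<Phi>. \<forall>c\<in>set cs. \<Phi> \<inter> (W \<times> UNIV) \<inter> cell c \<noteq> {}} =
      {\<Phi>\<in>space (conf W). \<forall>c\<in>set cs. \<Phi> \<inter> (W \<times> UNIV) \<inter> cell c \<noteq> {}}" by simp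
    also have "\<dots> \<in> sets (conf W)"
      by (intro sets.sets_Collect_finite_All) (use hit in auto)
    finally show "(if good_chain A B cs
      then {\<Phi>. \<forall>c\<in>set cs. \<Phi> \<inter> (W \<times> UNIV) \<inter> cell c \<noteq> {}} else {}) \<in> sets (conf W)"
      by simp
  qed
  finally show ?thesis .
qed

lemma joined_UNIV_in_conf: "{\<Phi>. joined \<Phi> A B} \<in> sets (conf UNIV)"
  using joined_in_conf[of UNIV A B] by simp

context
  fixes nu :: "real measure"
  assumes prob_nu: "prob_space nu" and sets_nu: "sets nu = sets borel"
begin

lemma emeasure_lborel_Times:
  fixes A :: "'a::euclidean_space set"
  assumes "A \<in> sets borel" "C \<in> sets borel"
  shows "emeasure (lborel \<Otimes>\<^sub>M nu) (A \<times> C) = emeasure lborel A * emeasure nu C"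
proof -
  interpret nu: prob_space nu by (rule prob_nu)
  show ?thesis
    using assms sets_nu by (intro nu.emeasure_pair_measure_Times) auto
qed

lemma measure_lborel_Times:
  fixes A :: "'a::euclidean_space set"
  assumes "A \<in> sets borel" "C \<in> sets borel"
  shows "measure (lborel \<Otimes>\<^sub>M nu) (A \<times> C) = measure lborel A * measure nu C"
  by (simp add: measure_def emeasure_lborel_Times assms enn2real_mult)

lemma emeasure_rects_finite:
  assumes "D \<in> rects W"
  shows "emeasure (lborel \<Otimes>\<^sub>M nu) D < \<infinity>"
proof -
  interpret nu: prob_space nu by (rule prob_nu)
  obtain A where A: "A \<in> sets borel" "bounded A" "D \<subseteq> A \<times> UNIV"
    using rects_bounded[OF assms] by metis
  have "emeasure (lborel \<Otimes>\<^sub>M nu) D \<le> emeasure (lborel \<Otimes>\<^sub>M nu) (A \<times> UNIV)"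
    using A sets_nu by (intro emeasure_mono) auto
  also have "\<dots> = emeasure lborel A * emeasure nu UNIV"
    using A by (intro emeasure_lborel_Times) auto
  also have "\<dots> \<le> emeasure lborel A * 1"
    by (intro mult_left_mono) (auto simp: nu.emeasure_le_1)
  also have "\<dots> < \<infinity>"
    using emeasure_bounded_finite[OF A(2)] by (simp add: less_top)
  finally show ?thesis .
qed

end

text \<open>The void probability is that of a Poisson process on space times radii with intensity
  measure \<open>lam\<close> times \<open>lborel \<Otimes>\<^sub>M nu\<close>. No enumeration of the
  points remains, so models on different probability spaces can be compared.\<close>

locale poisson_law = prob_space Q
  for Q :: "('a::euclidean_space \<times> real) set measure" and lam :: real and nu :: "real measure" +
  assumes sets_Q: "sets Q = sets (conf UNIV)"
    and lam_nonneg: "0 \<le> lam"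
    and prob_space_nu: "prob_space nu"
    and sets_nu: "sets nu = sets borel"
    and void_prob: "D \<in> rects UNIV \<Longrightarrow> prob (void D) = exp (- lam * measure (lborel \<Otimes>\<^sub>M nu) D)"
begin

lemma space_Q [simp]: "space Q = UNIV"
  using sets_eq_imp_space_eq[OF sets_Q] by simp

lemma in_events: "E \<in> sets (conf W) \<Longrightarrow> E \<in> events"
  using sets_conf_mono[of W UNIV] sets_Q by auto

lemmas measure_rects_Times = measure_lborel_Times[OF prob_space_nu sets_nu]
  and emeasure_rects_finite = emeasure_rects_finite[OF prob_space_nu sets_nu]

lemma prob_hits_le:
  assumes "D \<in> rects UNIV"
  shows "prob {\<Phi>. \<Phi> \<inter> D \<noteq> {}} \<le> lam * measure (lborel \<Otimes>\<^sub>M nu) D"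
proof -
  have "prob {\<Phi>. \<Phi> \<inter> D \<noteq> {}} = prob (space Q - void D)"
    by (intro arg_cong[where f=prob]) (auto simp: void_def)
  also have "\<dots> = 1 - exp (- lam * measure (lborel \<Otimes>\<^sub>M nu) D)"
    using void_in_conf[OF assms] in_events[of "void D" UNIV] by (subst prob_compl) (auto simp: void_prob[OF assms])
  also have "\<dots> \<le> lam * measure (lborel \<Otimes>\<^sub>M nu) D"
    using exp_ge_add_one_self[of "- lam * measure (lborel \<Otimes>\<^sub>M nu) D"] by linarith
  finally show ?thesis .
qed

text \<open>Over disjoint windows the measures of two rectangles add, so the void probability of
  their union factorises; stability of void events under intersection extends this to the generated
  sigma-algebras.\<close>

lemma conf_indep:
  assumes "W \<inter> W' = {}" "E \<in> sets (conf W)" "E' \<in> sets (conf W')"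
  shows "prob (E \<inter> E') = prob E * prob E'"
proof -
  have ev: "void ` rects W \<subseteq> events" for W
    using in_events void_in_conf by blast
  have "indep_set (void ` rects W) (void ` rects W')"
    unfolding indep_set_def
  proof (rule indep_setsI)
    show "case_bool (void ` rects W) (void ` rects W') b \<subseteq> events" for b
      using ev by (cases b) auto
  next
    fix A J
    assume J: "J \<noteq> {}" "J \<subseteq> UNIV" "finite J"
      and A: "\<forall>j\<in>J. A j \<in> (case_bool (void ` rects W) (void ` rects W') j)"
    have two: "prob (void D \<inter> void D') = prob (void D) * prob (void D')"
      if D: "D \<in> rects W" "D' \<in> rects W'" for D D'
    proof -
      have D': "D \<in> rects UNIV" "D' \<in> rects UNIV"
        using rects_mono[of _ UNIV] D by auto
      have "measure (lborel \<Otimes>\<^sub>M nu) (D \<union> D') = measure (lborel \<Otimes>\<^sub>M nu) D + measure (lborel \<Otimes>\<^sub>M nu) D'"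
        using D emeasure_rects_finite[OF D(1)] emeasure_rects_finite[OF D(2)] assms(1)
          rects_subset[OF D(1)] rects_subset[OF D(2)]
        by (intro measure_Union sets_rects[OF D(1) sets_nu] sets_rects[OF D(2) sets_nu]) auto
      then show ?thesis
        using D' by (simp add: void_Un void_prob rects_Un flip: exp_add) (simp add: algebra_simps)
    qed
    have "J \<in> Pow {False, True}"
      using UNIV_bool by blast
    then consider "J = {False, True}" | "J = {True}" | "J = {False}"
      using J(1) unfolding Pow_insert Pow_empty by blast
    then show "prob (\<Inter>j\<in>J. A j) = (\<Prod>j\<in>J. prob (A j))"
    proof cases
      case 1
      then obtain D D' where "A True = void D" "A False = void D'" "D \<in> rects W" "D' \<in> rects W'"
        using A by auto
      then show ?thesis using two[of D D'] 1 by (simp add: Int_commute mult.commute)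
    qed auto
  qed
  then have "indep_set (sigma_sets (space Q) (void ` rects W)) (sigma_sets (space Q) (void ` rects W'))"
    by (intro indep_set_sigma_sets Int_stable_void)
  then show ?thesis
    using assms(2,3) by (intro indep_setD) (auto simp: sets_conf)
qed

end

text \<open>The void events are stable under intersection, generate the sigma-algebra and contain
  the whole space as \<open>void {}\<close>.\<close>

lemma poisson_law_unique:
  assumes "poisson_law Q lam nu" "poisson_law Q' lam nu"
  shows "Q = Q'"
proof -
  interpret Q: poisson_law Q lam nu by fact
  interpret Q': poisson_law Q' lam nu by fact
  show ?thesis
  proof (rule measure_eqI_generator_eq[where E = "void ` rects UNIV" and \<Omega> = UNIV and A = "\<lambda>_. UNIV"])
    show "emeasure Q X = emeasure Q' X" if "X \<in> void ` rects UNIV" for X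
      using that by (auto simp: Q.emeasure_eq_measure Q'.emeasure_eq_measure Q.void_prob Q'.void_prob)
    have "UNIV \<in> void ` rects (UNIV :: 'a set)"
      using rects_empty void_empty by (metis imageI)
    then show "range (\<lambda>_. UNIV) \<subseteq> void ` rects (UNIV :: 'a set)"
      by blast
    show "sets Q = sigma_sets UNIV (void ` rects UNIV)" "sets Q' = sigma_sets UNIV (void ` rects UNIV)"
      by (simp_all only: Q.sets_Q Q'.sets_Q sets_conf)
    show "emeasure Q UNIV \<noteq> \<infinity>"
      by simp
  qed (simp_all add: Int_stable_void)
qed

text \<open>The common way to recognise a law: it serves for models, superpositions and
  translates.\<close>

lemma poisson_law_distr:
  assumes "prob_space M" "0 \<le> lam" "prob_space nu" "sets nu = sets borel"
    and "\<And>D. D \<in> rects UNIV \<Longrightarrow> {\<omega> \<in> space M. Z \<omega> \<inter> D = {}} \<in> sets M"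
    and "\<And>D. D \<in> rects UNIV \<Longrightarrow>
      measure M {\<omega> \<in> space M. Z \<omega> \<inter> D = {}} = exp (- lam * measure (lborel \<Otimes>\<^sub>M nu) D)"
  shows "Z \<in> measurable M (conf UNIV)" "poisson_law (distr M (conf UNIV) Z) lam nu"
proof -
  interpret prob_space M by fact
  have vim: "Z -` void D \<inter> space M = {\<omega> \<in> space M. Z \<omega> \<inter> D = {}}" for D
    by (auto simp: void_def)
  show Z: "Z \<in> measurable M (conf UNIV)"
    unfolding conf_def by (rule measurable_measure_of) (use assms(5) vim in auto)
  show "poisson_law (distr M (conf UNIV) Z) lam nu"
    unfolding poisson_law_def poisson_law_axioms_def
    using prob_space_distr[OF Z] assms
    by (simp add: measure_distr[OF Z] void_in_conf vim)
qed

text \<open>A union misses \<open>D\<close> exactly if both parts do, so void probabilities multiply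
  and the intensities in the exponent add.\<close>

lemma poisson_law_superposition:
  assumes "poisson_law Q lam nu" "poisson_law Q' lam' nu"
  shows "(\<lambda>(\<Phi>, \<Psi>). \<Phi> \<union> \<Psi>) \<in> measurable (Q \<Otimes>\<^sub>M Q') (conf UNIV)"
    "poisson_law (distr (Q \<Otimes>\<^sub>M Q') (conf UNIV) (\<lambda>(\<Phi>, \<Psi>). \<Phi> \<union> \<Psi>)) (lam + lam') nu"
proof -
  interpret Q: poisson_law Q lam nu by fact
  interpret Q': poisson_law Q' lam' nu by fact
  interpret QQ: pair_prob_space Q Q' ..
  have eq: "{\<omega> \<in> space (Q \<Otimes>\<^sub>M Q'). (\<lambda>(\<Phi>, \<Psi>). \<Phi> \<union> \<Psi>) \<omega> \<inter> D = {}} = void D \<times> void D" for D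
    by (auto simp: void_def space_pair_measure)
  note ev = Q.in_events[OF void_in_conf] Q'.in_events[OF void_in_conf]
  have pr: "measure (Q \<Otimes>\<^sub>M Q') (void D \<times> void D) = exp (- (lam + lam') * measure (lborel \<Otimes>\<^sub>M nu) D)"
    if D: "D \<in> rects UNIV" for D
  proof -
    have "emeasure (Q \<Otimes>\<^sub>M Q') (void D \<times> void D) = emeasure Q (void D) * emeasure Q' (void D)"
      using ev(1)[OF D] ev(2)[OF D] by (intro Q'.emeasure_pair_measure_Times)
    then have "measure (Q \<Otimes>\<^sub>M Q') (void D \<times> void D) = measure Q (void D) * measure Q' (void D)"
      by (simp add: measure_def enn2real_mult)
    also have "\<dots> = exp (- (lam + lam') * measure (lborel \<Otimes>\<^sub>M nu) D)"
      using D by (simp add: Q.void_prob Q'.void_prob algebra_simps flip: exp_add)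
    finally show ?thesis .
  qed
  have meas: "void D \<times> void D \<in> sets (Q \<Otimes>\<^sub>M Q')" if D: "D \<in> rects UNIV" for D
    using ev(1)[OF D] ev(2)[OF D] by (rule pair_measureI)
  have "0 \<le> lam + lam'"
    using Q.lam_nonneg Q'.lam_nonneg by simp
  note * = poisson_law_distr[of "Q \<Otimes>\<^sub>M Q'", OF QQ.prob_space_axioms this Q.prob_space_nu Q.sets_nu,
      of "\<lambda>(\<Phi>, \<Psi>). \<Phi> \<union> \<Psi>", unfolded eq, OF meas pr]
  show "(\<lambda>(\<Phi>, \<Psi>). \<Phi> \<union> \<Psi>) \<in> measurable (Q \<Otimes>\<^sub>M Q') (conf UNIV)"
    by (rule *(1))
  show "poisson_law (distr (Q \<Otimes>\<^sub>M Q') (conf UNIV) (\<lambda>(\<Phi>, \<Psi>). \<Phi> \<union> \<Psi>)) (lam + lam') nu"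
    by (rule *(2))
qed

section \<open>Translation invariance\<close>

definition translate :: "'a::real_normed_vector \<Rightarrow> ('a \<times> real) set \<Rightarrow> ('a \<times> real) set" where
  "translate v \<Phi> = (\<lambda>(x, r). (x + v, r)) ` \<Phi>"

lemma translate_translate [simp]: "translate u (translate v \<Phi>) = translate (u + v) \<Phi>"
  unfolding translate_def image_image by (intro image_cong) (auto simp: add_ac)

lemma translate_0 [simp]: "translate 0 \<Phi> = \<Phi>"
  by (simp add: translate_def)

lemma mem_translate: "(x, r) \<in> translate v \<Phi> \<longleftrightarrow> (x - v, r) \<in> \<Phi>"
  by (auto simp: translate_def image_iff split: prod.splits intro!: bexI[of _ "(x - v, r)"])

lemma white_translate: "white (translate v \<Phi>) = (+) v ` white \<Phi>"
proof -
  have "p \<in> white (translate v \<Phi>) \<longleftrightarrow> p - v \<in> white \<Phi>" for p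
  proof
    assume "p \<in> white (translate v \<Phi>)"
    then obtain x r where "(x - v, r) \<in> \<Phi>" "dist x p < r"
      unfolding mem_white mem_translate by blast
    moreover have "dist (x - v) (p - v) = dist x p" by (simp add: dist_norm)
    ultimately show "p - v \<in> white \<Phi>" unfolding mem_white by metis
  next
    assume "p - v \<in> white \<Phi>"
    then obtain x r where "(x + v - v, r) \<in> \<Phi>" "dist x (p - v) < r"
      unfolding mem_white by auto
    moreover have "dist (x + v) p = dist x (p - v)" by (simp add: dist_norm algebra_simps)
    ultimately show "p \<in> white (translate v \<Phi>)" unfolding mem_white mem_translate by metis
  qed
  moreover have "p \<in> (+) v ` white \<Phi> \<longleftrightarrow> p - v \<in> white \<Phi>" for p
    by (auto simp: image_iff intro!: bexI[of _ "p - v"])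
  ultimately show ?thesis by blast
qed

lemma joined_translate_imp:
  assumes "joined \<Phi> A B"
  shows "joined (translate v \<Phi>) ((\<lambda>x. x + v) ` A) ((\<lambda>x. x + v) ` B)"
proof -
  obtain p q \<gamma> where g: "p \<in> A" "q \<in> B" "path \<gamma>" "path_image \<gamma> \<subseteq> white \<Phi>" "pathstart \<gamma> = p" "pathfinish \<gamma> = q"
    using assms unfolding joined_def path_component_def by blast
  then show ?thesis
    unfolding joined_def path_component_def
    by (intro bexI[of _ "p + v"] bexI[of _ "q + v"] exI[of _ "(+) v \<circ> \<gamma>"])
      (auto simp: white_translate path_translation_eq path_image_translation pathstart_translation pathfinish_translation add.commute)
qed

lemma joined_translate:
  "joined (translate v \<Phi>) ((\<lambda>x. x + v) ` A) ((\<lambda>x. x + v) ` B) \<longleftrightarrow> joined \<Phi> A B"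
  using joined_translate_imp[of \<Phi> A B v] 
    joined_translate_imp[of "translate v \<Phi>" "(\<lambda>x. x + v) ` A" "(\<lambda>x. x + v) ` B" "- v"]
  by (auto simp: image_image)

lemma rects_translate:
  assumes "D \<in> rects UNIV"
  shows "translate v D \<in> rects (UNIV :: 'a::euclidean_space set)"
proof -
  obtain F where F: "finite F" "\<And>A C. (A, C) \<in> F \<Longrightarrow> A \<in> sets borel \<and> bounded A \<and> C \<in> sets borel"
    "D = (\<Union>(A, C)\<in>F. A \<times> C)"
    using assms unfolding rects_def by auto
  have Times: "translate v (A \<times> C) = (+) v ` A \<times> C" for A :: "'a set" and C
  proof -
    have "y \<in> (+) v ` A \<longleftrightarrow> y - v \<in> A" for y
      by (auto intro!: image_eqI[of _ _ "y - v"])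
    then show ?thesis by (auto simp: mem_translate)
  qed
  have "translate v D = (\<Union>p\<in>F. translate v (fst p \<times> snd p))"
    unfolding F(3) translate_def by (auto simp: image_UN case_prod_unfold)
  then have "translate v D = (\<Union>(A, C)\<in>(\<lambda>(A, C). ((+) v ` A, C)) ` F. A \<times> C)"
    by (simp add: Times case_prod_unfold)
  moreover have "(+) v ` A \<in> sets borel" if "A \<in> sets borel" for A :: "'a set"
  proof -
    have "(+) v ` A = (\<lambda>x. x - v) -` A \<inter> space borel"
      by (force simp: image_iff)
    also have "\<dots> \<in> sets borel"
      using that by (intro measurable_sets[of _ borel borel]) auto
    finally show ?thesis .
  qed
  ultimately show ?thesis
    unfolding rects_def using F(1,2)
    by (intro CollectI exI[of _ "(\<lambda>(A, C). ((+) v ` A, C)) ` F"]) (auto simp: bounded_translation)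
qed

context poisson_law
begin

lemma measure_translate:
  fixes D :: "('a \<times> real) set"
  assumes "D \<in> rects UNIV"
  shows "measure (lborel \<Otimes>\<^sub>M nu) (translate v D) = measure (lborel \<Otimes>\<^sub>M nu) D"
proof -
  interpret nu: prob_space nu by (rule prob_space_nu)
  let ?T = "\<lambda>(x::'a, r::real). ((+) (- v) x, r)"
  have "lborel \<Otimes>\<^sub>M nu = distr lborel lborel ((+) (- v)) \<Otimes>\<^sub>M distr nu nu (\<lambda>r. r)"
    using distr_cong[OF refl sets_lborel, of lborel "(+) (- v)" "(+) (- v)"] lborel_distr_plus[of "- v"]
    by (metis distr_id)
  also have "\<dots> = distr (lborel \<Otimes>\<^sub>M nu) (lborel \<Otimes>\<^sub>M nu) ?T"
    by (intro pair_measure_distr) (auto simp: distr_id nu.sigma_finite_measure_axioms)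
  finally have "measure (lborel \<Otimes>\<^sub>M nu) D = measure (distr (lborel \<Otimes>\<^sub>M nu) (lborel \<Otimes>\<^sub>M nu) ?T) D"
    by simp
  also have "\<dots> = measure (lborel \<Otimes>\<^sub>M nu) (?T -` D \<inter> space (lborel \<Otimes>\<^sub>M nu))"
    by (intro measure_distr sets_rects[OF assms sets_nu]) measurable
  also have "?T -` D \<inter> space (lborel \<Otimes>\<^sub>M nu) = translate v D"
    using sets_eq_imp_space_eq[OF sets_nu] by (auto simp: space_pair_measure mem_translate)
  finally show ?thesis by simp
qed

text \<open>Lebesgue measure is translation invariant, so the translated configuration has the same
  void probabilities and, by uniqueness, the same law.\<close>

lemma prob_translate:
  assumes "E \<in> sets (conf UNIV)"
  shows "prob {\<Phi>. translate v \<Phi> \<in> E} = prob E"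
proof -
  have eq: "{\<Phi>. translate v \<Phi> \<inter> D = {}} = void (translate (- v) D)" for D
  proof -
    have "translate v \<Phi> \<inter> D = translate v (\<Phi> \<inter> translate (- v) D)" for \<Phi>
      by (auto simp: mem_translate)
    then have "translate v \<Phi> \<inter> D = {} \<longleftrightarrow> \<Phi> \<inter> translate (- v) D = {}" for \<Phi>
      by (simp add: translate_def)
    then show ?thesis by (auto simp: void_def)
  qed
  have "{\<Phi> \<in> space Q. translate v \<Phi> \<inter> D = {}} \<in> events"
    "prob {\<Phi> \<in> space Q. translate v \<Phi> \<inter> D = {}} = exp (- lam * measure (lborel \<Otimes>\<^sub>M nu) D)"
    if "D \<in> rects UNIV" for D
    using in_events[OF void_in_conf] void_prob rects_translate[OF that, of "- v"] measure_translate[OF that, of "- v"]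
    by (auto simp: eq)
  from poisson_law_distr[OF prob_space_axioms lam_nonneg prob_space_nu sets_nu this]
  have *: "translate v \<in> measurable Q (conf UNIV)" "poisson_law (distr Q (conf UNIV) (translate v)) lam nu"
    by auto
  have "prob E = measure (distr Q (conf UNIV) (translate v)) E"
    using poisson_law_unique[OF *(2)] poisson_law_axioms by metis
  also have "\<dots> = prob (translate v -` E \<inter> space Q)"
    using assms * by (intro measure_distr)
  finally show ?thesis by (simp add: vimage_def)
qed

lemma prob_joined_translate:
  assumes "W \<in> sets borel"
  shows "prob {\<Phi>. joined (\<Phi> \<inter> ((\<lambda>x. x + v) ` W \<times> UNIV)) ((\<lambda>x. x + v) ` A) ((\<lambda>x. x + v) ` B)} =
    prob {\<Phi>. joined (\<Phi> \<inter> (W \<times> UNIV)) A B}"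
proof -
  have W: "y \<in> (\<lambda>x. x + v) ` W \<longleftrightarrow> y - v \<in> W" for y
    by (auto intro!: image_eqI[of _ _ "y - v"])
  have "translate v (\<Phi> \<inter> (W \<times> UNIV)) = translate v \<Phi> \<inter> ((\<lambda>x. x + v) ` W \<times> UNIV)" for \<Phi>
    unfolding set_eq_iff split_paired_All Int_iff mem_translate mem_Times_iff fst_conv snd_conv W by simp
  then have "joined (translate v \<Phi> \<inter> ((\<lambda>x. x + v) ` W \<times> UNIV)) ((\<lambda>x. x + v) ` A) ((\<lambda>x. x + v) ` B)
    \<longleftrightarrow> joined (\<Phi> \<inter> (W \<times> UNIV)) A B" for \<Phi>
    using joined_translate[of v "\<Phi> \<inter> (W \<times> UNIV)" A B] by simp
  moreover have meas: "{\<Phi>. joined (\<Phi> \<inter> ((\<lambda>x. x + v) ` W \<times> UNIV)) ((\<lambda>x. x + v) ` A) ((\<lambda>x. x + v) ` B)} \<in> sets (conf UNIV)"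
  proof -
    have "(\<lambda>x. x + v) ` W = (\<lambda>x. x - v) -` W \<inter> space borel"
      using W by auto
    also have "\<dots> \<in> sets borel"
      using assms by (intro measurable_sets[of _ borel borel]) auto
    finally show ?thesis
      using joined_in_conf sets_conf_mono[of _ UNIV] by blast
  qed
  ultimately show ?thesis
    using prob_translate[OF meas, of v] by simp
qed

end

section \<open>Boolean models\<close>


text \<open>A set rather than a multiset: equal marked points merge, which affects neither the white
  region nor the void events.\<close>

definition marked_points ::
  "('w \<Rightarrow> enat) \<Rightarrow> (nat \<Rightarrow> 'w \<Rightarrow> 'a) \<Rightarrow> (nat \<Rightarrow> 'w \<Rightarrow> real) \<Rightarrow> 'w \<Rightarrow> ('a \<times> real) set" where
  "marked_points K X rho \<omega> = (\<lambda>i. (X i \<omega>, rho i \<omega>)) ` {i. enat i < K \<omega>}"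

lemma boolean_colouring_white:
  "{x. boolean_colouring K X rho \<omega> x = 0} = white (marked_points K X rho \<omega>)"
  by (auto simp: boolean_colouring_def white_def marked_points_def)

lemma white_crossing_iff:
  "white_crossing (boolean_colouring K X rho \<omega>) R \<longleftrightarrow>
    joined (marked_points K X rho \<omega>) (sphere 0 1) (sphere 0 R)"
  unfolding white_crossing_def boolean_colouring_white joined_def path_component_def by blast

lemma nn_integral_split_nat:
  assumes N: "N \<in> measurable M (count_space (UNIV :: nat set))"
    and F: "\<And>n. F n \<in> borel_measurable M"
  shows "(\<integral>\<^sup>+\<omega>. F (N \<omega>) \<omega> \<partial>M) = (\<Sum>n. \<integral>\<^sup>+\<omega>. indicator {\<omega> \<in> space M. N \<omega> = n} \<omega> * F n \<omega> \<partial>M)"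
proof -
  have ev: "{\<omega> \<in> space M. N \<omega> = k} \<in> sets M" for k
    using measurable_sets[OF N, of "{k}"] by (simp add: vimage_def Int_def conj_commute)
  have "(\<integral>\<^sup>+\<omega>. F (N \<omega>) \<omega> \<partial>M) = (\<integral>\<^sup>+\<omega>. (\<Sum>n. indicator {\<omega> \<in> space M. N \<omega> = n} \<omega> * F n \<omega>) \<partial>M)"
  proof (rule nn_integral_cong)
    fix \<omega> assume "\<omega> \<in> space M"
    then show "F (N \<omega>) \<omega> = (\<Sum>n. indicator {\<omega> \<in> space M. N \<omega> = n} \<omega> * F n \<omega>)"
      by (subst suminf_finite[of "{N \<omega>}"]) (auto simp: indicator_def)
  qed
  also have "\<dots> = (\<Sum>n. \<integral>\<^sup>+\<omega>. indicator {\<omega> \<in> space M. N \<omega> = n} \<omega> * F n \<omega> \<partial>M)"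
    using ev F by (intro nn_integral_suminf) auto
  finally show ?thesis .
qed

text \<open>The generating function of the Poisson law of mean \<open>a\<close>, with
  \<open>a = 0\<close> allowed. At \<open>s = 1 - p\<close> it is the probability that no point
  survives when each is kept independently with probability \<open>p\<close>.\<close>

lemma (in prob_space) nn_integral_power_poisson:
  fixes N :: "'a \<Rightarrow> nat"
  assumes N: "N \<in> measurable M (count_space UNIV)" and a: "0 \<le> a" and s: "0 \<le> s"
    and pois: "\<And>k. prob {\<omega> \<in> space M. N \<omega> = k} = exp (- a) * a ^ k / fact k"
  shows "(\<integral>\<^sup>+\<omega>. ennreal (s ^ N \<omega>) \<partial>M) = ennreal (exp (- a * (1 - s)))"
proof -
  have ev: "{\<omega> \<in> space M. N \<omega> = k} \<in> events" for k
    using measurable_sets[OF N, of "{k}"] by (simp add: vimage_def Int_def conj_commute)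
  have "(\<integral>\<^sup>+\<omega>. ennreal (s ^ N \<omega>) \<partial>M) =
    (\<Sum>k. \<integral>\<^sup>+\<omega>. indicator {\<omega> \<in> space M. N \<omega> = k} \<omega> * ennreal (s ^ k) \<partial>M)"
    by (rule nn_integral_split_nat[OF N]) simp
  also have "\<dots> = (\<Sum>k. ennreal (exp (- a) * ((s * a) ^ k / fact k)))"
    using ev s a by (intro arg_cong[where f=suminf] ext)
      (simp add: mult.commute[of "indicator _ _"] nn_integral_cmult_indicator emeasure_eq_measure pois
        power_mult_distrib mult_ac flip: ennreal_mult)
  also have "\<dots> = ennreal (exp (- a) * exp (s * a))"
  proof (rule suminf_ennreal_eq)
    show "(\<lambda>k. exp (- a) * ((s * a) ^ k / fact k)) sums (exp (- a) * exp (s * a))"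
      using exp_converges[of "s * a"] by (intro sums_mult) (simp add: field_simps scaleR_conv_of_real)
  qed (use s a in auto)
  also have "exp (- a) * exp (s * a) = exp (- a * (1 - s))"
    by (simp add: algebra_simps flip: exp_add)
  finally show ?thesis .
qed

text \<open>The bases are cut into atoms: \<open>h\<close> enumerates the subfamilies of
  \<open>F\<close>, the atom of a subfamily consists of the points lying in exactly these bases, and
  its second factor is the union of theirs. Disjoint bases are what the independence of the counts
  requires.\<close>

lemma disjoint_rects:
  assumes "D \<in> rects W"
  obtains m :: nat and A :: "nat \<Rightarrow> 'a::euclidean_space set" and C :: "nat \<Rightarrow> real set"
  where "\<And>n. A n \<in> sets borel" "\<And>n. bounded (A n)" "disjoint_family A" "\<And>n. C n \<in> sets borel"
    "D = (\<Union>n<m. A n \<times> C n)"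
proof -
  obtain F where F: "finite F" "\<And>p. p \<in> F \<Longrightarrow> fst p \<in> sets borel \<and> bounded (fst p) \<and> snd p \<in> sets borel"
    "D = (\<Union>(A, C)\<in>F. A \<times> C)"
    using assms unfolding rects_def by fastforce
  obtain h :: "nat \<Rightarrow> ('a set \<times> real set) set" where h: "bij_betw h {..<card (Pow F)} (Pow F)"
    using ex_bij_betw_nat_finite[of "Pow F"] F(1) by (auto simp: atLeast0LessThan)
  define m where "m = card (Pow F)"
  \<comment> \<open>The empty subfamily is excluded because its atom is the complement of all bases,
    which is unbounded. Empty sets extend the atoms to an infinite sequence.\<close>
  define A where "A n = (if n < m \<and> h n \<noteq> {} then {x. {p \<in> F. x \<in> fst p} = h n} else {})" for n
  define C where "C n = (if n < m then \<Union>p\<in>h n. snd p else {})" for n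
  have hF: "h n \<subseteq> F" if "n < m" for n
    using bij_betwE[OF h] that by (auto simp: m_def)
  show thesis
  proof
    fix n
    have "{x. {p \<in> F. x \<in> fst p} = h n} = (\<Inter>p\<in>F. {x. x \<in> fst p \<longleftrightarrow> p \<in> h n})" if "n < m"
      using hF[OF that] by blast
    moreover have "(\<Inter>p\<in>F. {x. x \<in> fst p \<longleftrightarrow> p \<in> h n}) \<in> sets borel" if "F \<noteq> {}"
    proof (rule sets.finite_INT[OF F(1) that])
      fix p assume p: "p \<in> F"
      have "{x. x \<in> fst p \<longleftrightarrow> p \<in> h n} = (if p \<in> h n then fst p else - fst p)" by auto
      then show "{x. x \<in> fst p \<longleftrightarrow> p \<in> h n} \<in> sets borel" using F(2)[OF p] by auto
    qed
    ultimately show "A n \<in> sets borel"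
      using hF[of n] by (auto simp: A_def)
    show "bounded (A n)"
    proof (cases "A n = {}")
      case False
      then have n: "n < m" "h n \<noteq> {}" by (auto simp: A_def split: if_splits)
      then obtain p where p: "p \<in> h n" by blast
      have "A n \<subseteq> fst p" using p n by (auto simp: A_def)
      with F(2)[of p] p hF[OF n(1)] show ?thesis by (blast intro: bounded_subset)
    qed simp
    have "snd p \<in> sets borel" if "p \<in> h n" "n < m" for p
      using F(2)[of p] hF that by blast
    then show "C n \<in> sets borel"
      using finite_subset[OF hF F(1)] by (auto simp: C_def intro!: sets.finite_UN)
  next
    have "h i = h j \<longrightarrow> i = j" if "i < m" "j < m" for i j
      using bij_betw_imp_inj_on[OF h] that by (auto simp: m_def inj_on_def)
    then show "disjoint_family A"
      by (auto simp: disjoint_family_on_def A_def split: if_splits)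
  next
    show "D = (\<Union>n<m. A n \<times> C n)"
    proof (intro equalityI subsetI)
      fix z assume "z \<in> D"
      then obtain p where p: "p \<in> F" "z \<in> fst p \<times> snd p"
        by (auto simp: F(3))
      define T where "T = {p \<in> F. fst z \<in> fst p}"
      have "T \<in> h ` {..<m}"
        using bij_betw_imp_surj_on[OF h] by (auto simp: T_def m_def)
      then obtain n where n: "n < m" "h n = T" by auto
      have "p \<in> T" using p by (auto simp: T_def)
      then have "fst z \<in> A n" "snd z \<in> C n"
        using p n by (cases p, auto simp: A_def C_def T_def)+
      then have "z \<in> A n \<times> C n" by (simp add: mem_Times_iff)
      with n show "z \<in> (\<Union>n<m. A n \<times> C n)" by blast
    next
      fix z assume "z \<in> (\<Union>n<m. A n \<times> C n)"
      then obtain n where n: "n < m" "z \<in> A n \<times> C n" by blast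
      then obtain p where p: "p \<in> h n" "snd z \<in> snd p" by (auto simp: C_def)
      have "fst z \<in> fst p" using n p by (auto simp: A_def split: if_splits)
      with p have "z \<in> fst p \<times> snd p" by (simp add: mem_Times_iff)
      with p hF[OF n(1)] show "z \<in> D"
        unfolding F(3) case_prod_unfold by blast
    qed
  qed
qed

text \<open>The predicate \<open>indep_var\<close> of the library requires both variables to take values in one type.\<close>

lemma (in prob_space) distr_pair_indep_set:
  assumes Y: "Y \<in> measurable M S" and Z: "Z \<in> measurable M T"
    and ind: "indep_set (sets (vimage_algebra (space M) Y S)) (sets (vimage_algebra (space M) Z T))"
  shows "distr M S Y \<Otimes>\<^sub>M distr M T Z = distr M (S \<Otimes>\<^sub>M T) (\<lambda>\<omega>. (Y \<omega>, Z \<omega>))"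
proof (rule pair_measure_eqI)
  interpret Y: prob_space "distr M S Y" by (rule prob_space_distr[OF Y])
  interpret Z: prob_space "distr M T Z" by (rule prob_space_distr[OF Z])
  show "sigma_finite_measure (distr M S Y)" "sigma_finite_measure (distr M T Z)" ..
  show "sets (distr M S Y \<Otimes>\<^sub>M distr M T Z) = sets (distr M (S \<Otimes>\<^sub>M T) (\<lambda>\<omega>. (Y \<omega>, Z \<omega>)))"
    by (simp cong: sets_pair_measure_cong)
  fix A B assume A: "A \<in> sets (distr M S Y)" and B: "B \<in> sets (distr M T Z)"
  have eq: "(\<lambda>\<omega>. (Y \<omega>, Z \<omega>)) -` (A \<times> B) \<inter> space M = (Y -` A \<inter> space M) \<inter> (Z -` B \<inter> space M)"
    by auto
  have "prob ((Y -` A \<inter> space M) \<inter> (Z -` B \<inter> space M)) =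
    prob (Y -` A \<inter> space M) * prob (Z -` B \<inter> space M)"
    using ind by (rule indep_setD) (use A B in \<open>auto intro!: in_vimage_algebra\<close>)
  then show "emeasure (distr M S Y) A * emeasure (distr M T Z) B =
    emeasure (distr M (S \<Otimes>\<^sub>M T) (\<lambda>\<omega>. (Y \<omega>, Z \<omega>))) (A \<times> B)"
    using A B Y Z by (simp add: emeasure_distr eq emeasure_eq_measure ennreal_mult'')
qed

section \<open>The law of a Boolean model\<close>

context boolean_model
begin

lemma measurable_rho: "rho i \<in> borel_measurable M"
  using radii_indep by (auto simp: indep_vars_def)

lemma prob_space_nu: "prob_space nu"
  using prob_space_distr[OF measurable_rho[of 0]] radii_law[of 0] by simp

lemma sets_nu: "sets nu = sets borel"
  using radii_law[of 0] by auto

lemma distr_radii: "distr M (\<Pi>\<^sub>M i\<in>UNIV. borel) (\<lambda>\<omega> i. rho i \<omega>) = (\<Pi>\<^sub>M i\<in>UNIV. nu)"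
  using indep_vars_iff_distr_eq_PiM[where I = UNIV and M' = "\<lambda>_. borel" and X = rho] measurable_rho radii_indep radii_law
  by (simp add: restrict_def)

lemma measurable_process:
  "(\<lambda>\<omega>. (K \<omega>, \<lambda>i. X i \<omega>)) \<in> measurable M (count_space UNIV \<Otimes>\<^sub>M (\<Pi>\<^sub>M i\<in>UNIV. borel))"
  using measurable_K measurable_X by (intro measurable_Pair measurable_PiM_single') auto

lemma measurable_radii: "(\<lambda>\<omega> i. rho i \<omega>) \<in> measurable M (\<Pi>\<^sub>M i\<in>UNIV. borel)"
  using measurable_rho by (intro measurable_PiM_single') auto

lemma distr_process_radii:
  "distr M (count_space UNIV \<Otimes>\<^sub>M (\<Pi>\<^sub>M i\<in>UNIV. borel)) (\<lambda>\<omega>. (K \<omega>, \<lambda>i. X i \<omega>)) \<Otimes>\<^sub>M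
    distr M (\<Pi>\<^sub>M i\<in>UNIV. borel) (\<lambda>\<omega> i. rho i \<omega>) =
  distr M ((count_space UNIV \<Otimes>\<^sub>M (\<Pi>\<^sub>M i\<in>UNIV. borel)) \<Otimes>\<^sub>M (\<Pi>\<^sub>M i\<in>UNIV. borel))
    (\<lambda>\<omega>. ((K \<omega>, \<lambda>i. X i \<omega>), \<lambda>i. rho i \<omega>))"
  using radii_indep_process by (intro distr_pair_indep_set measurable_process measurable_radii)

lemma hits_event: 
  assumes "A \<in> sets borel" "C \<in> sets borel"
  shows "{\<omega> \<in> space M. marked_points K X rho \<omega> \<inter> A \<times> C \<noteq> {}} \<in> events"
proof -
  have "{\<omega> \<in> space M. marked_points K X rho \<omega> \<inter> A \<times> C \<noteq> {}} =
    (\<Union>i. (K -` {k. enat i < k} \<inter> space M) \<inter> (X i -` A \<inter> space M) \<inter> (rho i -` C \<inter> space M))"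
    by (auto simp: marked_points_def)
  also have "\<dots> \<in> events"
    using assms
    by (intro sets.countable_nat_UN image_subsetI sets.Int measurable_sets[OF measurable_K]
      measurable_sets[OF measurable_X] measurable_sets[OF measurable_rho]) auto
  finally show ?thesis .
qed

text \<open>For the process held fixed, \<open>I n\<close> is the set of indices whose points lie in
  the n-th base. Disjointness puts at most one constraint on each radius, and the radii are
  independent.\<close>

lemma emeasure_radii_avoid:
  fixes I :: "nat \<Rightarrow> nat set"
  assumes fin: "\<And>n. n < m \<Longrightarrow> finite (I n)" and disj: "disjoint_family_on I {..<m}"
    and C: "\<And>n. C n \<in> sets borel"
  shows "emeasure (\<Pi>\<^sub>M i\<in>UNIV. nu) {r. \<forall>n<m. \<forall>i\<in>I n. r i \<notin> C n} =
    ennreal (\<Prod>n<m. (1 - measure nu (C n)) ^ card (I n))"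
proof -
  interpret nu: prob_space nu by (rule prob_space_nu)
  interpret P: product_prob_space "\<lambda>_::nat. nu" UNIV ..
  have space_nu: "space nu = UNIV"
    using sets_eq_imp_space_eq[OF sets_nu] by simp
  \<comment> \<open>The unique base to which an index belongs, so that the constraint can be stated
    coordinate by coordinate.\<close>
  define c where "c i = (THE n. n < m \<and> i \<in> I n)" for i
  have c: "c i = n" if "n < m" "i \<in> I n" for i n
    unfolding c_def using disj that by (intro the_equality) (auto simp: disjoint_family_on_def)
  have "{r. \<forall>n<m. \<forall>i\<in>I n. r i \<notin> C n} =
    {r \<in> space (\<Pi>\<^sub>M i\<in>UNIV. nu). \<forall>i\<in>(\<Union>n<m. I n). r i \<in> UNIV - C (c i)}"
    using c by (auto simp: space_PiM space_nu)
  also have "emeasure (\<Pi>\<^sub>M i\<in>UNIV. nu) \<dots> = (\<Prod>i\<in>(\<Union>n<m. I n). emeasure nu (UNIV - C (c i)))"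
    using fin C sets_nu by (intro P.emeasure_PiM_Collect) auto
  also have "\<dots> = (\<Prod>n<m. \<Prod>i\<in>I n. emeasure nu (UNIV - C (c i)))"
    using fin disj by (intro prod.UNION_disjoint) (auto simp: disjoint_family_on_def)
  also have "\<dots> = (\<Prod>n<m. \<Prod>i\<in>I n. ennreal (1 - measure nu (C n)))"
  proof (intro prod.cong refl)
    fix n i assume "n \<in> {..<m}" "i \<in> I n"
    then have "c i = n" using c by auto
    then show "emeasure nu (UNIV - C (c i)) = ennreal (1 - measure nu (C n))"
      using nu.prob_compl[of "C n"] C sets_nu by (simp add: nu.emeasure_eq_measure space_nu)
  qed
  also have "\<dots> = ennreal (\<Prod>n<m. (1 - measure nu (C n)) ^ card (I n))"
    by (simp add: prod_ennreal ennreal_power prod_nonneg)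
  finally show ?thesis .
qed

text \<open>Fubini over process and radii: for a fixed process the radii avoid the sets
  \<open>C n\<close> with a probability that is a product of powers of
  \<open>1 - measure nu (C n)\<close>, the exponents being the counts. The counts over disjoint
  bases are independent and Poisson, so their generating functions give the exponentials.\<close>

lemma void_disjoint_rects:
  fixes A :: "nat \<Rightarrow> 'a set" and C :: "nat \<Rightarrow> real set"
  assumes A: "\<And>n. A n \<in> sets borel" "\<And>n. bounded (A n)" "disjoint_family A"
    and C: "\<And>n. C n \<in> sets borel"
  shows "emeasure M {\<omega> \<in> space M. marked_points K X rho \<omega> \<inter> (\<Union>n<m. A n \<times> C n) = {}} =
    ennreal (\<Prod>n<m. exp (- lam * (measure lborel (A n) * measure nu (C n))))"
proof -
  interpret nu: prob_space nu by (rule prob_space_nu)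
  let ?S = "count_space UNIV \<Otimes>\<^sub>M (\<Pi>\<^sub>M i\<in>(UNIV :: nat set). (borel :: 'a measure)) :: (enat \<times> (nat \<Rightarrow> 'a)) measure"
  let ?T = "\<Pi>\<^sub>M i\<in>(UNIV :: nat set). (borel :: real measure)"
  let ?Y = "\<lambda>\<omega>. (K \<omega>, \<lambda>i. X i \<omega>)"
  let ?I = "\<lambda>n. point_indices K X (A n)"
  define V where "V = {p \<in> space (?S \<Otimes>\<^sub>M ?T). \<forall>n\<in>{..<m}. \<forall>i.
    (enat i < fst (fst p) \<and> snd (fst p) i \<in> A n) \<longrightarrow> \<not> snd p i \<in> C n}"
  have V: "V \<in> sets (?S \<Otimes>\<^sub>M ?T)"
  proof -
    note A(1)[measurable] C[measurable]
    have [measurable]: "Measurable.pred (count_space UNIV) (\<lambda>k. enat i < k)" for i by simp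
    show ?thesis unfolding V_def by measurable
  qed
  interpret R: prob_space "distr M ?T (\<lambda>\<omega> i. rho i \<omega>)"
    by (rule prob_space_distr[OF measurable_radii])
  have "{\<omega> \<in> space M. marked_points K X rho \<omega> \<inter> (\<Union>n<m. A n \<times> C n) = {}} =
    (\<lambda>\<omega>. (?Y \<omega>, \<lambda>i. rho i \<omega>)) -` V \<inter> space M"
    by (auto simp: V_def marked_points_def space_pair_measure space_PiM)
  then have "emeasure M {\<omega> \<in> space M. marked_points K X rho \<omega> \<inter> (\<Union>n<m. A n \<times> C n) = {}} =
    emeasure (distr M (?S \<Otimes>\<^sub>M ?T) (\<lambda>\<omega>. (?Y \<omega>, \<lambda>i. rho i \<omega>))) V"
    using V measurable_process measurable_radii by (subst emeasure_distr) auto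
  also have "\<dots> = emeasure (distr M ?S ?Y \<Otimes>\<^sub>M distr M ?T (\<lambda>\<omega> i. rho i \<omega>)) V"
    by (simp only: distr_process_radii)
  also have "\<dots> = (\<integral>\<^sup>+p. emeasure (distr M ?T (\<lambda>\<omega> i. rho i \<omega>)) (Pair p -` V) \<partial>distr M ?S ?Y)"
    using V by (intro R.emeasure_pair_measure_alt) simp
  also have "\<dots> = (\<integral>\<^sup>+\<omega>. emeasure (distr M ?T (\<lambda>\<omega> i. rho i \<omega>)) (Pair (?Y \<omega>) -` V) \<partial>M)"
    using measurable_process R.measurable_emeasure_Pair[of V ?S] V
    by (intro nn_integral_distr) (auto cong: measurable_cong_sets)
  also have "\<dots> = (\<integral>\<^sup>+\<omega>. (\<Prod>n<m. ennreal ((1 - measure nu (C n)) ^ point_count K X (A n) \<omega>)) \<partial>M)"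
  proof (rule nn_integral_cong_AE)
    have "AE \<omega> in M. \<forall>n\<in>{..<m}. finite (?I n \<omega>)"
      using A by (intro AE_finite_allI locally_finite) auto
    then show "AE \<omega> in M. emeasure (distr M ?T (\<lambda>\<omega> i. rho i \<omega>)) (Pair (?Y \<omega>) -` V) =
      (\<Prod>n<m. ennreal ((1 - measure nu (C n)) ^ point_count K X (A n) \<omega>))"
    proof eventually_elim
      case (elim \<omega>)
      have "Pair (?Y \<omega>) -` V = {r. \<forall>n<m. \<forall>i\<in>?I n \<omega>. r i \<notin> C n}"
        by (auto simp: V_def point_indices_def space_pair_measure space_PiM)
      moreover have "disjoint_family_on (\<lambda>n. ?I n \<omega>) {..<m}"
        using A(3) by (auto simp: disjoint_family_on_def point_indices_def)
      ultimately show ?case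
        using elim C unfolding distr_radii
        by (simp add: emeasure_radii_avoid point_count_def prod_ennreal)
    qed
  qed
  also have "\<dots> = (\<Prod>n<m. \<integral>\<^sup>+\<omega>. ennreal ((1 - measure nu (C n)) ^ point_count K X (A n) \<omega>) \<partial>M)"
  proof (rule indep_vars_nn_integral)
    have "indep_vars (\<lambda>_. count_space UNIV) (\<lambda>n. point_count K X (A n)) {..<m}"
      using poisson_indep[OF A] by (rule indep_vars_subset) simp
    then show "indep_vars (\<lambda>_. borel) (\<lambda>n \<omega>. ennreal ((1 - measure nu (C n)) ^ point_count K X (A n) \<omega>)) {..<m}"
      by (rule indep_vars_compose2[where Y = "\<lambda>n k. ennreal ((1 - measure nu (C n)) ^ k)"]) simp
  qed simp_all
  also have "\<dots> = (\<Prod>n<m. ennreal (exp (- lam * (measure lborel (A n) * measure nu (C n)))))"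
  proof (intro prod.cong refl)
    fix n
    have "point_count K X (A n) \<in> measurable M (count_space UNIV)"
      using poisson_indep[OF A] by (auto simp: indep_vars_def)
    from nn_integral_power_poisson[OF this _ _ poisson_counts[OF A(1,2)], of "1 - measure nu (C n)"]
    show "(\<integral>\<^sup>+\<omega>. ennreal ((1 - measure nu (C n)) ^ point_count K X (A n) \<omega>) \<partial>M) =
      ennreal (exp (- lam * (measure lborel (A n) * measure nu (C n))))"
      using intensity_nonneg by (simp add: mult.assoc)
  qed
  finally show ?thesis
    by (simp add: prod_ennreal)
qed

text \<open>Decomposing \<open>D\<close> over disjoint bases makes its measure a sum and its void
  probability the matching product. From here on the model is replaced by its law.\<close>

lemma poisson_law_marked_points:
  shows "marked_points K X rho \<in> measurable M (conf UNIV)"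
    "poisson_law (distr M (conf UNIV) (marked_points K X rho)) lam nu"
proof -
  have ev: "{\<omega> \<in> space M. marked_points K X rho \<omega> \<inter> D = {}} \<in> events" if "D \<in> rects UNIV" for D
  proof -
    obtain m :: nat and A :: "nat \<Rightarrow> 'a set" and C :: "nat \<Rightarrow> real set"
    where D: "\<And>n. A n \<in> sets borel" "\<And>n. bounded (A n)" "disjoint_family A"
      "\<And>n. C n \<in> sets borel" "D = (\<Union>n<m. A n \<times> C n)"
      by (rule disjoint_rects[OF \<open>D \<in> rects UNIV\<close>]) (rule that; assumption)
    have "{\<omega> \<in> space M. marked_points K X rho \<omega> \<inter> D = {}} =
      space M - (\<Union>n<m. {\<omega> \<in> space M. marked_points K X rho \<omega> \<inter> A n \<times> C n \<noteq> {}})"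
      by (auto simp: D(5))
    also have "\<dots> \<in> events"
      using hits_event[OF D(1) D(4)] by (intro sets.compl_sets sets.finite_UN) auto
    finally show ?thesis .
  qed
  have pr: "prob {\<omega> \<in> space M. marked_points K X rho \<omega> \<inter> D = {}} = exp (- lam * measure (lborel \<Otimes>\<^sub>M nu) D)"
    if "D \<in> rects UNIV" for D
  proof -
    obtain m :: nat and A :: "nat \<Rightarrow> 'a set" and C :: "nat \<Rightarrow> real set"
    where A: "\<And>n. A n \<in> sets borel" "\<And>n. bounded (A n)" "disjoint_family A"
      and C: "\<And>n. C n \<in> sets borel" and D: "D = (\<Union>n<m. A n \<times> C n)"
      by (rule disjoint_rects[OF \<open>D \<in> rects UNIV\<close>]) (rule that; assumption)
    have fin: "emeasure (lborel \<Otimes>\<^sub>M nu) (A n \<times> C n) \<noteq> \<infinity>" for n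
      using emeasure_rects_finite[OF prob_space_nu sets_nu rects_Times[of "A n" UNIV "C n"]] A C by simp
    have "disjoint_family_on (\<lambda>n. A n \<times> C n) {..<m}"
      using A(3) unfolding disjoint_family_on_def by blast
    then have "measure (lborel \<Otimes>\<^sub>M nu) D = (\<Sum>n<m. measure (lborel \<Otimes>\<^sub>M nu) (A n \<times> C n))"
      unfolding D using A C fin sets_nu
      by (intro measure_finite_Union) (auto intro!: pair_measureI)
    also have "\<dots> = (\<Sum>n<m. measure lborel (A n) * measure nu (C n))"
      using A C by (simp add: measure_lborel_Times[OF prob_space_nu sets_nu])
    finally have "exp (- lam * measure (lborel \<Otimes>\<^sub>M nu) D) =
      (\<Prod>n<m. exp (- lam * (measure lborel (A n) * measure nu (C n))))"
      by (simp add: exp_sum[symmetric] sum_distrib_left sum_negf)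
    with void_disjoint_rects[where m = m, OF A C] show ?thesis
      by (simp add: D emeasure_eq_measure prod_nonneg)
  qed
  from poisson_law_distr[OF prob_space_axioms intensity_nonneg prob_space_nu sets_nu ev pr]
  show "marked_points K X rho \<in> measurable M (conf UNIV)"
    "poisson_law (distr M (conf UNIV) (marked_points K X rho)) lam nu"
    by simp_all
qed

end

section \<open>Multiscale recursion\<close>


text \<open>
  The window \<open>ball c (4 * R)\<close> contains the centres of all balls of radius less than \<open>R\<close> that meet
  \<open>cball c (2 * R)\<close>, and the windows of distant centres are disjoint.
\<close>

definition cross :: "'a::euclidean_space \<Rightarrow> real \<Rightarrow> ('a \<times> real) set \<Rightarrow> bool" where
  "cross c R \<Phi> \<longleftrightarrow> joined (\<Phi> \<inter> (ball c (4 * R) \<times> UNIV)) (sphere c R) (sphere c (2 * R))"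

definition crossp :: "('a::euclidean_space \<times> real) set measure \<Rightarrow> real \<Rightarrow> real" where
  "crossp Q R = measure Q {\<Phi>. cross 0 R \<Phi>}"

lemma cross_in_conf: "{\<Phi>. cross c R \<Phi>} \<in> sets (conf (ball c (4 * R)))"
  unfolding cross_def by (rule joined_in_conf) simp

lemma joined_hits: "joined (\<Phi> \<inter> D) A B \<Longrightarrow> \<Phi> \<inter> D \<noteq> {}"
  unfolding joined_def using path_component_mem(1) by (fastforce simp: white_def)

lemma ball_translate: "(\<lambda>x. x + c) ` ball 0 r = ball (c::'a::real_normed_vector) r"
  using ball_translation[of c 0 r] by (simp add: add.commute)

lemma sphere_translate: "(\<lambda>x. x + c) ` sphere 0 r = sphere (c::'a::real_normed_vector) r"
  using sphere_translation[of c 0 r] by (simp add: add.commute)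

text \<open>One compactness cover of the sphere of radius \<open>s\<close>, rescaled by
  \<open>R\<close>. That \<open>F\<close> does not depend on \<open>R\<close> makes the constant of
  the recursion independent of the scale.\<close>

lemma sphere_finite_cover:
  obtains F :: "'a::euclidean_space set" where "finite F" "F \<subseteq> sphere 0 s"
    "\<And>R p. 0 < R \<Longrightarrow> p \<in> sphere 0 (s * R) \<Longrightarrow> \<exists>c\<in>F. dist (R *\<^sub>R c) p < R"
proof -
  obtain F where F: "F \<subseteq> sphere (0::'a) s" "finite F" "sphere 0 s \<subseteq> (\<Union>c\<in>F. ball c 1)"
    by (rule compactE_image[of "sphere (0::'a) s" "sphere 0 s" "\<lambda>c. ball c 1"]) auto
  show thesis
  proof (rule that[OF F(2,1)])
    fix R :: real and p :: 'a assume R: "0 < R" "p \<in> sphere 0 (s * R)"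
    then have "(1 / R) *\<^sub>R p \<in> sphere 0 s" by simp
    then obtain c where c: "c \<in> F" "dist c ((1 / R) *\<^sub>R p) < 1"
      using F(3) by (meson UN_E mem_ball subsetD)
    have "dist (R *\<^sub>R c) (R *\<^sub>R ((1 / R) *\<^sub>R p)) = R * dist c ((1 / R) *\<^sub>R p)"
      using R(1) by (simp add: dist_norm del: scaleR_scaleR flip: scaleR_diff_right)
    also have "\<dots> < R" using c R(1) by simp
    finally show "\<exists>c\<in>F. dist (R *\<^sub>R c) p < R" using c(1) R(1) by auto
  qed
qed

text \<open>The path runs from \<open>p\<close> of norm \<open>10 * R\<close> to \<open>q\<close> of
  norm \<open>20 * R\<close>. A centre \<open>R *\<^sub>R c\<close> within \<open>R\<close> of
  \<open>p\<close> is at distance at least \<open>10 * R\<close> from \<open>q\<close>, so the path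
  crosses the annulus around this centre; the same path read backwards crosses the one around the
  centre near \<open>q\<close>.\<close>

lemma cross_multiscale:
  fixes F F' :: "'a::euclidean_space set"
  assumes R: "0 < R"
    and F: "F \<subseteq> sphere 0 10" "\<And>p. p \<in> sphere 0 (10 * R) \<Longrightarrow> \<exists>c\<in>F. dist (R *\<^sub>R c) p < R"
    and F': "F' \<subseteq> sphere 0 20" "\<And>p. p \<in> sphere 0 (20 * R) \<Longrightarrow> \<exists>c\<in>F'. dist (R *\<^sub>R c) p < R"
    and cr: "cross 0 (10 * R) \<Phi>" and small: "\<Phi> \<inter> (ball 0 (40 * R) \<times> {R..}) = {}"
  shows "\<exists>c\<in>F. \<exists>c'\<in>F'. cross (R *\<^sub>R c) R \<Phi> \<and> cross (R *\<^sub>R c') R \<Phi>"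
proof -
  define \<Psi> where "\<Psi> = \<Phi> \<inter> (ball 0 (40 * R) \<times> UNIV)"
  have lt: "r < R" if "(x, r) \<in> \<Psi>" for x r
    using small that by (force simp: \<Psi>_def)
  obtain p q where pq: "p \<in> sphere 0 (10 * R)" "q \<in> sphere 0 (20 * R)" "path_component (white \<Psi>) p q"
    using cr by (auto simp: cross_def joined_def \<Psi>_def)
  \<comment> \<open>With all radii below \<open>R\<close>, a ball meeting
    \<open>cball c (2 * R)\<close> is centred within \<open>3 * R\<close> of \<open>c\<close>,
    inside the window of radius \<open>4 * R\<close>.\<close>
  have local_cross: "cross c R \<Phi>"
    if "path_component (white \<Psi>) u v" "dist c u < R" "2 * R \<le> dist c v" for c u v
  proof -
    have "joined (\<Psi> \<inter> (ball c (4 * R) \<times> UNIV)) (sphere c R) (sphere c (2 * R))"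
    proof (rule joined_annulus[OF that(1)])
      fix x r assume "(x, r) \<in> \<Psi>" "dist c x < r + 2 * R"
      with lt[of x r] R show "x \<in> ball c (4 * R)" by simp
    qed (use that R in auto)
    then show ?thesis
      unfolding cross_def by (rule joined_mono) (auto simp: \<Psi>_def)
  qed
  obtain c where c: "c \<in> F" "dist (R *\<^sub>R c) p < R" using F(2) pq(1) by blast
  obtain c' where c': "c' \<in> F'" "dist (R *\<^sub>R c') q < R" using F'(2) pq(2) by blast
  have "norm c = 10" "norm c' = 20" using c c' F(1) F'(1) by auto
  then have n: "norm (R *\<^sub>R c) = 10 * R" "norm (R *\<^sub>R c') = 20 * R" using R by auto
  have "2 * R \<le> dist (R *\<^sub>R c) q" "2 * R \<le> dist (R *\<^sub>R c') p"
    using norm_triangle_ineq2[of q "R *\<^sub>R c"] norm_triangle_ineq2[of "R *\<^sub>R c'" p] n pq R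
    by (auto simp: dist_norm norm_minus_commute)
  then have "cross (R *\<^sub>R c) R \<Phi>" "cross (R *\<^sub>R c') R \<Phi>"
    using local_cross pq(3) c c' path_component_sym by blast+
  with c c' show ?thesis by blast
qed

lemma measure_lborel_ball:
  "0 \<le> r \<Longrightarrow> measure lborel (ball (c::'a::euclidean_space) r) = unit_ball_vol (real DIM('a)) * r ^ DIM('a)"
  by (simp add: content_ball)

context poisson_law
begin

lemma prob_cross: "prob {\<Phi>. cross c R \<Phi>} = crossp Q R"
  using prob_joined_translate[of "ball 0 (4 * R)" c "sphere 0 R" "sphere 0 (2 * R)"]
  unfolding crossp_def cross_def by (simp add: ball_translate sphere_translate)

lemma cross_event: "{\<Phi>. cross c R \<Phi>} \<in> events"
  using in_events[OF cross_in_conf] .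

lemma hits_event: "D \<in> rects UNIV \<Longrightarrow> {\<Phi>. \<Phi> \<inter> D \<noteq> {}} \<in> events"
  using in_events[OF hits_in_conf] .

lemma ball_Ici_rects: "ball c r \<times> {s..} \<in> rects (UNIV :: 'a set)"
  by (rule rects_Times) auto

lemma prob_hits_ball:
  assumes "0 \<le> r"
  shows "prob {\<Phi>. \<Phi> \<inter> (ball (0::'a) r \<times> {s..}) \<noteq> {}} \<le>
    lam * (unit_ball_vol (real DIM('a)) * r ^ DIM('a) * measure nu {s..})"
  using prob_hits_le[OF ball_Ici_rects, of 0 r s] measure_rects_Times[of "ball (0::'a) r" "{s..}"]
  by (simp add: measure_lborel_ball assms)

text \<open>Union bound over pairs of centres. Two centres of a pair are at least
  \<open>10 * R\<close> apart, so their windows of radius \<open>4 * R\<close> are disjoint and the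
  two crossings independent; translation invariance gives each the probability
  \<open>crossp Q R\<close>.\<close>

lemma crossp_multiscale:
  fixes F F' :: "'a set"
  assumes R: "0 < R"
    and F: "finite F" "F \<subseteq> sphere 0 10" "\<And>p. p \<in> sphere 0 (10 * R) \<Longrightarrow> \<exists>c\<in>F. dist (R *\<^sub>R c) p < R"
    and F': "finite F'" "F' \<subseteq> sphere 0 20" "\<And>p. p \<in> sphere 0 (20 * R) \<Longrightarrow> \<exists>c\<in>F'. dist (R *\<^sub>R c) p < R"
  shows "crossp Q (10 * R) \<le> real (card F * card F') * (crossp Q R)\<^sup>2 +
    prob {\<Phi>. \<Phi> \<inter> (ball 0 (40 * R) \<times> {R..}) \<noteq> {}}"
proof -
  let ?E = "\<lambda>(c, c'). {\<Phi>. cross (R *\<^sub>R c) R \<Phi>} \<inter> {\<Phi>. cross (R *\<^sub>R c') R \<Phi>}"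
  let ?H = "{\<Phi>. \<Phi> \<inter> (ball (0::'a) (40 * R) \<times> {R..}) \<noteq> {}}"
  have ev: "?E z \<in> events" for z
    using cross_event by (cases z) auto
  have pr: "prob (?E z) = (crossp Q R)\<^sup>2" if z: "z \<in> F \<times> F'" for z
  proof -
    obtain c c' where c: "z = (c, c')" "c \<in> F" "c' \<in> F'" using z by auto
    then have "norm c = 10" "norm c' = 20" using F(2) F'(2) by auto
    then have "norm (R *\<^sub>R c) = 10 * R" "norm (R *\<^sub>R c') = 20 * R" using R by auto
    then have "10 * R \<le> dist (R *\<^sub>R c) (R *\<^sub>R c')"
      using norm_triangle_ineq2[of "R *\<^sub>R c'" "R *\<^sub>R c"] by (simp add: dist_norm norm_minus_commute)
    then have "ball (R *\<^sub>R c) (4 * R) \<inter> ball (R *\<^sub>R c') (4 * R) = {}"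
      using R by (intro disjoint_ballI) simp
    then show ?thesis
      using conf_indep[OF _ cross_in_conf cross_in_conf] by (simp add: c prob_cross power2_eq_square)
  qed
  have "{\<Phi>. cross 0 (10 * R) \<Phi>} \<subseteq> (\<Union>z\<in>F \<times> F'. ?E z) \<union> ?H"
    using cross_multiscale[OF R F(2,3) F'(2,3)] by fast
  then have "crossp Q (10 * R) \<le> prob ((\<Union>z\<in>F \<times> F'. ?E z) \<union> ?H)"
    unfolding crossp_def using ev hits_event[OF ball_Ici_rects] F(1) F'(1)
    by (intro finite_measure_mono sets.Un sets.finite_UN) auto
  also have "\<dots> \<le> prob (\<Union>z\<in>F \<times> F'. ?E z) + prob ?H"
    using ev hits_event[OF ball_Ici_rects] F(1) F'(1)
    by (intro measure_Un_le sets.finite_UN) auto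
  also have "prob (\<Union>z\<in>F \<times> F'. ?E z) \<le> (\<Sum>z\<in>F \<times> F'. prob (?E z))"
    using ev F(1) F'(1) by (intro finite_measure_subadditive_finite) auto
  also have "\<dots> = (\<Sum>z\<in>F \<times> F'. (crossp Q R)\<^sup>2)"
    by (intro sum.cong refl pr)
  also have "\<dots> = real (card F * card F') * (crossp Q R)\<^sup>2"
    by (simp add: card_cartesian_product)
  finally show ?thesis by simp
qed

end

section \<open>Tail of the radii and balls coming from afar\<close>

lemma power_le_exp:
  assumes "0 \<le> (x::real)"
  shows "x ^ n \<le> fact n * exp x"
proof -
  have s: "(\<lambda>k. x ^ k / fact k) sums exp x"
    using exp_converges[of x] by (simp add: field_simps scaleR_conv_of_real)
  have "(\<Sum>k\<in>{n}. x ^ k / fact k) \<le> (\<Sum>k. x ^ k / fact k)"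
    using assms by (intro sum_le_suminf sums_summable[OF s]) auto
  then show ?thesis
    using sums_unique[OF s] by (simp add: field_simps)
qed

text \<open>The factor \<open>y ^ d\<close> pays for the volume in which a radius above
  \<open>y\<close> may occur; the remaining decay \<open>1 / y\<^sup>2\<close> makes the errors
  summable over shells and small at large scales.\<close>

lemma exp_small_tail_moment:
  assumes "exp_small_tail nu"
  obtains T where "0 \<le> T" "\<And>y. 1 \<le> y \<Longrightarrow> y ^ d * measure nu {y..} \<le> T / y\<^sup>2"
proof -
  obtain c where c: "0 < c" "\<And>r. 1 \<le> r \<Longrightarrow> measure nu {r..} \<le> exp (- c * r)"
    using assms by (auto simp: exp_small_tail_def)
  show thesis
  proof
    show "0 \<le> fact (d + 2) / c ^ (d + 2)" using c(1) by simp
    fix y :: real assume y: "1 \<le> y"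
    have "(c * y) ^ (d + 2) \<le> fact (d + 2) * exp (c * y)"
      using c(1) y by (intro power_le_exp) simp
    then have "y ^ (d + 2) * exp (- (c * y)) \<le> fact (d + 2) / c ^ (d + 2)"
      using c(1) by (simp add: field_simps power_mult_distrib exp_minus)
    moreover have "y ^ (d + 2) * measure nu {y..} \<le> y ^ (d + 2) * exp (- (c * y))"
      using c(2)[OF y] y by (intro mult_left_mono) auto
    ultimately have "y ^ (d + 2) * measure nu {y..} \<le> fact (d + 2) / c ^ (d + 2)"
      by (rule order_trans[rotated])
    then show "y ^ d * measure nu {y..} \<le> fact (d + 2) / c ^ (d + 2) / y\<^sup>2"
    proof -
      have "y ^ d * measure nu {y..} = y ^ (d + 2) * measure nu {y..} / y\<^sup>2"
        using y by (simp add: power_add power2_eq_square field_simps)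
      then show ?thesis
        using divide_right_mono[OF \<open>y ^ (d + 2) * measure nu {y..} \<le> fact (d + 2) / c ^ (d + 2)\<close>, of "y\<^sup>2"]
        by (simp only: zero_le_power2 simp_thms)
    qed
  qed
qed

text \<open>Countably many rectangles that catch every ball centred outside
  \<open>ball 0 (4 * R)\<close> and reaching into \<open>cball 0 (2 * R)\<close>.\<close>

definition far_hit :: "real \<Rightarrow> ('a::euclidean_space \<times> real) set \<Rightarrow> bool" where
  "far_hit R \<Phi> \<longleftrightarrow> (\<exists>k::nat. \<Phi> \<inter> (ball 0 ((real k + 4) * R) \<times> {(real k + 1) * R..}) \<noteq> {})"

lemma far_hitI:
  assumes "(x, r) \<in> \<Phi>" "0 < R" "4 * R \<le> norm x" "norm x < r + 2 * R"
  shows "far_hit R \<Phi>"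
proof -
  \<comment> \<open>So \<open>k + 3\<close> is the integer part of \<open>norm x / R\<close>, and
    the radius exceeds \<open>norm x - 2 * R\<close>, which is at least
    \<open>(k + 1) * R\<close>.\<close>
  define k where "k = nat \<lfloor>norm x / R\<rfloor> - 3"
  have "4 \<le> norm x / R"
    using assms(2,3) by (simp add: field_simps)
  then have "real k = real_of_int \<lfloor>norm x / R\<rfloor> - 3"
    unfolding k_def by linarith
  then have "real k + 3 \<le> norm x / R" "norm x / R < real k + 4"
    by linarith+
  then have "(real k + 3) * R \<le> norm x" "norm x < (real k + 4) * R"
    using assms(2) by (simp_all add: field_simps)
  then show ?thesis
    unfolding far_hit_def using assms by (intro exI[of _ k]) (auto simp: algebra_simps)
qed

text \<open>A component of an open set is path connected, so an unbounded one through
  \<open>p\<close> contains a path from \<open>p\<close> to beyond radius \<open>2 * R\<close>.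
  Without a far hit all balls used inside \<open>cball 0 (2 * R)\<close> are centred in the
  window.\<close>

lemma unbounded_component_crosses:
  fixes \<Phi> :: "('a::euclidean_space \<times> real) set"
  assumes "C \<in> components (white \<Phi>)" "\<not> bounded C" "p \<in> C" "norm p \<le> R" "0 < R"
  shows "cross 0 R \<Phi> \<or> far_hit R \<Phi>"
proof (rule disjCI)
  assume far: "\<not> far_hit R \<Phi>"
  obtain q where q: "q \<in> C" "2 * R < norm q"
    using assms(2) by (meson boundedI not_le)
  have "connected_component (white \<Phi>) p q"
    using assms(1,3) q(1) in_components_connected in_components_subset connected_component_def by metis
  then have "path_component (white \<Phi>) p q"
    using open_path_connected_component[OF open_white] by metis
  then show "cross 0 R \<Phi>"
    unfolding cross_def
  proof (rule joined_annulus)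
    fix x r assume "(x, r) \<in> \<Phi>" "dist 0 x < r + 2 * R"
    then show "x \<in> ball 0 (4 * R)"
      using far_hitI[of x r \<Phi> R] far assms(5) by (force simp: not_le)
  qed (use assms q in auto)
qed

context poisson_law
begin

lemma far_hit_event: "{\<Phi>. far_hit R \<Phi>} \<in> events"
proof -
  have "{\<Phi>. far_hit R \<Phi>} = (\<Union>k::nat. {\<Phi>. \<Phi> \<inter> (ball (0::'a) ((real k + 4) * R) \<times> {(real k + 1) * R..}) \<noteq> {}})"
    by (auto simp: far_hit_def)
  also have "\<dots> \<in> events"
    using hits_event[OF ball_Ici_rects] by (intro sets.countable_nat_UN) blast
  finally show ?thesis .
qed

text \<open>Union bound with \<open>y = (k + 1) * R\<close>: the ball of radius
  \<open>(k + 4) * R\<close> is contained in that of radius \<open>4 * y\<close>, so each term is of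
  order \<open>1 / y\<^sup>2\<close> and the series in \<open>k\<close> converges.\<close>

lemma prob_far_hit_le:
  assumes T: "\<And>y. 1 \<le> y \<Longrightarrow> y ^ DIM('a) * measure nu {y..} \<le> T / y\<^sup>2" and R: "1 \<le> R"
  shows "prob {\<Phi>. far_hit R \<Phi>} \<le>
    lam * unit_ball_vol (real DIM('a)) * 4 ^ DIM('a) * T * (\<Sum>k. 1 / (real k + 1)\<^sup>2) / R\<^sup>2"
proof -
  let ?v = "unit_ball_vol (real DIM('a))"
  let ?H = "\<lambda>k::nat. {\<Phi>. \<Phi> \<inter> (ball (0::'a) ((real k + 4) * R) \<times> {(real k + 1) * R..}) \<noteq> {}}"
  let ?G = "lam * ?v * 4 ^ DIM('a) * T / R\<^sup>2"
  have le: "prob (?H k) \<le> ?G * (1 / (real k + 1)\<^sup>2)" for k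
  proof -
    define y where "y = (real k + 1) * R"
    have y: "1 \<le> y" using R mult_mono[of 1 "real k + 1" 1 R] by (simp add: y_def)
    have "(real k + 4) * R \<le> 4 * y" using R by (simp add: y_def algebra_simps)
    then have "((real k + 4) * R) ^ DIM('a) \<le> 4 ^ DIM('a) * y ^ DIM('a)"
      using R power_mono[of "(real k + 4) * R" "4 * y" "DIM('a)"] by (simp add: power_mult_distrib)
    then have "?v * ((real k + 4) * R) ^ DIM('a) * measure nu {y..} \<le> ?v * (4 ^ DIM('a) * y ^ DIM('a)) * measure nu {y..}"
      by (intro mult_right_mono mult_left_mono) auto
    also have "\<dots> = ?v * 4 ^ DIM('a) * (y ^ DIM('a) * measure nu {y..})" by simp
    also have "\<dots> \<le> ?v * 4 ^ DIM('a) * (T / y\<^sup>2)"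
      using T[OF y] by (intro mult_left_mono) auto
    finally have "lam * (?v * ((real k + 4) * R) ^ DIM('a) * measure nu {y..}) \<le> lam * (?v * 4 ^ DIM('a) * (T / y\<^sup>2))"
      using lam_nonneg by (intro mult_left_mono)
    moreover have "prob (?H k) \<le> lam * (?v * ((real k + 4) * R) ^ DIM('a) * measure nu {y..})"
      unfolding y_def using R by (intro prob_hits_ball) simp
    ultimately have "prob (?H k) \<le> lam * (?v * 4 ^ DIM('a) * (T / y\<^sup>2))"
      by (rule order_trans[rotated])
    also have "\<dots> = ?G * (1 / (real k + 1)\<^sup>2)"
      by (simp add: y_def power_mult_distrib mult_ac)
    finally show ?thesis .
  qed
  have summ: "summable (\<lambda>k. 1 / (real k + 1)\<^sup>2)"
    using sums_summable[OF inverse_squares_sums] by (simp add: add.commute)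
  have summH: "summable (\<lambda>k. prob (?H k))"
    by (rule summable_comparison_test'[OF summable_mult[OF summ, of ?G], of 0]) (use le in simp)
  have "{\<Phi>. far_hit R \<Phi>} = (\<Union>k. ?H k)"
    by (auto simp: far_hit_def)
  also have "prob (\<Union>k. ?H k) \<le> (\<Sum>k. prob (?H k))"
    using hits_event[OF ball_Ici_rects] by (intro finite_measure_subadditive_countably summH) auto
  also have "\<dots> \<le> (\<Sum>k. ?G * (1 / (real k + 1)\<^sup>2))"
    by (intro suminf_le le summH summable_mult summ)
  also have "\<dots> = ?G * (\<Sum>k. 1 / (real k + 1)\<^sup>2)"
    by (rule suminf_mult[OF summ])
  finally show ?thesis by (simp add: field_simps)
qed

text \<open>\<open>E n\<close> is a crossing or a far hit at scale \<open>10 ^ n * R\<close>, and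
  its probability tends to 0. Hence it is impossible, up to a null set, that all \<open>E n\<close>
  beyond some rank occur. A point of an unbounded component lies within all large scales, and a
  large scale where \<open>E n\<close> fails contradicts unboundedness.\<close>

lemma AE_bounded_components:
  assumes T: "\<And>y. 1 \<le> y \<Longrightarrow> y ^ DIM('a) * measure nu {y..} \<le> T / y\<^sup>2" and R: "1 \<le> R"
    and lim: "(\<lambda>n. crossp Q (10 ^ n * R)) \<longlonglongrightarrow> 0"
  shows "AE \<Phi> in Q. \<forall>C\<in>components (white \<Phi>). bounded C"
proof -
  define E where "E n = {\<Phi>. cross 0 (10 ^ n * R) \<Phi>} \<union> {\<Phi>. far_hit (10 ^ n * R) (\<Phi> :: ('a \<times> real) set)}" for n :: nat
  have ev: "E n \<in> events" for n
    unfolding E_def using cross_event far_hit_event by blast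
  define G where "G = lam * unit_ball_vol (real DIM('a)) * 4 ^ DIM('a) * T * (\<Sum>k. 1 / (real k + 1)\<^sup>2) / R\<^sup>2"
  have R': "1 \<le> 10 ^ n * R" for n :: nat
    using R mult_mono[of 1 "10 ^ n" 1 R] by simp
  have le: "prob (E n) \<le> crossp Q (10 ^ n * R) + G * (1 / 100) ^ n" for n
  proof -
    have "prob (E n) \<le> crossp Q (10 ^ n * R) + prob {\<Phi>. far_hit (10 ^ n * R) \<Phi>}"
      unfolding E_def crossp_def using cross_event far_hit_event by (intro measure_Un_le) auto
    also have "prob {\<Phi>. far_hit (10 ^ n * R) \<Phi>} \<le> G * (1 / 100) ^ n"
    proof -
      have "(10 ^ n)\<^sup>2 = (100 :: real) ^ n"
        by (simp add: power2_eq_square flip: power_mult_distrib)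
      then show ?thesis
        using prob_far_hit_le[OF T R'[of n]] by (simp add: G_def power_mult_distrib power_divide mult.commute)
    qed
    finally show ?thesis by simp
  qed
  have "(\<lambda>n. crossp Q (10 ^ n * R) + G * (1 / 100) ^ n) \<longlonglongrightarrow> 0 + G * 0"
    by (intro tendsto_intros lim LIMSEQ_realpow_zero) auto
  then have lim0: "(\<lambda>n. crossp Q (10 ^ n * R) + G * (1 / 100) ^ n) \<longlonglongrightarrow> 0" by simp
  have "AE \<Phi> in Q. \<exists>n\<ge>m. \<Phi> \<notin> E n" for m
  proof -
    define B where "B = (\<Inter>n\<in>{m..}. E n)"
    have B: "B \<in> events" unfolding B_def using ev sets.top[of Q] by (intro sets.countable_INT'') auto
    have "prob B \<le> 0"
    proof (rule LIMSEQ_le_const[OF lim0])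
      have "prob B \<le> prob (E n)" if "m \<le> n" for n
        using that ev by (intro finite_measure_mono) (auto simp: B_def)
      then show "\<exists>N. \<forall>n\<ge>N. prob B \<le> crossp Q (10 ^ n * R) + G * (1 / 100) ^ n"
        using le order_trans by blast
    qed
    then have "AE \<Phi> in Q. \<Phi> \<notin> B"
      using B prob_eq_0[OF B] measure_nonneg[of Q B] by simp
    then show ?thesis by eventually_elim (auto simp: B_def)
  qed
  then have "AE \<Phi> in Q. \<forall>m. \<exists>n\<ge>m. \<Phi> \<notin> E n"
    unfolding AE_all_countable by blast
  then show ?thesis
  proof eventually_elim
    case (elim \<Phi>)
    show ?case
    proof (rule ballI, rule ccontr)
      fix C assume C: "C \<in> components (white \<Phi>)" "\<not> bounded C"
      then obtain p where p: "p \<in> C" by fastforce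
      obtain m :: nat where m: "norm p < 10 ^ m"
        using real_arch_pow[of 10 "norm p"] by auto
      obtain n where n: "m \<le> n" "\<Phi> \<notin> E n" using elim by blast
      have "norm p \<le> 10 ^ m" using m by simp
      also have "\<dots> \<le> 10 ^ n" using n(1) by (intro power_increasing) auto
      also have "\<dots> \<le> 10 ^ n * R" using R by simp
      finally have "norm p \<le> 10 ^ n * R" .
      from unbounded_component_crosses[OF C p this] n(2) R'[of n] show False
        by (auto simp: E_def)
    qed
  qed
qed

end

text \<open>Multiplying by \<open>C\<close>, which exceeds the number of pairs of centres, turns the
  recursion into \<open>u (10 * \<rho>) \<le> (u \<rho>)\<^sup>2 + G / \<rho>\<^sup>2\<close>. If
  \<open>u \<le> 2 ^ (-n) / 4\<close>, square and error are each at most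
  \<open>2 ^ (-n) / 16\<close>, which halves the bound. The constants are uniform over intensities
  up to \<open>L\<close>.\<close>

lemma subcritical_crossing:
  fixes nu :: "real measure"
  assumes T: "0 \<le> T" "\<And>y. 1 \<le> y \<Longrightarrow> y ^ DIM('a::euclidean_space) * measure nu {y..} \<le> T / y\<^sup>2"
    and L: "0 \<le> L"
  obtains C R0 where "1 \<le> C" "1 \<le> R0"
    "\<And>(Q :: ('a \<times> real) set measure) lam R n. poisson_law Q lam nu \<Longrightarrow> lam \<le> L \<Longrightarrow> R0 \<le> R \<Longrightarrow>
      C * crossp Q R \<le> 1 / 4 \<Longrightarrow> C * crossp Q (10 ^ n * R) \<le> (1 / 2) ^ n / 4"
proof -
  obtain F :: "'a set" where F: "finite F" "F \<subseteq> sphere 0 10"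
    "\<And>R p. 0 < R \<Longrightarrow> p \<in> sphere 0 (10 * R) \<Longrightarrow> \<exists>c\<in>F. dist (R *\<^sub>R c) p < R"
    by (rule sphere_finite_cover[of 10]) (rule that; assumption)
  obtain F' :: "'a set" where F': "finite F'" "F' \<subseteq> sphere 0 20"
    "\<And>R p. 0 < R \<Longrightarrow> p \<in> sphere 0 (20 * R) \<Longrightarrow> \<exists>c\<in>F'. dist (R *\<^sub>R c) p < R"
    by (rule sphere_finite_cover[of 20]) (rule that; assumption)
  define v where "v = unit_ball_vol (real DIM('a))"
  have v: "0 \<le> v" by (simp add: v_def)
  define C where "C = 1 + real (card F * card F')"
  define G where "G = C * L * v * 40 ^ DIM('a) * T"
  have C: "1 \<le> C" by (simp add: C_def)
  have G: "0 \<le> G" using C L v T by (simp add: G_def)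
  show thesis
  proof
    show "1 \<le> C" by fact
    show "1 \<le> max 1 (16 * G)" by simp
    fix Q :: "('a \<times> real) set measure" and lam R n
    assume Q: "poisson_law Q lam nu" and lam: "lam \<le> L" and R: "max 1 (16 * G) \<le> R"
      and base: "C * crossp Q R \<le> 1 / 4"
    interpret poisson_law Q lam nu by fact
    have step: "C * crossp Q (10 * \<rho>) \<le> (C * crossp Q \<rho>)\<^sup>2 + G / \<rho>\<^sup>2" if "1 \<le> \<rho>" for \<rho>
    proof -
      have "prob {\<Phi>. \<Phi> \<inter> (ball (0::'a) (40 * \<rho>) \<times> {\<rho>..}) \<noteq> {}} \<le> lam * (v * (40 * \<rho>) ^ DIM('a) * measure nu {\<rho>..})"
        unfolding v_def using that by (intro prob_hits_ball) simp
      also have "\<dots> = lam * (v * 40 ^ DIM('a) * (\<rho> ^ DIM('a) * measure nu {\<rho>..}))"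
        by (simp add: power_mult_distrib)
      also have "\<dots> \<le> L * (v * 40 ^ DIM('a) * (T / \<rho>\<^sup>2))"
        using T(2)[OF that] lam lam_nonneg v that by (intro mult_mono) auto
      finally have err: "C * prob {\<Phi>. \<Phi> \<inter> (ball (0::'a) (40 * \<rho>) \<times> {\<rho>..}) \<noteq> {}} \<le> G / \<rho>\<^sup>2"
        using mult_left_mono[of _ _ C] C by (fastforce simp: G_def)
      have "crossp Q (10 * \<rho>) \<le> real (card F * card F') * (crossp Q \<rho>)\<^sup>2 +
        prob {\<Phi>. \<Phi> \<inter> (ball (0::'a) (40 * \<rho>) \<times> {\<rho>..}) \<noteq> {}}"
        using that F F' by (intro crossp_multiscale) auto
      also have "\<dots> \<le> C * (crossp Q \<rho>)\<^sup>2 + prob {\<Phi>. \<Phi> \<inter> (ball (0::'a) (40 * \<rho>) \<times> {\<rho>..}) \<noteq> {}}"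
        by (intro add_right_mono mult_right_mono) (auto simp: C_def)
      finally have "C * crossp Q (10 * \<rho>) \<le> C * (C * (crossp Q \<rho>)\<^sup>2 + prob {\<Phi>. \<Phi> \<inter> (ball (0::'a) (40 * \<rho>) \<times> {\<rho>..}) \<noteq> {}})"
        using C by (intro mult_left_mono) auto
      with err show ?thesis
        by (simp add: algebra_simps power2_eq_square)
    qed
    show "C * crossp Q (10 ^ n * R) \<le> (1 / 2) ^ n / 4"
    proof (induction n)
      case 0
      with base show ?case by simp
    next
      case (Suc n)
      define \<rho> where "\<rho> = 10 ^ n * R"
      have rho1: "1 \<le> \<rho>" using R mult_mono[of 1 "10 ^ n" 1 R] by (simp add: \<rho>_def)
      have small: "G / \<rho>\<^sup>2 \<le> (1 / 2) ^ n / 16"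
      proof -
        \<comment> \<open>The threshold \<open>16 * G \<le> R\<close> was chosen for this, together
          with \<open>2 ^ n \<le> 10 ^ n\<close>.\<close>
        have "G * 16 * 2 ^ n \<le> R * 10 ^ n"
          using R by (intro mult_mono power_mono) auto
        also have "\<dots> = \<rho>" by (simp add: \<rho>_def)
        also have "\<dots> \<le> \<rho>\<^sup>2" using rho1 by (simp add: power2_eq_square)
        finally show ?thesis using rho1 by (simp add: field_simps)
      qed
      have "(C * crossp Q \<rho>)\<^sup>2 \<le> ((1 / 2) ^ n / 4)\<^sup>2"
        using Suc C by (intro power_mono) (auto simp: \<rho>_def crossp_def)
      also have "\<dots> = (1 / 2) ^ n * (1 / 2) ^ n / 16" by (simp add: power2_eq_square)
      also have "\<dots> \<le> (1 / 2) ^ n * 1 / 16"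
        by (intro divide_right_mono mult_left_mono power_le_one) auto
      finally have "C * crossp Q (10 * \<rho>) \<le> (1 / 2) ^ n / 16 + (1 / 2) ^ n / 16"
        using step[OF rho1] small by linarith
      then show ?case by (simp add: \<rho>_def mult.assoc)
    qed
  qed
qed

text \<open>A condition at one scale, with constants common to all intensities up to
  \<open>L\<close>. This uniformity allows the scale to be fixed before the intensity is
  raised.\<close>

lemma subcritical_criterion:
  fixes nu :: "real measure"
  assumes "exp_small_tail nu" and L: "0 \<le> L"
  obtains C R0 where "1 \<le> C" "1 \<le> R0"
    "\<forall>lam R. lam \<le> L \<longrightarrow> R0 \<le> R \<longrightarrow>
      (\<forall>Q :: ('a::euclidean_space \<times> real) set measure. poisson_law Q lam nu \<longrightarrow> C * crossp Q R \<le> 1 / 4) \<longrightarrow>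
      as_no_unbounded_white TYPE('a) nu lam"
proof -
  obtain T where T: "0 \<le> T" "\<And>y. 1 \<le> y \<Longrightarrow> y ^ DIM('a) * measure nu {y..} \<le> T / y\<^sup>2"
    using exp_small_tail_moment[OF assms(1)] by metis
  obtain C R0 where CR: "1 \<le> C" "1 \<le> R0"
    "\<And>(Q :: ('a \<times> real) set measure) lam R n. poisson_law Q lam nu \<Longrightarrow> lam \<le> L \<Longrightarrow> R0 \<le> R \<Longrightarrow>
      C * crossp Q R \<le> 1 / 4 \<Longrightarrow> C * crossp Q (10 ^ n * R) \<le> (1 / 2) ^ n / 4"
    by (rule subcritical_crossing[OF T L]) (assumption | (rule that; assumption))+
  show thesis
  proof
    show "1 \<le> C" "1 \<le> R0" by fact+
    show "\<forall>lam R. lam \<le> L \<longrightarrow> R0 \<le> R \<longrightarrow>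
      (\<forall>Q :: ('a \<times> real) set measure. poisson_law Q lam nu \<longrightarrow> C * crossp Q R \<le> 1 / 4) \<longrightarrow>
      as_no_unbounded_white TYPE('a) nu lam"
      unfolding as_no_unbounded_white_def
    proof (intro allI impI)
      fix lam R
      assume lam: "lam \<le> L" and R: "R0 \<le> R"
        and small: "\<forall>Q :: ('a \<times> real) set measure. poisson_law Q lam nu \<longrightarrow> C * crossp Q R \<le> 1 / 4"
      fix P :: "'a marked_sequence measure" and K and X :: "nat \<Rightarrow> 'a marked_sequence \<Rightarrow> 'a" and rho
      assume "boolean_model P lam K X nu rho"
      then interpret boolean_model P lam K X nu rho .
      define Q where "Q = distr P (conf UNIV) (marked_points K X rho)"
      interpret Q: poisson_law Q lam nu
        unfolding Q_def by (rule poisson_law_marked_points)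
      have "(\<lambda>n. crossp Q (10 ^ n * R)) \<longlonglongrightarrow> 0"
      proof (rule tendsto_sandwich[OF _ _ tendsto_const])
        show "\<forall>\<^sub>F n in sequentially. 0 \<le> crossp Q (10 ^ n * R)"
          by (simp add: crossp_def)
        have "crossp Q (10 ^ n * R) \<le> (1 / 2) ^ n" for n
        proof -
          have "crossp Q (10 ^ n * R) \<le> C * crossp Q (10 ^ n * R)"
            using CR(1) mult_right_mono[of 1 C "crossp Q (10 ^ n * R)"] by (simp add: crossp_def)
          also have "\<dots> \<le> (1 / 2) ^ n / 4"
            using CR(3)[OF Q.poisson_law_axioms lam R small[rule_format, OF Q.poisson_law_axioms]] .
          also have "\<dots> \<le> (1 / 2) ^ n" by simp
          finally show ?thesis .
        qed
        then show "\<forall>\<^sub>F n in sequentially. crossp Q (10 ^ n * R) \<le> (1 / 2) ^ n" by simp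
        show "(\<lambda>n. (1 / 2) ^ n) \<longlonglongrightarrow> (0::real)"
          by (rule LIMSEQ_realpow_zero) auto
      qed
      then have "AE \<Phi> in Q. \<forall>C\<in>components (white \<Phi>). bounded C"
        by (rule Q.AE_bounded_components[OF T(2), rotated 2]) (use CR(2) R in auto)
      then have "AE \<omega> in P. \<forall>C\<in>components (white (marked_points K X rho \<omega>)). bounded C"
        unfolding Q_def by (rule AE_distrD[OF poisson_law_marked_points(1)])
      then show "AE \<omega> in P. no_unbounded_white (boolean_colouring K X rho \<omega>)"
        by (simp add: no_unbounded_white_def boolean_colouring_white)
    qed
  qed
qed

section \<open>Poisson laws from generating functions\<close>


text \<open>When the coefficients before \<open>m\<close> vanish, dividing the series by
  \<open>s ^ m\<close> and letting \<open>s\<close> decrease to 0 isolates \<open>a m\<close>. Only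
  positive \<open>s\<close> are used because generating functions are given on the unit
  interval.\<close>

lemma power_series_eq_0:
  fixes a :: "nat \<Rightarrow> real"
  assumes summ: "summable (\<lambda>k. \<bar>a k\<bar>)"
    and zero: "\<And>s. 0 < s \<Longrightarrow> s < 1 \<Longrightarrow> (\<Sum>k. a k * s ^ k) = 0"
  shows "a m = 0"
proof (induction m rule: less_induct)
  case (less m)
  have bnd: "summable (\<lambda>k. a (k + m) * x ^ k)" if "norm x < 1" for x :: real
  proof (rule summable_comparison_test'[where N = 0])
    show "summable (\<lambda>k. \<bar>a (k + m)\<bar>)"
      using summable_ignore_initial_segment[OF summ, of m] .
    fix k show "norm (a (k + m) * x ^ k) \<le> \<bar>a (k + m)\<bar>"
      using that power_le_one[of "\<bar>x\<bar>" k] by (simp add: abs_mult power_abs mult_left_le)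
  qed
  define f where "f x = (\<Sum>k. a (k + m) * x ^ k)" for x
  have "(f \<longlongrightarrow> a (0 + m)) (at 0)"
    using bnd by (intro powser_limit_0[of 1 "\<lambda>k. a (k + m)" f]) (auto simp: f_def intro: summable_sums)
  then have lim: "(f \<longlongrightarrow> a m) (at_right 0)"
    by (simp add: filterlim_at_split)
  have "f s = 0" if s: "0 < s" "s < 1" for s
  proof -
    have "summable (\<lambda>k. a k * s ^ k)"
    proof (rule summable_comparison_test'[where N = 0, OF summ])
      fix k show "norm (a k * s ^ k) \<le> \<bar>a k\<bar>"
        using s power_le_one[of s k] by (simp add: abs_mult mult_left_le)
    qed
    then have "(\<Sum>k. a k * s ^ k) = (\<Sum>k. a (k + m) * s ^ (k + m)) + (\<Sum>k<m. a k * s ^ k)"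
      by (rule suminf_split_initial_segment)
    also have "(\<Sum>k<m. a k * s ^ k) = 0"
      using less by simp
    also have "(\<Sum>k. a (k + m) * s ^ (k + m)) = s ^ m * f s"
      unfolding f_def using bnd[of s] s by (subst suminf_mult[symmetric]) (auto simp: power_add mult_ac)
    finally show ?thesis using zero[OF s] s by simp
  qed
  then have "\<forall>\<^sub>F s in at_right 0. f s = 0"
    unfolding eventually_at_right_field by (intro exI[of _ 1]) auto
  then have "(f \<longlongrightarrow> 0) (at_right 0)"
    by (rule tendsto_eventually)
  with lim show ?case
    using tendsto_unique[of "at_right (0::real)"] by auto
qed

text \<open>The weight \<open>W\<close> stands for the contribution of other variables, which
  permits extracting one variable at a time. The weighted masses and the Poisson weights are both
  summable and have the same power series on the unit interval.\<close>

lemma poisson_coefficients_of_pgf: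
  assumes Z: "Z \<in> measurable M (count_space (UNIV :: nat set))" and W: "W \<in> borel_measurable M"
    and l: "0 \<le> l" and c: "0 \<le> c"
    and pgf: "\<And>s. 0 \<le> s \<Longrightarrow> s \<le> 1 \<Longrightarrow>
      (\<integral>\<^sup>+\<omega>. W \<omega> * ennreal (s ^ Z \<omega>) \<partial>M) = ennreal (c * exp (- l * (1 - s)))"
  shows "(\<integral>\<^sup>+\<omega>. W \<omega> * indicator {\<omega> \<in> space M. Z \<omega> = v} \<omega> \<partial>M) = ennreal (c * (exp (- l) * l ^ v / fact v))"
proof -
  let ?Z = "\<lambda>k. {\<omega> \<in> space M. Z \<omega> = k}"
  have ev: "?Z k \<in> sets M" for k
    using measurable_sets[OF Z, of "{k}"] by (simp add: vimage_def Int_def conj_commute)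
  have total: "(\<integral>\<^sup>+\<omega>. W \<omega> \<partial>M) = ennreal c"
    using pgf[of 1] by simp
  define \<alpha> where "\<alpha> k = enn2real (\<integral>\<^sup>+\<omega>. W \<omega> * indicator (?Z k) \<omega> \<partial>M)" for k
  have \<alpha>: "(\<integral>\<^sup>+\<omega>. W \<omega> * indicator (?Z k) \<omega> \<partial>M) = ennreal (\<alpha> k)" for k
  proof -
    have "(\<integral>\<^sup>+\<omega>. W \<omega> * indicator (?Z k) \<omega> \<partial>M) \<le> (\<integral>\<^sup>+\<omega>. W \<omega> \<partial>M)"
      by (intro nn_integral_mono) (auto simp: indicator_def)
    then have "(\<integral>\<^sup>+\<omega>. W \<omega> * indicator (?Z k) \<omega> \<partial>M) < top"
      unfolding total using ennreal_less_top le_less_trans by blast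
    then show ?thesis by (simp add: \<alpha>_def)
  qed
  have \<alpha>0: "0 \<le> \<alpha> k" for k by (simp add: \<alpha>_def)
  have sums_\<alpha>: "(\<lambda>k. \<alpha> k * s ^ k) sums (c * exp (- l * (1 - s)))" if s: "0 \<le> s" "s \<le> 1" for s
  proof -
    have "ennreal (c * exp (- l * (1 - s))) = (\<Sum>k. \<integral>\<^sup>+\<omega>. indicator (?Z k) \<omega> * (W \<omega> * ennreal (s ^ k)) \<partial>M)"
      unfolding pgf[OF s, symmetric] by (rule nn_integral_split_nat[OF Z]) (use W in auto)
    also have "\<dots> = (\<Sum>k. ennreal (\<alpha> k * s ^ k))"
    proof (intro arg_cong[where f = suminf] ext)
      fix k
      have "(\<integral>\<^sup>+\<omega>. indicator (?Z k) \<omega> * (W \<omega> * ennreal (s ^ k)) \<partial>M) =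
        (\<integral>\<^sup>+\<omega>. (W \<omega> * indicator (?Z k) \<omega>) * ennreal (s ^ k) \<partial>M)"
        by (simp add: mult_ac)
      also have "\<dots> = (\<integral>\<^sup>+\<omega>. W \<omega> * indicator (?Z k) \<omega> \<partial>M) * ennreal (s ^ k)"
        using W ev by (intro nn_integral_multc) auto
      finally show "(\<integral>\<^sup>+\<omega>. indicator (?Z k) \<omega> * (W \<omega> * ennreal (s ^ k)) \<partial>M) = ennreal (\<alpha> k * s ^ k)"
        using \<alpha>0 s by (simp add: \<alpha> ennreal_mult)
    qed
    finally have eq: "(\<Sum>k. ennreal (\<alpha> k * s ^ k)) = ennreal (c * exp (- l * (1 - s)))" by simp
    have nonneg: "0 \<le> \<alpha> k * s ^ k" for k using \<alpha>0 s by simp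
    have "summable (\<lambda>k. \<alpha> k * s ^ k)"
      by (rule summable_suminf_not_top) (use nonneg eq in auto)
    then show ?thesis
      using eq nonneg c by (simp add: suminf_ennreal2 suminf_nonneg sums_iff)
  qed
  define \<beta> where "\<beta> k = \<alpha> k - c * (exp (- l) * l ^ k / fact k)" for k
  have sums_p: "(\<lambda>k. c * (exp (- l) * l ^ k / fact k) * s ^ k) sums (c * exp (- l * (1 - s)))" for s
  proof -
    have "(\<lambda>k. c * exp (- l) * ((l * s) ^ k /\<^sub>R fact k)) sums (c * exp (- l) * exp (l * s))"
      by (intro sums_mult exp_converges)
    moreover have "c * exp (- l) * exp (l * s) = c * exp (- l * (1 - s))"
      by (simp add: algebra_simps flip: exp_add)
    moreover have "(\<lambda>k. c * exp (- l) * ((l * s) ^ k /\<^sub>R fact k)) = (\<lambda>k. c * (exp (- l) * l ^ k / fact k) * s ^ k)"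
      by (intro ext) (simp add: power_mult_distrib field_simps)
    ultimately show ?thesis by simp
  qed
  have "\<beta> v = 0"
  proof (rule power_series_eq_0)
    have "summable (\<lambda>k. \<alpha> k + c * (exp (- l) * l ^ k / fact k))"
      using sums_\<alpha>[of 1] sums_p[of 1] by (intro summable_add) (auto simp: sums_iff)
    then show "summable (\<lambda>k. \<bar>\<beta> k\<bar>)"
    proof (rule summable_comparison_test'[where N = 0])
      fix k show "norm \<bar>\<beta> k\<bar> \<le> \<alpha> k + c * (exp (- l) * l ^ k / fact k)"
      proof -
        have "0 \<le> c * (exp (- l) * l ^ k / fact k)"
          using c l by (intro mult_nonneg_nonneg divide_nonneg_nonneg) auto
        moreover have "\<bar>x - y\<bar> \<le> x + y" if "0 \<le> x" "0 \<le> y" for x y :: real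
          using that by simp
        ultimately show ?thesis
          using \<alpha>0[of k] unfolding \<beta>_def real_norm_def abs_idempotent by blast
      qed
    qed
    fix s :: real assume "0 < s" "s < 1"
    then show "(\<Sum>k. \<beta> k * s ^ k) = 0"
      using sums_diff[OF sums_\<alpha>[of s] sums_p[of s]] by (simp add: \<beta>_def left_diff_distrib sums_iff)
  qed
  then show ?thesis by (simp add: \<alpha> \<beta>_def)
qed

text \<open>Each induction step trades one factor \<open>s ^ Z\<close> for the indicator of
  \<open>Z = v\<close>; the indicator is absorbed into \<open>W\<close> and the Poisson mass into
  \<open>c\<close>.\<close>

lemma poisson_joint_of_pgf:
  fixes Z :: "'i \<Rightarrow> 'w \<Rightarrow> nat"
  assumes "finite J" and Z: "\<And>n. n \<in> J \<Longrightarrow> Z n \<in> measurable M (count_space UNIV)"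
    and l: "\<And>n. n \<in> J \<Longrightarrow> 0 \<le> l n" and W: "W \<in> borel_measurable M" and c: "0 \<le> c"
    and pgf: "\<And>s. (\<And>n. 0 \<le> s n \<and> s n \<le> 1) \<Longrightarrow>
      (\<integral>\<^sup>+\<omega>. W \<omega> * (\<Prod>n\<in>J. ennreal (s n ^ Z n \<omega>)) \<partial>M) = ennreal (c * (\<Prod>n\<in>J. exp (- l n * (1 - s n))))"
  shows "(\<integral>\<^sup>+\<omega>. W \<omega> * (\<Prod>n\<in>J. indicator {\<omega> \<in> space M. Z n \<omega> = v n} \<omega>) \<partial>M) =
    ennreal (c * (\<Prod>n\<in>J. exp (- l n) * l n ^ v n / fact (v n)))"
  using assms
proof (induction J arbitrary: W c rule: finite_induct)
  case empty
  then show ?case using empty(5)[of "\<lambda>_. 0"] by simp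
next
  case (insert m J)
  let ?W = "\<lambda>\<omega>. W \<omega> * indicator {\<omega> \<in> space M. Z m \<omega> = v m} \<omega>"
  let ?c = "c * (exp (- l m) * l m ^ v m / fact (v m))"
  have Zm: "Z m \<in> measurable M (count_space UNIV)" and Zn: "\<And>n. n \<in> J \<Longrightarrow> Z n \<in> measurable M (count_space UNIV)"
    using insert.prems(1) by auto
  have ev: "{\<omega> \<in> space M. Z m \<omega> = k} \<in> sets M" for k
    using measurable_sets[OF Zm, of "{k}"] by (simp add: vimage_def Int_def conj_commute)
  have "(\<integral>\<^sup>+\<omega>. ?W \<omega> * (\<Prod>n\<in>J. indicator {\<omega> \<in> space M. Z n \<omega> = v n} \<omega>) \<partial>M) =
    ennreal (?c * (\<Prod>n\<in>J. exp (- l n) * l n ^ v n / fact (v n)))"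
  proof (rule insert.IH)
    show "\<And>n. n \<in> J \<Longrightarrow> Z n \<in> measurable M (count_space UNIV)" "\<And>n. n \<in> J \<Longrightarrow> 0 \<le> l n"
      using insert.prems by auto
    show "?W \<in> borel_measurable M" using insert.prems(3) ev by auto
    show "0 \<le> ?c" using insert.prems by auto
    fix s :: "'i \<Rightarrow> real" assume s: "\<And>n. 0 \<le> s n \<and> s n \<le> 1"
    define W' where "W' \<omega> = W \<omega> * (\<Prod>n\<in>J. ennreal (s n ^ Z n \<omega>))" for \<omega>
    have "(\<lambda>\<omega>. ennreal (s n ^ Z n \<omega>)) \<in> borel_measurable M" if "n \<in> J" for n
      using measurable_compose[OF Zn[OF that], of "\<lambda>k. ennreal (s n ^ k)"] by simp
    then have W': "W' \<in> borel_measurable M"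
      unfolding W'_def using insert.prems(3) by (intro borel_measurable_times_ennreal borel_measurable_prod_ennreal) auto
    have "(\<integral>\<^sup>+\<omega>. W' \<omega> * indicator {\<omega> \<in> space M. Z m \<omega> = v m} \<omega> \<partial>M) =
      ennreal (c * (\<Prod>n\<in>J. exp (- l n * (1 - s n))) * (exp (- l m) * l m ^ v m / fact (v m)))"
    proof (rule poisson_coefficients_of_pgf[OF Zm W'])
      show "0 \<le> l m" using insert.prems(2) by auto
      show "0 \<le> c * (\<Prod>n\<in>J. exp (- l n * (1 - s n)))"
        using insert.prems(4) by (intro mult_nonneg_nonneg prod_nonneg) auto
      fix r :: real assume r: "0 \<le> r" "r \<le> 1"
      have "(\<integral>\<^sup>+\<omega>. W \<omega> * (\<Prod>n\<in>insert m J. ennreal ((s(m := r)) n ^ Z n \<omega>)) \<partial>M) =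
        ennreal (c * (\<Prod>n\<in>insert m J. exp (- l n * (1 - (s(m := r)) n))))"
        using s r by (intro insert.prems(5)) auto
      moreover have "W \<omega> * (\<Prod>n\<in>insert m J. ennreal ((s(m := r)) n ^ Z n \<omega>)) = W' \<omega> * ennreal (r ^ Z m \<omega>)" for \<omega>
      proof -
        have "(\<Prod>n\<in>J. ennreal ((s(m := r)) n ^ Z n \<omega>)) = (\<Prod>n\<in>J. ennreal (s n ^ Z n \<omega>))"
          using insert.hyps by (intro prod.cong) auto
        then show ?thesis
          using insert.hyps by (simp add: W'_def mult_ac)
      qed
      moreover have "c * (\<Prod>n\<in>insert m J. exp (- l n * (1 - (s(m := r)) n))) =
        c * (\<Prod>n\<in>J. exp (- l n * (1 - s n))) * exp (- l m * (1 - r))"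
      proof -
        have "(\<Prod>n\<in>J. exp (- l n * (1 - (s(m := r)) n))) = (\<Prod>n\<in>J. exp (- l n * (1 - s n)))"
          using insert.hyps by (intro prod.cong) auto
        then show ?thesis
          using insert.hyps by (simp add: mult_ac)
      qed
      ultimately show "(\<integral>\<^sup>+\<omega>. W' \<omega> * ennreal (r ^ Z m \<omega>) \<partial>M) =
        ennreal (c * (\<Prod>n\<in>J. exp (- l n * (1 - s n))) * exp (- l m * (1 - r)))" by (simp only:)
    qed
    then show "(\<integral>\<^sup>+\<omega>. ?W \<omega> * (\<Prod>n\<in>J. ennreal (s n ^ Z n \<omega>)) \<partial>M) =
      ennreal (?c * (\<Prod>n\<in>J. exp (- l n * (1 - s n))))"
      by (simp add: W'_def mult_ac)
  qed
  then show ?case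
    using insert.hyps by (simp add: mult_ac)
qed

text \<open>A product form of the joint generating functions yields the Poisson marginals and the
  independence at once, by comparing coefficients.\<close>

lemma (in prob_space) indep_poisson_of_pgf:
  fixes Z :: "'i \<Rightarrow> 'a \<Rightarrow> nat"
  assumes Z: "\<And>n. Z n \<in> measurable M (count_space UNIV)" and l: "\<And>n. 0 \<le> l n"
    and pgf: "\<And>J s. finite J \<Longrightarrow> (\<And>n. 0 \<le> s n \<and> s n \<le> 1) \<Longrightarrow>
      (\<integral>\<^sup>+\<omega>. (\<Prod>n\<in>J. ennreal (s n ^ Z n \<omega>)) \<partial>M) = ennreal (\<Prod>n\<in>J. exp (- l n * (1 - s n)))"
  shows "prob {\<omega> \<in> space M. Z n \<omega> = k} = exp (- l n) * l n ^ k / fact k"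
    and "indep_vars (\<lambda>_. count_space UNIV) Z UNIV"
proof -
  have ev: "{\<omega> \<in> space M. Z n \<omega> = k} \<in> events" for n k
    using measurable_sets[OF Z[of n], of "{k}"] by (simp add: vimage_def Int_def conj_commute)
  have joint: "prob (\<Inter>n\<in>J. {\<omega> \<in> space M. Z n \<omega> = v n}) = (\<Prod>n\<in>J. exp (- l n) * l n ^ v n / fact (v n))"
    if J: "finite J" "J \<noteq> {}" for J v
  proof -
    have "(\<integral>\<^sup>+\<omega>. 1 * (\<Prod>n\<in>J. indicator {\<omega> \<in> space M. Z n \<omega> = v n} \<omega>) \<partial>M) =
      ennreal (1 * (\<Prod>n\<in>J. exp (- l n) * l n ^ v n / fact (v n)))"
      using J(1) Z l pgf by (intro poisson_joint_of_pgf) auto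
    moreover have "(\<Prod>n\<in>J. indicator {\<omega> \<in> space M. Z n \<omega> = v n} \<omega>) =
      (indicator (\<Inter>n\<in>J. {\<omega> \<in> space M. Z n \<omega> = v n}) \<omega> :: ennreal)" for \<omega>
      using J by (induction J rule: finite_ne_induct) (auto simp: indicator_def)
    moreover have "(\<Inter>n\<in>J. {\<omega> \<in> space M. Z n \<omega> = v n}) \<in> events"
      using J ev by (intro sets.finite_INT) auto
    ultimately show ?thesis
      using l by (simp add: emeasure_eq_measure prod_nonneg)
  qed
  show single: "prob {\<omega> \<in> space M. Z n \<omega> = k} = exp (- l n) * l n ^ k / fact k" for n k
    using joint[of "{n}" "\<lambda>_. k"] by simp
  \<comment> \<open>The empty set is added to make the family stable under intersection, since
    distinct values give disjoint events.\<close>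
  define F where "F n = insert {} (range (\<lambda>k. {\<omega> \<in> space M. Z n \<omega> = k}))" for n
  have "indep_sets F UNIV"
  proof (rule indep_setsI)
    show "F n \<subseteq> events" for n using ev by (auto simp: F_def)
    fix A J assume J: "J \<noteq> {}" "finite J" and A: "\<forall>n\<in>J. A n \<in> F n"
    show "prob (\<Inter>n\<in>J. A n) = (\<Prod>n\<in>J. prob (A n))"
    proof (cases "\<exists>n\<in>J. A n = {}")
      case True
      then obtain n where n: "n \<in> J" "A n = {}" by auto
      then have "(\<Inter>n\<in>J. A n) = {}" by auto
      moreover have "(\<Prod>n\<in>J. prob (A n)) = 0"
        using n J(2) by (intro prod_zero) (auto intro!: bexI[of _ n])
      ultimately show ?thesis by simp
    next
      case False
      then have "\<forall>n\<in>J. \<exists>k. A n = {\<omega> \<in> space M. Z n \<omega> = k}"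
        using A unfolding F_def by blast
      then obtain v where v: "\<And>n. n \<in> J \<Longrightarrow> A n = {\<omega> \<in> space M. Z n \<omega> = v n}" by metis
      then show ?thesis
        using joint[OF J(2,1), of v] by (simp add: single cong: INF_cong_simp)
    qed
  qed
  moreover have "Int_stable (F n)" for n
    by (auto simp: Int_stable_def F_def)
  ultimately have "indep_sets (\<lambda>n. sigma_sets (space M) (F n)) UNIV"
    by (intro indep_sets_sigma)
  then have "indep_sets (\<lambda>n. {Z n -` A \<inter> space M | A. A \<in> sets (count_space UNIV)}) UNIV"
  proof (rule indep_sets_mono_sets)
    fix n
    have "Z n -` A \<inter> space M \<in> sigma_sets (space M) (F n)" for A
    proof -
      have "Z n -` A \<inter> space M = (\<Union>k. if k \<in> A then {\<omega> \<in> space M. Z n \<omega> = k} else {})" by auto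
      also have "\<dots> \<in> sigma_sets (space M) (F n)"
        by (rule sigma_sets.Union) (auto simp: F_def intro: sigma_sets.Basic sigma_sets.Empty)
      finally show ?thesis .
    qed
    then show "{Z n -` A \<inter> space M | A. A \<in> sets (count_space UNIV)} \<subseteq> sigma_sets (space M) (F n)"
      by blast
  qed
  then show "indep_vars (\<lambda>_. count_space UNIV) Z UNIV"
    unfolding indep_vars_def2 using Z by simp
qed

section \<open>Existence of Boolean models\<close>


text \<open>Bounded pieces of positive volume that partition the space; the process is built on each
  of them from a Poisson number of uniform points.\<close>

definition shell :: "nat \<Rightarrow> 'a::euclidean_space set" where
  "shell k = ball 0 (real k + 1) - ball 0 (real k)"

text \<open>A pair \<open>(k, j)\<close> stands for the j-th candidate in shell \<open>k\<close>,
  and \<open>N k\<close> says how many candidates of that shell are used. Listing the codes in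
  increasing order merges all shells into one sequence.\<close>

definition codes :: "(nat \<Rightarrow> nat) \<Rightarrow> nat set" where
  "codes N = {c. snd (prod_decode c) < N (fst (prod_decode c))}"

definition point_number :: "(nat \<Rightarrow> nat) \<Rightarrow> enat" where
  "point_number N = (if finite (codes N) then enat (card (codes N)) else \<infinity>)"

definition point_location :: "(nat \<Rightarrow> nat) \<Rightarrow> (nat \<Rightarrow> nat \<Rightarrow> 'a) \<Rightarrow> nat \<Rightarrow> 'a" where
  "point_location N U i = (case prod_decode (enumerate (codes N) i) of (k, j) \<Rightarrow> U k j)"

lemma shell_sets [measurable]: "shell k \<in> sets borel"
  by (simp add: shell_def)

lemma shell_partition: "(\<Union>k<m. shell k) = ball 0 (real m)"
proof (intro equalityI subsetI)
  fix x :: 'a assume "x \<in> (\<Union>k<m. shell k)"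
  then obtain k where "k < m" "x \<in> shell k" by auto
  then show "x \<in> ball 0 (real m)" by (auto simp: shell_def)
next
  fix x :: 'a assume "x \<in> ball 0 (real m)"
  then have m: "norm x < real m" by simp
  define k where "k = nat \<lfloor>norm x\<rfloor>"
  have "real k \<le> norm x" "norm x < real k + 1"
    unfolding k_def using norm_ge_zero[of x] by linarith+
  with m show "x \<in> (\<Union>k<m. shell k)" by (intro UN_I[of k]) (auto simp: shell_def)
qed

lemma shell_disjoint: "i \<noteq> j \<Longrightarrow> shell i \<inter> shell j = {}"
  by (auto simp: shell_def)

lemma emeasure_shell: "emeasure lborel (shell k :: 'a::euclidean_space set) = ennreal (measure lborel (shell k :: 'a set))"
proof -
  have "bounded (shell k :: 'a set)"
    unfolding shell_def by (rule bounded_subset[OF bounded_ball]) auto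
  from emeasure_bounded_finite[OF this] show ?thesis
    by (intro emeasure_eq_ennreal_measure) auto
qed

text \<open>A ball of radius \<open>1 / 4\<close> around a point of norm \<open>k + 1 / 2\<close>
  fits into the shell. Positive volume makes the uniform law on the shell a probability.\<close>

lemma measure_shell_pos: "0 < measure lborel (shell k :: 'a::euclidean_space set)"
proof -
  obtain b :: 'a where b: "b \<in> Basis" using nonempty_Basis by blast
  define x where "x = (real k + 1 / 2) *\<^sub>R b"
  have nx: "norm x = real k + 1 / 2" using b by (simp add: x_def)
  have "ball x (1 / 4) \<subseteq> (shell k :: 'a set)"
  proof
    fix y assume "y \<in> ball x (1 / 4)"
    then have "norm (x - y) < 1 / 4" by (simp add: dist_norm)
    then show "y \<in> shell k"
      using nx norm_triangle_ineq2[of x y] norm_triangle_ineq3[of x y] by (auto simp: shell_def)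
  qed
  then have "measure lborel (ball x (1 / 4)) \<le> measure lborel (shell k :: 'a set)"
    by (intro measure_mono_fmeasurable) (auto intro!: fmeasurableI simp: emeasure_shell)
  moreover have "0 < measure lborel (ball x (1 / 4))"
    by (simp add: measure_lborel_ball)
  ultimately show ?thesis by linarith
qed

text \<open>The cardinality of a finite set is the sum of indicators up to its least strict upper
  bound, a measurable index with countably many values; for infinite sets \<open>card\<close> is 0
  by convention.\<close>

lemma measurable_card_set:
  fixes S :: "'w \<Rightarrow> nat set"
  assumes S: "\<And>c. {\<omega> \<in> space M. c \<in> S \<omega>} \<in> sets M"
  shows "{\<omega> \<in> space M. finite (S \<omega>)} \<in> sets M"
    "(\<lambda>\<omega>. card (S \<omega>)) \<in> measurable M (count_space UNIV)"
proof -
  have p [measurable]: "Measurable.pred M (\<lambda>\<omega>. c \<in> S \<omega>)" for c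
    using S by (simp add: pred_def)
  have fin: "finite (S \<omega>) \<longleftrightarrow> (\<exists>m. \<forall>c. c \<in> S \<omega> \<longrightarrow> c < m)" for \<omega>
    unfolding finite_nat_set_iff_bounded by auto
  show meas: "{\<omega> \<in> space M. finite (S \<omega>)} \<in> sets M"
    unfolding fin by measurable
  have "card (S \<omega>) = (if \<exists>m. \<forall>c. c \<in> S \<omega> \<longrightarrow> c < m
      then (\<Sum>c<(LEAST m. \<forall>c. c \<in> S \<omega> \<longrightarrow> c < m). if c \<in> S \<omega> then 1 else 0) else 0)" for \<omega>
  proof (cases "\<exists>m. \<forall>c. c \<in> S \<omega> \<longrightarrow> c < m")
    case True
    then have "\<forall>c. c \<in> S \<omega> \<longrightarrow> c < (LEAST m. \<forall>c. c \<in> S \<omega> \<longrightarrow> c < m)"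
      by (rule LeastI_ex)
    then have "{..<(LEAST m. \<forall>c. c \<in> S \<omega> \<longrightarrow> c < m)} \<inter> {c. c \<in> S \<omega>} = S \<omega>" by auto
    then have "(\<Sum>c<(LEAST m. \<forall>c. c \<in> S \<omega> \<longrightarrow> c < m). if c \<in> S \<omega> then 1 else (0::nat)) = card (S \<omega>)"
      by (subst sum.If_cases) (simp_all only: finite_lessThan sum.neutral_const card_eq_sum[symmetric] add_0_right)
    then show ?thesis using True by simp
  next
    case False
    then show ?thesis using fin by auto
  qed
  moreover have "(\<lambda>\<omega>. if \<exists>m. \<forall>c. c \<in> S \<omega> \<longrightarrow> c < m
      then (\<Sum>c<(LEAST m. \<forall>c. c \<in> S \<omega> \<longrightarrow> c < m). if c \<in> S \<omega> then 1 else (0::nat)) else 0)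
    \<in> measurable M (count_space UNIV)"
  proof (intro measurable_If)
    show "(\<lambda>\<omega>. \<Sum>c<(LEAST m. \<forall>c. c \<in> S \<omega> \<longrightarrow> c < m). if c \<in> S \<omega> then 1 else (0::nat)) \<in> measurable M (count_space UNIV)"
    proof (rule measurable_compose_countable[where f = "\<lambda>n \<omega>. \<Sum>c<n. if c \<in> S \<omega> then 1 else (0::nat)"])
      show "(\<lambda>\<omega>. \<Sum>c<n. if c \<in> S \<omega> then 1 else (0::nat)) \<in> measurable M (count_space UNIV)" for n
      proof (induction n)
        case (Suc n)
        have "(\<lambda>\<omega>. (\<Sum>c<n. if c \<in> S \<omega> then 1 else (0::nat)) + (if n \<in> S \<omega> then 1 else 0)) \<in> measurable M (count_space UNIV)"
          by (rule measurable_compose_countable[where f = "\<lambda>i \<omega>. i + (if n \<in> S \<omega> then 1 else 0)", OF _ Suc]) measurable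
        then show ?case by simp
      qed simp
      show "(\<lambda>\<omega>. LEAST m. \<forall>c. c \<in> S \<omega> \<longrightarrow> c < m) \<in> measurable M (count_space UNIV)" by measurable
    qed
  qed (measurable)
  ultimately show "(\<lambda>\<omega>. card (S \<omega>)) \<in> measurable M (count_space UNIV)" by simp
qed

lemma measurable_enumerate:
  fixes S :: "'w \<Rightarrow> nat set"
  assumes "\<And>c. {\<omega> \<in> space M. c \<in> S \<omega>} \<in> sets M"
  shows "(\<lambda>\<omega>. enumerate (S \<omega>) i) \<in> measurable M (count_space UNIV)"
  using assms
proof (induction i arbitrary: S)
  case 0
  then have [measurable]: "Measurable.pred M (\<lambda>\<omega>. c \<in> S \<omega>)" for c
    by (simp add: pred_def)
  show ?case unfolding enumerate_0 by measurable
next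
  case (Suc i)
  then have [measurable]: "Measurable.pred M (\<lambda>\<omega>. c \<in> S \<omega>)" for c
    by (simp add: pred_def)
  show ?case unfolding enumerate_Suc
  proof (rule Suc.IH)
    fix c show "{\<omega> \<in> space M. c \<in> S \<omega> - {LEAST n. n \<in> S \<omega>}} \<in> sets M"
      unfolding Diff_iff singleton_iff by measurable
  qed
qed

lemma measurable_point_number:
  assumes N: "\<And>k. N k \<in> measurable M (count_space UNIV)"
  shows "(\<lambda>\<omega>. point_number (\<lambda>k. N k \<omega>)) \<in> measurable M (count_space UNIV)"
    and "\<And>i. (\<lambda>\<omega>. enumerate (codes (\<lambda>k. N k \<omega>)) i) \<in> measurable M (count_space UNIV)"
proof -
  have S: "{\<omega> \<in> space M. c \<in> codes (\<lambda>k. N k \<omega>)} \<in> sets M" for c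
  proof -
    have "{\<omega> \<in> space M. c \<in> codes (\<lambda>k. N k \<omega>)} = N (fst (prod_decode c)) -` {snd (prod_decode c)<..} \<inter> space M"
      by (auto simp: codes_def)
    also have "\<dots> \<in> sets M" by (intro measurable_sets[OF N]) simp
    finally show ?thesis .
  qed
  have "(\<lambda>\<omega>. enat (card (codes (\<lambda>k. N k \<omega>)))) \<in> measurable M (count_space UNIV)"
    by (rule measurable_compose[OF measurable_card_set(2)[OF S]]) simp
  then show "(\<lambda>\<omega>. point_number (\<lambda>k. N k \<omega>)) \<in> measurable M (count_space UNIV)"
    unfolding point_number_def using measurable_card_set(1)[OF S]
    by (intro measurable_If) auto
  show "(\<lambda>\<omega>. enumerate (codes (\<lambda>k. N k \<omega>)) i) \<in> measurable M (count_space UNIV)" for i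
    by (rule measurable_enumerate[OF S])
qed

lemma measurable_point_location:
  assumes N: "\<And>k. N k \<in> measurable M (count_space UNIV)" and U: "\<And>k j. U k j \<in> borel_measurable M"
  shows "(\<lambda>\<omega>. point_location (\<lambda>k. N k \<omega>) (\<lambda>k j. U k j \<omega>) i) \<in> borel_measurable M"
  unfolding point_location_def case_prod_unfold
  by (rule measurable_compose_countable[OF _ measurable_point_number(2)[OF N],
      where f = "\<lambda>c \<omega>. U (fst (prod_decode c)) (snd (prod_decode c)) \<omega>"]) (rule U)

lemma point_indices_codes:
  "bij_betw (enumerate (codes N)) {i. enat i < point_number N \<and> point_location N U i \<in> A}
    {c \<in> codes N. case_prod U (prod_decode c) \<in> A}"
proof -
  have bij: "bij_betw (enumerate (codes N)) {i. enat i < point_number N} (codes N)"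
  proof (cases "finite (codes N)")
    case True
    then show ?thesis
      using finite_bij_enumerate[OF True] by (simp add: point_number_def lessThan_def)
  next
    case False
    then show ?thesis
      using bij_enumerate[OF False] by (simp add: point_number_def)
  qed
  have "enumerate (codes N) ` {i \<in> {i. enat i < point_number N}. point_location N U i \<in> A} =
    {c \<in> codes N. case_prod U (prod_decode c) \<in> A}"
    using bij_betw_imp_surj_on[OF bij] by (auto simp: point_location_def)
  then show ?thesis
    using bij_betw_subset[OF bij, of "{i. enat i < point_number N \<and> point_location N U i \<in> A}"] by auto
qed

text \<open>A point of shell \<open>k\<close> has norm at least \<open>k\<close>, so only the
  finitely many shells with \<open>k < m\<close> contribute.\<close>

lemma codes_in_ball:
  assumes U: "\<And>k j. U k j \<in> shell k" and A: "A \<subseteq> ball 0 (real m)"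
  shows "finite {i. enat i < point_number N \<and> point_location N U i \<in> A}"
    "card {i. enat i < point_number N \<and> point_location N U i \<in> A} = (\<Sum>k<m. card {j. j < N k \<and> U k j \<in> A})"
proof -
  have km: "k < m" if "U k j \<in> A" for k j
  proof -
    have "real k \<le> norm (U k j)" "norm (U k j) < real m"
      using U[of k j] A that by (auto simp: shell_def)
    then show ?thesis by linarith
  qed
  have eq: "{c \<in> codes N. case_prod U (prod_decode c) \<in> A} =
    prod_encode ` (SIGMA k:{..<m}. {j. j < N k \<and> U k j \<in> A})"
    (is "?L = prod_encode ` ?R")
  proof (intro equalityI subsetI)
    fix c assume "c \<in> ?L"
    then have "prod_decode c \<in> ?R"
      using km by (auto simp: codes_def split: prod.splits)
    then have "prod_encode (prod_decode c) \<in> prod_encode ` ?R" by (rule imageI)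
    then show "c \<in> prod_encode ` ?R" by simp
  qed (auto simp: codes_def)
  have fin: "finite ?R" by (intro finite_SigmaI) auto
  show "finite {i. enat i < point_number N \<and> point_location N U i \<in> A}"
    using bij_betw_finite[OF point_indices_codes[of N U A]] fin unfolding eq by simp
  have "card {i. enat i < point_number N \<and> point_location N U i \<in> A} = card (prod_encode ` ?R)"
    using bij_betw_same_card[OF point_indices_codes[of N U A]] unfolding eq .
  also have "\<dots> = card ?R"
    by (intro card_image inj_prod_encode)
  also have "\<dots> = (\<Sum>k<m. card {j. j < N k \<and> U k j \<in> A})"
    by (simp add: card_SigmaI)
  finally show "card {i. enat i < point_number N \<and> point_location N U i \<in> A} = (\<Sum>k<m. card {j. j < N k \<and> U k j \<in> A})" .
qed

text \<open>
  All the randomness is carried by one independent family of points: \<open>zeta (k, 0)\<close> encodes a radius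
  and \<open>zeta (k, 1)\<close> the number of points in \<open>shell k\<close>, both as coefficients of the basis vector \<open>b\<close>,
  and the further \<open>zeta (k, j)\<close> are the candidate positions in \<open>shell k\<close>.
\<close>

locale poisson_construction = prob_space P
  for P :: "'w measure" +
  fixes lam :: real and nu :: "real measure" and zeta :: "nat \<times> nat \<Rightarrow> 'w \<Rightarrow> 'a::euclidean_space" and b :: 'a
  assumes lam_pos: "0 < lam" and b: "b \<in> Basis" and prob_nu: "prob_space nu" and sets_nu: "sets nu = sets borel"
    and indep_zeta: "indep_vars (\<lambda>_. borel) zeta UNIV"
    and law_radius: "\<And>k. distr P borel (zeta (k, 0)) = distr nu borel (\<lambda>r. r *\<^sub>R b)"
    and law_number: "\<And>k. distr P borel (zeta (k, 1)) =
      distr (measure_pmf (poisson_pmf (lam * measure lborel (shell k :: 'a set)))) borel (\<lambda>n. real n *\<^sub>R b)"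
    and law_point: "\<And>k j. distr P borel (zeta (k, j + 2)) = uniform_measure lborel (shell k)"
begin

definition rad :: "nat \<Rightarrow> 'w \<Rightarrow> real" where "rad k \<omega> = zeta (k, 0) \<omega> \<bullet> b"
definition num :: "nat \<Rightarrow> 'w \<Rightarrow> nat" where "num k \<omega> = nat \<lfloor>zeta (k, 1) \<omega> \<bullet> b\<rfloor>"
definition pt :: "nat \<Rightarrow> nat \<Rightarrow> 'w \<Rightarrow> 'a" where "pt k j = zeta (k, j + 2)"
definition K :: "'w \<Rightarrow> enat" where "K \<omega> = point_number (\<lambda>k. num k \<omega>)"
definition X :: "nat \<Rightarrow> 'w \<Rightarrow> 'a" where "X i \<omega> = point_location (\<lambda>k. num k \<omega>) (\<lambda>k j. pt k j \<omega>) i"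

lemma b_b [simp]: "b \<bullet> b = 1"
  using b by simp

lemma measurable_zeta [measurable]: "zeta i \<in> borel_measurable P"
  using indep_zeta unfolding indep_vars_def by blast

lemma measurable_num [measurable]: "num k \<in> measurable P (count_space UNIV)"
  unfolding num_def by measurable

lemma measurable_pt [measurable]: "pt k j \<in> borel_measurable P"
  unfolding pt_def by measurable

lemma measurable_rad [measurable]: "rad k \<in> borel_measurable P"
  unfolding rad_def by measurable

lemma distr_rad: "distr P borel (rad k) = nu"
proof -
  have "distr P borel (rad k) = distr (distr P borel (zeta (k, 0))) borel (\<lambda>x. x \<bullet> b)"
    by (subst distr_distr) (auto simp: rad_def[abs_def] comp_def)
  also have "\<dots> = distr nu borel (\<lambda>r. r)"
    unfolding law_radius by (subst distr_distr) (auto simp: comp_def measurable_cong_sets[OF sets_nu refl])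
  also have "\<dots> = nu"
    using sets_nu by (intro measure_eqI) (auto simp: emeasure_distr measurable_cong_sets[OF sets_nu refl] space_distr sets_eq_imp_space_eq[OF sets_nu])
  finally show ?thesis .
qed

lemma indep_rad: "indep_vars (\<lambda>_. borel) rad UNIV"
proof -
  have "indep_vars (\<lambda>k. PiM {(k, 0)} (\<lambda>_. borel)) (\<lambda>k \<omega>. restrict (\<lambda>i. zeta i \<omega>) {(k, 0)}) UNIV"
    by (rule indep_vars_restrict[OF indep_zeta]) (auto simp: disjoint_family_on_def)
  then have "indep_vars (\<lambda>_. borel) (\<lambda>k \<omega>. (\<lambda>f. f (k, 0) \<bullet> b) (restrict (\<lambda>i. zeta i \<omega>) {(k, 0)})) UNIV"
    by (rule indep_vars_compose2) (auto intro!: borel_measurable_inner measurable_component_singleton)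
  then show ?thesis
    by (simp add: rad_def[abs_def])
qed

lemma prob_num: "prob {\<omega> \<in> space P. num k \<omega> = n} =
  exp (- (lam * measure lborel (shell k :: 'a set))) * (lam * measure lborel (shell k :: 'a set)) ^ n / fact n"
proof -
  let ?p = "poisson_pmf (lam * measure lborel (shell k :: 'a set))"
  have "{\<omega> \<in> space P. num k \<omega> = n} = zeta (k, 1) -` {x. nat \<lfloor>x \<bullet> b\<rfloor> = n} \<inter> space P"
    by (auto simp: num_def)
  also have "prob \<dots> = measure (distr P borel (zeta (k, 1))) {x. nat \<lfloor>x \<bullet> b\<rfloor> = n}"
    by (rule measure_distr[symmetric]) measurable
  also have "\<dots> = measure (measure_pmf ?p) ((\<lambda>n. real n *\<^sub>R b) -` {x. nat \<lfloor>x \<bullet> b\<rfloor> = n} \<inter> space (measure_pmf ?p))"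
    unfolding law_number by (rule measure_distr) measurable
  also have "(\<lambda>n. real n *\<^sub>R b) -` {x. nat \<lfloor>x \<bullet> b\<rfloor> = n} \<inter> space (measure_pmf ?p) = {n}"
    by auto
  finally show ?thesis
    using lam_pos measure_shell_pos[of k, where 'a = 'a] by (simp add: measure_pmf_single)
qed

lemma prob_pt:
  assumes "A \<in> sets borel"
  shows "prob {\<omega> \<in> space P. pt k j \<omega> \<in> A} = measure lborel (shell k \<inter> A) / measure lborel (shell k :: 'a set)"
proof -
  have "{\<omega> \<in> space P. pt k j \<omega> \<in> A} = zeta (k, j + 2) -` A \<inter> space P"
    by (auto simp: pt_def)
  also have "prob \<dots> = measure (distr P borel (zeta (k, j + 2))) A"
    by (rule measure_distr[symmetric]) (use assms in auto)
  also have "\<dots> = measure lborel (shell k \<inter> A) / measure lborel (shell k :: 'a set)"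
    unfolding law_point using assms measure_shell_pos[of k, where 'a = 'a]
    by (intro measure_uniform_measure) (auto simp: emeasure_shell)
  finally show ?thesis .
qed

lemma AE_pt_shell: "AE \<omega> in P. \<forall>k j. pt k j \<omega> \<in> shell k"
proof -
  have "AE \<omega> in P. pt k j \<omega> \<in> shell k" for k j
  proof -
    have "prob {\<omega> \<in> space P. pt k j \<omega> \<in> shell k} = 1"
      using prob_pt[of "shell k" k j] measure_shell_pos[of k, where 'a = 'a] by simp
    moreover have "{\<omega> \<in> space P. pt k j \<omega> \<in> shell k} \<in> events" by measurable
    ultimately show ?thesis using prob_eq_1 by fastforce
  qed
  then show ?thesis by (simp add: AE_all_countable)
qed

text \<open>On \<open>num k = n\<close> the n points are independent of the number and contribute
  \<open>\<gamma> ^ n\<close>; summing over \<open>n\<close> gives the Poisson generating function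
  at \<open>\<gamma>\<close>.\<close>

lemma row_pgf:
  fixes g :: "'a \<Rightarrow> real"
  assumes g: "g \<in> borel_measurable borel" "\<And>x. 0 \<le> g x" and \<gamma>: "0 \<le> \<gamma>"
    and mean: "\<And>j. (\<integral>\<^sup>+\<omega>. ennreal (g (pt k j \<omega>)) \<partial>P) = ennreal \<gamma>"
  shows "(\<integral>\<^sup>+\<omega>. (\<Prod>j<num k \<omega>. ennreal (g (pt k j \<omega>))) \<partial>P) =
    ennreal (exp (- (lam * measure lborel (shell k :: 'a set)) * (1 - \<gamma>)))"
proof -
  note g(1) [measurable]
  have terms: "(\<integral>\<^sup>+\<omega>. indicator {\<omega> \<in> space P. num k \<omega> = n} \<omega> * (\<Prod>j<n. ennreal (g (pt k j \<omega>))) \<partial>P) =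
    (\<integral>\<^sup>+\<omega>. indicator {\<omega> \<in> space P. num k \<omega> = n} \<omega> * ennreal (\<gamma> ^ n) \<partial>P)" for n
  proof -
    \<comment> \<open>Index 0 reads \<open>zeta (k, 1)\<close>, the number of points; index
      \<open>Suc j\<close> reads \<open>zeta (k, j + 2)\<close>, the j-th candidate.\<close>
    define h :: "nat \<Rightarrow> 'a \<Rightarrow> ennreal" where
      "h i = (case i of 0 \<Rightarrow> indicator {x. nat \<lfloor>x \<bullet> b\<rfloor> = n} | Suc j \<Rightarrow> (\<lambda>x. ennreal (g x)))" for i
    have h: "h i \<in> borel_measurable borel" for i
      by (cases i) (auto simp: h_def)
    have "indep_vars (\<lambda>i. PiM {(k, Suc i)} (\<lambda>_. borel)) (\<lambda>i \<omega>. restrict (\<lambda>i. zeta i \<omega>) {(k, Suc i)}) {..<Suc n}"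
      by (rule indep_vars_restrict[OF indep_zeta]) (auto simp: disjoint_family_on_def)
    then have "indep_vars (\<lambda>_. borel) (\<lambda>i \<omega>. (\<lambda>f. h i (f (k, Suc i))) (restrict (\<lambda>i. zeta i \<omega>) {(k, Suc i)})) {..<Suc n}"
      by (rule indep_vars_compose2) (auto intro!: measurable_compose[OF _ h] measurable_component_singleton)
    then have ind: "indep_vars (\<lambda>_. borel) (\<lambda>i \<omega>. h i (zeta (k, Suc i) \<omega>)) {..<Suc n}"
      by simp
    have split: "(\<Prod>i<Suc n. h i (zeta (k, Suc i) \<omega>)) =
      indicator {\<omega> \<in> space P. num k \<omega> = n} \<omega> * (\<Prod>j<n. ennreal (g (pt k j \<omega>)))" if "\<omega> \<in> space P" for \<omega>
      using that unfolding prod.lessThan_Suc_shift by (simp add: h_def num_def pt_def indicator_def)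
    have "(\<integral>\<^sup>+\<omega>. indicator {\<omega> \<in> space P. num k \<omega> = n} \<omega> * (\<Prod>j<n. ennreal (g (pt k j \<omega>))) \<partial>P) =
      (\<integral>\<^sup>+\<omega>. (\<Prod>i<Suc n. h i (zeta (k, Suc i) \<omega>)) \<partial>P)"
      by (intro nn_integral_cong split[symmetric])
    also have "\<dots> = (\<Prod>i<Suc n. \<integral>\<^sup>+\<omega>. h i (zeta (k, Suc i) \<omega>) \<partial>P)"
      by (intro indep_vars_nn_integral ind) auto
    also have "\<dots> = (\<integral>\<^sup>+\<omega>. indicator {\<omega> \<in> space P. num k \<omega> = n} \<omega> \<partial>P) * ennreal (\<gamma> ^ n)"
    proof -
      have "(\<integral>\<^sup>+\<omega>. h 0 (zeta (k, Suc 0) \<omega>) \<partial>P) = (\<integral>\<^sup>+\<omega>. indicator {\<omega> \<in> space P. num k \<omega> = n} \<omega> \<partial>P)"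
        by (intro nn_integral_cong) (simp add: h_def num_def indicator_def)
      moreover have "(\<integral>\<^sup>+\<omega>. h (Suc j) (zeta (k, Suc (Suc j)) \<omega>) \<partial>P) = ennreal \<gamma>" for j
        using mean[of j] by (simp add: h_def pt_def)
      ultimately show ?thesis
        unfolding prod.lessThan_Suc_shift using \<gamma> by (simp add: ennreal_power)
    qed
    also have "\<dots> = (\<integral>\<^sup>+\<omega>. indicator {\<omega> \<in> space P. num k \<omega> = n} \<omega> * ennreal (\<gamma> ^ n) \<partial>P)"
      by (rule nn_integral_multc[symmetric]) measurable
    finally show ?thesis .
  qed
  have "(\<integral>\<^sup>+\<omega>. (\<Prod>j<num k \<omega>. ennreal (g (pt k j \<omega>))) \<partial>P) =
    (\<Sum>n. \<integral>\<^sup>+\<omega>. indicator {\<omega> \<in> space P. num k \<omega> = n} \<omega> * (\<Prod>j<n. ennreal (g (pt k j \<omega>))) \<partial>P)"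
    by (rule nn_integral_split_nat) measurable
  also have "\<dots> = (\<integral>\<^sup>+\<omega>. ennreal (\<gamma> ^ num k \<omega>) \<partial>P)"
    unfolding terms by (rule nn_integral_split_nat[symmetric]) measurable
  also have "\<dots> = ennreal (exp (- (lam * measure lborel (shell k :: 'a set)) * (1 - \<gamma>)))"
    using lam_pos by (intro nn_integral_power_poisson prob_num \<gamma>) auto
  finally show ?thesis .
qed

lemma indep_rows:
  fixes g :: "'a \<Rightarrow> real"
  assumes g: "g \<in> borel_measurable borel"
  shows "indep_vars (\<lambda>_. borel) (\<lambda>k \<omega>. \<Prod>j<num k \<omega>. ennreal (g (pt k j \<omega>))) {..<m::nat}"
proof -
  let ?R = "\<lambda>k::nat. {k} \<times> (UNIV :: nat set)"
  define Y where "Y k f = (\<Prod>j<nat \<lfloor>f (k, 1) \<bullet> b\<rfloor>. ennreal (g (f (k, j + 2))))" for k :: nat and f :: "nat \<times> nat \<Rightarrow> 'a"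
  have "indep_vars (\<lambda>k. PiM (?R k) (\<lambda>_. borel)) (\<lambda>k \<omega>. restrict (\<lambda>i. zeta i \<omega>) (?R k)) {..<m}"
    by (rule indep_vars_restrict[OF indep_zeta]) (auto simp: disjoint_family_on_def)
  then have "indep_vars (\<lambda>_. borel) (\<lambda>k \<omega>. Y k (restrict (\<lambda>i. zeta i \<omega>) (?R k))) {..<m}"
  proof (rule indep_vars_compose2)
    fix k
    have comp: "(\<lambda>f. f (k, j)) \<in> borel_measurable (PiM (?R k) (\<lambda>_. borel :: 'a measure))" for j
      by (rule measurable_component_singleton) simp
    show "Y k \<in> borel_measurable (PiM (?R k) (\<lambda>_. borel))"
      unfolding Y_def
    proof (rule measurable_compose_countable[where f = "\<lambda>n f. \<Prod>j<n. ennreal (g (f (k, j + 2)))"])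
      show "(\<lambda>f. \<Prod>j<n. ennreal (g (f (k, j + 2)))) \<in> borel_measurable (PiM (?R k) (\<lambda>_. borel))" for n
        by (intro borel_measurable_prod_ennreal measurable_compose[OF comp] measurable_compose[OF g] measurable_ennreal)
      have "(\<lambda>x. nat \<lfloor>x \<bullet> b\<rfloor>) \<in> measurable borel (count_space UNIV)" by measurable
      then show "(\<lambda>f. nat \<lfloor>f (k, 1) \<bullet> b\<rfloor>) \<in> measurable (PiM (?R k) (\<lambda>_. borel)) (count_space UNIV)"
        by (rule measurable_compose[OF comp])
    qed
  qed
  then show ?thesis by (simp add: Y_def num_def pt_def)
qed

section \<open>Counts of the constructed process\<close>

lemma measurable_K: "K \<in> measurable P (count_space UNIV)"
  unfolding K_def by (rule measurable_point_number(1)) measurable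

lemma measurable_X: "X i \<in> borel_measurable P"
  unfolding X_def by (rule measurable_point_location) measurable

lemma measurable_point_count:
  assumes "A \<in> sets borel"
  shows "point_count K X A \<in> measurable P (count_space UNIV)"
proof -
  have "{\<omega> \<in> space P. i \<in> point_indices K X A \<omega>} \<in> events" for i
  proof -
    have "{\<omega> \<in> space P. i \<in> point_indices K X A \<omega>} = (K -` {k. enat i < k} \<inter> space P) \<inter> (X i -` A \<inter> space P)"
      by (auto simp: point_indices_def)
    also have "\<dots> \<in> events"
      using assms by (intro sets.Int measurable_sets[OF measurable_K] measurable_sets[OF measurable_X]) auto
    finally show ?thesis .
  qed
  then show ?thesis
    unfolding point_count_def[abs_def] by (rule measurable_card_set(2))
qed

lemma AE_point_count:
  assumes "A \<subseteq> ball 0 (real m)"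
  shows "AE \<omega> in P. finite (point_indices K X A \<omega>) \<and>
    point_count K X A \<omega> = (\<Sum>k<m. card {j. j < num k \<omega> \<and> pt k j \<omega> \<in> A})"
  using AE_pt_shell
proof eventually_elim
  case (elim \<omega>)
  then show ?case
    using codes_in_ball[of "\<lambda>k j. pt k j \<omega>" A m "\<lambda>k. num k \<omega>"] assms
    by (simp add: point_indices_def point_count_def K_def X_def)
qed

text \<open>The product of the \<open>s n ^ count\<close> over \<open>n\<close> is a product, over
  all points, of a function \<open>g\<close> equal to \<open>s n\<close> on \<open>A n\<close> and
  to 1 elsewhere. The latter product splits into independent shells.\<close>

lemma point_count_pgf:
  fixes A :: "nat \<Rightarrow> 'a set"
  assumes A: "\<And>n. A n \<in> sets borel" "\<And>n. bounded (A n)" "disjoint_family A" and J: "finite J"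
    and s: "\<And>n. 0 \<le> s n \<and> s n \<le> 1"
  shows "(\<integral>\<^sup>+\<omega>. (\<Prod>n\<in>J. ennreal (s n ^ point_count K X (A n) \<omega>)) \<partial>P) =
    ennreal (\<Prod>n\<in>J. exp (- (lam * measure lborel (A n)) * (1 - s n)))"
proof -
  have "bounded (\<Union>n\<in>J. A n)" using A(2) J by auto
  then obtain r where r: "(\<Union>n\<in>J. A n) \<subseteq> ball 0 r"
    using bounded_subset_ballD[of _ 0] by metis
  obtain m :: nat where "r \<le> real m" using real_arch_simple by blast
  with r have m: "A n \<subseteq> ball 0 (real m)" if "n \<in> J" for n using that by fastforce
  define g where "g x = 1 - (\<Sum>n\<in>J. (1 - s n) * indicator (A n) x)" for x
  have g_in: "g x = s n" if "n \<in> J" "x \<in> A n" for n x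
  proof -
    have "x \<notin> A i" if "i \<noteq> n" for i
      using A(3) \<open>x \<in> A n\<close> that by (auto simp: disjoint_family_on_def)
    then have "(\<Sum>i\<in>J. (1 - s i) * indicator (A i) x) = (\<Sum>i\<in>J. if i = n then 1 - s n else 0)"
      using \<open>x \<in> A n\<close> by (intro sum.cong) auto
    then show ?thesis using J \<open>n \<in> J\<close> by (simp add: g_def)
  qed
  have g_out: "g x = 1" if "\<And>n. n \<in> J \<Longrightarrow> x \<notin> A n" for x
    using that by (simp add: g_def)
  have g01: "0 \<le> g x" for x
  proof (cases "\<exists>n\<in>J. x \<in> A n")
    case True
    then show ?thesis using g_in s by metis
  next
    case False
    then show ?thesis using g_out[of x] by auto
  qed
  have g_prod: "g x = (\<Prod>n\<in>J. if x \<in> A n then s n else 1)" for x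
  proof (cases "\<exists>n\<in>J. x \<in> A n")
    case True
    then obtain n where n: "n \<in> J" "x \<in> A n" by auto
    have "x \<notin> A i" if "i \<noteq> n" for i
      using A(3) n(2) that by (auto simp: disjoint_family_on_def)
    then have "(\<Prod>i\<in>J. if x \<in> A i then s i else 1) = (\<Prod>i\<in>J. if i = n then s n else 1)"
      using n by (intro prod.cong) auto
    then show ?thesis using J n g_in by simp
  next
    case False
    then show ?thesis using g_out by simp
  qed
  have g_meas: "g \<in> borel_measurable borel"
    unfolding g_def using A(1) by (intro borel_measurable_diff borel_measurable_sum borel_measurable_times) auto
  define w where "w k = measure lborel (shell k :: 'a set)" for k
  \<comment> \<open>The mean of \<open>g\<close> under the uniform law on shell \<open>k\<close>.
    The normalisation by \<open>w k\<close> cancels against the mean \<open>lam * w k\<close> of the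
    number of points, leaving volumes of \<open>shell k \<inter> A n\<close> that add up over the
    shells.\<close>
  define \<gamma> where "\<gamma> k = 1 - (\<Sum>n\<in>J. (1 - s n) * (measure lborel (shell k \<inter> A n) / w k))" for k
  have mean: "(\<integral>\<^sup>+\<omega>. ennreal (g (pt k j \<omega>)) \<partial>P) = ennreal (\<gamma> k)" and \<gamma>0: "0 \<le> \<gamma> k" for k j
  proof -
    have ind: "(\<lambda>\<omega>. indicator (A n) (pt k j \<omega>) :: real) = indicator (pt k j -` A n)" for n
      by (auto simp: indicator_def)
    have ev: "{\<omega> \<in> space P. pt k j \<omega> \<in> A n} \<in> events" for n
      using A(1)[of n] measurable_sets[OF measurable_pt[of k j]] by (simp add: vimage_def Int_def conj_commute)
    have hb: "has_bochner_integral P (\<lambda>\<omega>. indicator (A n) (pt k j \<omega>) :: real) (measure lborel (shell k \<inter> A n) / w k)" for n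
    proof -
      have "has_bochner_integral P (indicator {\<omega> \<in> space P. pt k j \<omega> \<in> A n} :: _ \<Rightarrow> real) (prob {\<omega> \<in> space P. pt k j \<omega> \<in> A n})"
        using ev by (intro has_bochner_integral_real_indicator) (auto simp: emeasure_eq_measure)
      then show ?thesis
        unfolding prob_pt[OF A(1)] w_def
        by (rule has_bochner_integral_cong[THEN iffD1, rotated -1]) (auto simp: indicator_def)
    qed
    have "has_bochner_integral P (\<lambda>\<omega>. g (pt k j \<omega>)) (prob (space P) - (\<Sum>n\<in>J. (1 - s n) * (measure lborel (shell k \<inter> A n) / w k)))"
      unfolding g_def by (intro has_bochner_integral_diff has_bochner_integral_sum has_bochner_integral_mult_right hb)
        (auto intro: has_bochner_integral_cong[THEN iffD1, OF refl _ refl has_bochner_integral_real_indicator[of "space P"]] simp: emeasure_space_1)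
    then have hb': "has_bochner_integral P (\<lambda>\<omega>. g (pt k j \<omega>)) (\<gamma> k)"
      by (simp add: \<gamma>_def prob_space)
    then show "(\<integral>\<^sup>+\<omega>. ennreal (g (pt k j \<omega>)) \<partial>P) = ennreal (\<gamma> k)"
      using g01 by (subst nn_integral_eq_integral) (auto simp: has_bochner_integral_iff)
    show "0 \<le> \<gamma> k"
    proof -
      have "\<gamma> k = (LINT \<omega>|P. g (pt k j \<omega>))"
        using hb' by (simp add: has_bochner_integral_iff)
      then show ?thesis using g01 by simp
    qed
  qed
  have prods: "(\<Prod>n\<in>J. ennreal (s n ^ (\<Sum>k<m. card {j. j < num k \<omega> \<and> pt k j \<omega> \<in> A n}))) =
    (\<Prod>k<m. \<Prod>j<num k \<omega>. ennreal (g (pt k j \<omega>)))" for \<omega>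
  proof -
    have "s n ^ card {j. j < num k \<omega> \<and> pt k j \<omega> \<in> A n} = (\<Prod>j<num k \<omega>. if pt k j \<omega> \<in> A n then s n else 1)" for n k
    proof -
      have "{j. j < num k \<omega> \<and> pt k j \<omega> \<in> A n} = {..<num k \<omega>} \<inter> {j. pt k j \<omega> \<in> A n}" by auto
      then show ?thesis by (simp add: prod.If_cases)
    qed
    then have "(\<Prod>n\<in>J. s n ^ (\<Sum>k<m. card {j. j < num k \<omega> \<and> pt k j \<omega> \<in> A n})) =
      (\<Prod>n\<in>J. \<Prod>k<m. \<Prod>j<num k \<omega>. if pt k j \<omega> \<in> A n then s n else 1)"
      by (simp add: power_sum)
    also have "\<dots> = (\<Prod>k<m. \<Prod>n\<in>J. \<Prod>j<num k \<omega>. if pt k j \<omega> \<in> A n then s n else 1)"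
      by (rule prod.swap)
    also have "\<dots> = (\<Prod>k<m. \<Prod>j<num k \<omega>. g (pt k j \<omega>))"
      unfolding g_prod by (intro prod.cong refl prod.swap)
    finally have "(\<Prod>n\<in>J. s n ^ (\<Sum>k<m. card {j. j < num k \<omega> \<and> pt k j \<omega> \<in> A n})) =
      (\<Prod>k<m. \<Prod>j<num k \<omega>. g (pt k j \<omega>))" .
    then show ?thesis
      using s g01 by (simp add: prod_ennreal prod_nonneg)
  qed
  have "AE \<omega> in P. \<forall>n\<in>J. point_count K X (A n) \<omega> = (\<Sum>k<m. card {j. j < num k \<omega> \<and> pt k j \<omega> \<in> A n})"
    using J AE_point_count[OF m] by (intro AE_finite_allI) (auto elim: eventually_mono)
  then have "AE \<omega> in P. (\<Prod>n\<in>J. ennreal (s n ^ point_count K X (A n) \<omega>)) = (\<Prod>k<m. \<Prod>j<num k \<omega>. ennreal (g (pt k j \<omega>)))"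
    by eventually_elim (simp flip: prods)
  then have "(\<integral>\<^sup>+\<omega>. (\<Prod>n\<in>J. ennreal (s n ^ point_count K X (A n) \<omega>)) \<partial>P) =
    (\<integral>\<^sup>+\<omega>. (\<Prod>k<m. \<Prod>j<num k \<omega>. ennreal (g (pt k j \<omega>))) \<partial>P)"
    by (rule nn_integral_cong_AE)
  also have "\<dots> = (\<Prod>k<m. \<integral>\<^sup>+\<omega>. (\<Prod>j<num k \<omega>. ennreal (g (pt k j \<omega>))) \<partial>P)"
    by (intro indep_vars_nn_integral indep_rows g_meas) auto
  also have "\<dots> = (\<Prod>k<m. ennreal (exp (- (lam * w k) * (1 - \<gamma> k))))"
    unfolding w_def by (intro prod.cong refl row_pgf[OF g_meas g01 \<gamma>0 mean])
  also have "\<dots> = ennreal (exp (\<Sum>k<m. - (lam * w k) * (1 - \<gamma> k)))"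
    by (simp add: prod_ennreal exp_sum)
  also have "(\<Sum>k<m. - (lam * w k) * (1 - \<gamma> k)) = (\<Sum>n\<in>J. - (lam * measure lborel (A n)) * (1 - s n))"
  proof -
    have w: "0 < w k" for k by (simp add: w_def measure_shell_pos)
    have "- (lam * w k) * (1 - \<gamma> k) = (\<Sum>n\<in>J. - (lam * (1 - s n)) * measure lborel (shell k \<inter> A n))" for k
      using w[of k] by (simp add: \<gamma>_def sum_distrib_left sum_negf mult_ac)
    then have "(\<Sum>k<m. - (lam * w k) * (1 - \<gamma> k)) =
      (\<Sum>n\<in>J. - (lam * (1 - s n)) * (\<Sum>k<m. measure lborel (shell k \<inter> A n)))"
      by (simp add: sum_distrib_left) (rule sum.swap)
    also have "\<dots> = (\<Sum>n\<in>J. - (lam * (1 - s n)) * measure lborel (A n))"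
    proof (intro sum.cong refl)
      fix n assume "n \<in> J"
      have "(\<Union>k<m. shell k \<inter> A n) = A n"
        using m[OF \<open>n \<in> J\<close>] shell_partition[of m, where 'a = 'a] by blast
      moreover have "measure lborel (\<Union>k<m. shell k \<inter> A n) = (\<Sum>k<m. measure lborel (shell k \<inter> A n))"
      proof (rule measure_finite_Union)
        show "disjoint_family_on (\<lambda>k. shell k \<inter> A n) {..<m}"
          using shell_disjoint by (fastforce simp: disjoint_family_on_def)
        show "emeasure lborel (shell k \<inter> A n) \<noteq> \<infinity>" for k
          using emeasure_bounded_finite[of "shell k \<inter> A n"] bounded_subset[OF A(2)[of n], of "shell k \<inter> A n"] by auto
      qed (use A(1) in auto)
      ultimately show "- (lam * (1 - s n)) * (\<Sum>k<m. measure lborel (shell k \<inter> A n)) =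
        - (lam * (1 - s n)) * measure lborel (A n)" by simp
    qed
    finally show ?thesis by (simp add: mult_ac)
  qed
  finally show ?thesis using J by (simp add: exp_sum)
qed

lemma boolean_model: "boolean_model P lam K X nu rad"
proof -
  interpret nu: prob_space nu by (rule prob_nu)
  have poisson: "poisson_process P lam K X"
  proof
    show "0 \<le> lam" using lam_pos by simp
    show "K \<in> measurable P (count_space UNIV)" by (rule measurable_K)
    show "X i \<in> borel_measurable P" for i by (rule measurable_X)
    show "AE \<omega> in P. finite (point_indices K X A \<omega>)" if A: "A \<in> sets borel" "bounded A" for A
    proof -
      obtain r where "A \<subseteq> ball 0 r" using bounded_subset_ballD[OF A(2), of 0] by metis
      moreover obtain m :: nat where "r \<le> real m" using real_arch_simple by blast
      ultimately have "A \<subseteq> ball 0 (real m)" by fastforce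
      from AE_point_count[OF this] show ?thesis by (auto elim: eventually_mono)
    qed
    have ip: "prob {\<omega> \<in> space P. point_count K X (A n) \<omega> = k} =
        exp (- (lam * measure lborel (A n))) * (lam * measure lborel (A n)) ^ k / fact k"
      "indep_vars (\<lambda>_. count_space UNIV) (\<lambda>n. point_count K X (A n)) UNIV"
      if A: "\<And>n. A n \<in> sets borel" "\<And>n. bounded (A n)" "disjoint_family A" for A :: "nat \<Rightarrow> 'a set" and n k
      using indep_poisson_of_pgf[of "\<lambda>n. point_count K X (A n)" "\<lambda>n. lam * measure lborel (A n)"]
        measurable_point_count[OF A(1)] point_count_pgf[OF A] lam_pos by auto
    then show "indep_vars (\<lambda>_. count_space UNIV) (\<lambda>n. point_count K X (A n)) UNIV"
      if "\<And>n. A n \<in> sets borel" "\<And>n. bounded (A n)" "disjoint_family A" for A :: "nat \<Rightarrow> 'a set"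
      using that by blast
    \<comment> \<open>A single set is completed to a disjoint sequence by empty sets.\<close>
    show "prob {\<omega> \<in> space P. point_count K X A \<omega> = k} =
        exp (- (lam * measure lborel A)) * (lam * measure lborel A) ^ k / fact k"
      if A: "A \<in> sets borel" "bounded A" for A k
      using ip(1)[of "\<lambda>n. if n = 0 then A else {}" 0 k] A by (simp add: disjoint_family_on_def)
  qed
  have indep: "indep_set
    (sets (vimage_algebra (space P) (\<lambda>\<omega>. (K \<omega>, \<lambda>i. X i \<omega>)) (count_space UNIV \<Otimes>\<^sub>M (\<Pi>\<^sub>M i\<in>UNIV. borel))))
    (sets (vimage_algebra (space P) (\<lambda>\<omega> i. rad i \<omega>) (\<Pi>\<^sub>M i\<in>UNIV. borel)))"
  proof -
    \<comment> \<open>Numbers and positions read \<open>zeta\<close> only at second index at least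
      1, radii only at second index 0.\<close>
    let ?I = "UNIV \<times> {1..} :: (nat \<times> nat) set"
    let ?J = "UNIV \<times> {0} :: (nat \<times> nat) set"
    let ?V = "\<lambda>I. vimage_algebra (space P) (\<lambda>\<omega>. restrict (\<lambda>i. zeta i \<omega>) I) (PiM I (\<lambda>_. borel))"
    have "indep_var (PiM ?I (\<lambda>_. borel)) (\<lambda>\<omega>. restrict (\<lambda>i. zeta i \<omega>) ?I)
      (PiM ?J (\<lambda>_. borel)) (\<lambda>\<omega>. restrict (\<lambda>i. zeta i \<omega>) ?J)"
      by (rule indep_var_restrict[OF indep_zeta]) auto
    then have ind: "indep_set (sets (?V ?I)) (sets (?V ?J))"
      unfolding indep_var_eq sets_vimage_algebra by blast
    have zV: "zeta i \<in> borel_measurable (?V I)" if "i \<in> I" for i I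
    proof -
      have "(\<lambda>\<omega>. restrict (\<lambda>i. zeta i \<omega>) I) \<in> measurable (?V I) (PiM I (\<lambda>_. borel))"
        by (rule measurable_vimage_algebra1) (auto simp: space_PiM)
      from measurable_compose[OF this measurable_component_singleton[OF that]] show ?thesis
        using that by simp
    qed
    have sub: "sets (vimage_algebra (space P) Y S) \<subseteq> sets (?V I)" if "Y \<in> measurable (?V I) S" for Y S I
      unfolding sets_vimage_algebra[of _ Y]
      using measurable_sets[OF that] by (intro sigma_algebra.sigma_sets_subset sets.sigma_algebra_axioms[of "?V I", simplified]) auto
    have N: "num k \<in> measurable (?V ?I) (count_space UNIV)" for k
    proof -
      have "(\<lambda>x. nat \<lfloor>x \<bullet> b\<rfloor>) \<in> measurable borel (count_space UNIV)" by measurable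
      from measurable_compose[OF zV[of "(k, 1)" ?I] this] show ?thesis
        by (simp add: num_def[abs_def])
    qed
    have U: "pt k j \<in> borel_measurable (?V ?I)" for k j
      unfolding pt_def by (rule zV) simp
    have "(\<lambda>\<omega>. (K \<omega>, \<lambda>i. X i \<omega>)) \<in> measurable (?V ?I) (count_space UNIV \<Otimes>\<^sub>M (\<Pi>\<^sub>M i\<in>UNIV. borel))"
    proof (rule measurable_Pair)
      show "K \<in> measurable (?V ?I) (count_space UNIV)"
        unfolding K_def by (rule measurable_point_number(1)[OF N])
      show "(\<lambda>\<omega> i. X i \<omega>) \<in> measurable (?V ?I) (\<Pi>\<^sub>M i\<in>UNIV. borel)"
        unfolding X_def by (rule measurable_PiM_single'[OF measurable_point_location[OF N U]]) auto
    qed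
    note s1 = sub[OF this]
    have "(\<lambda>\<omega> i. rad i \<omega>) \<in> measurable (?V ?J) (\<Pi>\<^sub>M i\<in>UNIV. borel)"
    proof (rule measurable_PiM_single')
      show "rad k \<in> borel_measurable (?V ?J)" for k
        unfolding rad_def[abs_def] by (intro borel_measurable_inner borel_measurable_const zV) simp
    qed auto
    note s2 = sub[OF this]
    show ?thesis
      unfolding indep_set_def
      by (rule indep_sets_mono_sets[OF ind[unfolded indep_set_def]]) (use s1 s2 in \<open>simp split: bool.split\<close>)
  qed
  show ?thesis
    unfolding boolean_model_def boolean_model_axioms_def
    using poisson indep indep_rad distr_rad by auto
qed

end

text \<open>The model has to live on \<open>'a marked_sequence\<close>, the type in the definition
  of \<open>as_no_unbounded_white\<close>. The doubly indexed family of independent vectors is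
  realised on a product space and transported to that type.\<close>

lemma boolean_model_exists:
  assumes "0 < lam" "prob_space nu" "sets nu = sets borel"
  obtains P :: "'a::euclidean_space marked_sequence measure" and K X rho
  where "boolean_model P lam K (X :: nat \<Rightarrow> 'a marked_sequence \<Rightarrow> 'a) nu rho"
proof -
  interpret nu: prob_space nu by fact
  obtain b :: 'a where b: "b \<in> Basis" using nonempty_Basis by blast
  define L :: "nat \<times> nat \<Rightarrow> 'a measure" where "L = (\<lambda>(k, j).
    if j = 0 then distr nu borel (\<lambda>r. r *\<^sub>R b)
    else if j = 1 then distr (measure_pmf (poisson_pmf (lam * measure lborel (shell k :: 'a set)))) borel (\<lambda>n. real n *\<^sub>R b)
    else uniform_measure lborel (shell k))"
  have sets_L [simp]: "sets (L i) = sets borel" for i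
    by (simp add: L_def split: prod.splits)
  have prob_L: "prob_space (L i)" for i
  proof (cases i)
    case (Pair k j)
    have "prob_space (uniform_measure lborel (shell k :: 'a set))"
      using measure_shell_pos[of k, where 'a = 'a] by (intro prob_space_uniform_measure) (auto simp: emeasure_shell)
    moreover have "prob_space (distr nu borel (\<lambda>r. r *\<^sub>R b))"
      using assms(3) by (intro nu.prob_space_distr) (simp add: measurable_cong_sets[OF assms(3) refl])
    moreover have "prob_space (distr (measure_pmf p) borel (\<lambda>n. real n *\<^sub>R b))" for p
      by (intro prob_space.prob_space_distr prob_space_measure_pmf) simp
    ultimately show ?thesis by (simp add: Pair L_def)
  qed
  define T :: "'a marked_sequence measure" where
    "T = count_space UNIV \<Otimes>\<^sub>M ((\<Pi>\<^sub>M i\<in>UNIV. borel) \<Otimes>\<^sub>M (\<Pi>\<^sub>M i\<in>UNIV. borel))"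
  define Q where "Q = (\<Pi>\<^sub>M i\<in>UNIV. L i)"
  interpret PL: product_prob_space L UNIV
    using prob_L by (intro product_prob_spaceI) 
  \<comment> \<open>The whole family is stored in the vector sequence by pairing indices; the other
    two components are dummies. Hence radii and numbers had to be encoded as vectors along
    \<open>b\<close>.\<close>
  define emb :: "(nat \<times> nat \<Rightarrow> 'a) \<Rightarrow> 'a marked_sequence" where
    "emb f = (0, (\<lambda>n. f (prod_decode n)), (\<lambda>_. 0))" for f
  define zeta :: "nat \<times> nat \<Rightarrow> 'a marked_sequence \<Rightarrow> 'a" where "zeta i \<omega> = fst (snd \<omega>) (prod_encode i)" for i \<omega>
  have sets_Q: "sets Q = sets (\<Pi>\<^sub>M i\<in>UNIV. (borel :: 'a measure))"
    unfolding Q_def by (intro sets_PiM_cong) auto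
  have emb: "emb \<in> measurable Q T"
    unfolding emb_def T_def measurable_cong_sets[OF sets_Q refl]
    by (intro measurable_Pair measurable_PiM_single' measurable_component_singleton) auto
  have ze: "zeta i (emb f) = f i" for i f by (simp add: zeta_def emb_def)
  have zT: "zeta i \<in> borel_measurable T" for i
    unfolding zeta_def T_def by measurable
  define P where "P = distr Q T emb"
  interpret P: prob_space P
    unfolding P_def Q_def by (rule PL.prob_space_distr) (use emb in \<open>simp add: Q_def\<close>)
  have zP: "zeta i \<in> borel_measurable P" for i using zT by (simp add: P_def)
  have law: "distr P borel (zeta i) = L i" for i
  proof -
    have "distr P borel (zeta i) = distr Q borel (\<lambda>f. f i)"
      unfolding P_def by (subst distr_distr[OF zT emb]) (simp add: comp_def ze)
    also have "\<dots> = distr Q (L i) (\<lambda>f. f i)" by (intro distr_cong) auto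
    also have "\<dots> = L i" unfolding Q_def by (rule PL.PiM_component) simp
    finally show ?thesis .
  qed
  have "P.indep_vars (\<lambda>_. borel) zeta UNIV"
  proof (subst P.indep_vars_iff_distr_eq_PiM)
    have "(\<lambda>\<omega>. \<lambda>i\<in>UNIV. zeta i \<omega>) \<in> measurable T (\<Pi>\<^sub>M i\<in>UNIV. borel)"
      using zT by (intro measurable_restrict) auto
    then have "distr P (\<Pi>\<^sub>M i\<in>UNIV. borel) (\<lambda>\<omega>. \<lambda>i\<in>UNIV. zeta i \<omega>) = distr Q (\<Pi>\<^sub>M i\<in>UNIV. borel) (\<lambda>f. f)"
      unfolding P_def by (subst distr_distr[OF _ emb]) (auto simp: comp_def ze restrict_def)
    also have "\<dots> = Q" using sets_Q by (intro distr_id2) auto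
    finally show "distr P (\<Pi>\<^sub>M i\<in>UNIV. borel) (\<lambda>\<omega>. \<lambda>i\<in>UNIV. zeta i \<omega>) = (\<Pi>\<^sub>M i\<in>UNIV. distr P borel (zeta i))"
      by (simp add: law Q_def)
  qed (use zP in auto)
  then interpret poisson_construction P lam nu zeta b
    using assms b by unfold_locales (auto simp: law L_def)
  show thesis using boolean_model by (rule that)
qed

section \<open>High intensity\<close>


text \<open>Having at most one bad sub-block is stated through pairs, so that badness becomes a
  finite union of intersections of two events.\<close>

fun good :: "(nat \<Rightarrow> nat \<Rightarrow> bool) \<Rightarrow> nat \<Rightarrow> nat \<Rightarrow> nat \<Rightarrow> bool" where
  "good occ 0 i j = occ i j"
| "good occ (Suc n) i j = (\<forall>a<3. \<forall>b<3. \<forall>a'<3. \<forall>b'<3. (a, b) \<noteq> (a', b') \<longrightarrow>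
    good occ n (3 * i + a) (3 * j + b) \<or> good occ n (3 * i + a') (3 * j + b'))"

text \<open>If the corner sub-block of a good block is bad, then its neighbour is good.\<close>

fun label :: "(nat \<Rightarrow> nat \<Rightarrow> bool) \<Rightarrow> (nat \<Rightarrow> nat \<Rightarrow> 'c) \<Rightarrow> nat \<Rightarrow> nat \<Rightarrow> nat \<Rightarrow> 'c" where
  "label occ cl 0 i j = cl i j"
| "label occ cl (Suc n) i j = (if good occ n (3 * i) (3 * j) then label occ cl n (3 * i) (3 * j)
    else label occ cl n (3 * i) (3 * j + 1))"

lemma less_3_cases: "(a::nat) < 3 \<longleftrightarrow> a = 0 \<or> a = 1 \<or> a = 2"
  by auto

text \<open>The 3 x 3 grid stays connected when one vertex is removed, and \<open>f\<close> is
  constant along edges between good vertices. The common value is read at the corner, or at its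
  neighbour if the corner is the removed vertex.\<close>

lemma grid_minus_one_connected:
  fixes g :: "nat \<Rightarrow> nat \<Rightarrow> bool" and f :: "nat \<Rightarrow> nat \<Rightarrow> 'c"
  assumes one: "\<And>a b a' b'. a < 3 \<Longrightarrow> b < 3 \<Longrightarrow> a' < 3 \<Longrightarrow> b' < 3 \<Longrightarrow> (a, b) \<noteq> (a', b') \<Longrightarrow> g a b \<or> g a' b'"
    and H: "\<And>a b. g a b \<Longrightarrow> g (a + 1) b \<Longrightarrow> f a b = f (a + 1) b"
    and V: "\<And>a b. g a b \<Longrightarrow> g a (b + 1) \<Longrightarrow> f a b = f a (b + 1)"
    and ab: "a < 3" "b < 3" "g a b"
  shows "f a b = (if g 0 0 then f 0 0 else f 0 1)"
proof -
  have H': "g 0 0 \<and> g 1 0 \<longrightarrow> f 0 0 = f 1 0" "g 0 1 \<and> g 1 1 \<longrightarrow> f 0 1 = f 1 1" "g 0 2 \<and> g 1 2 \<longrightarrow> f 0 2 = f 1 2"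
    "g 1 0 \<and> g 2 0 \<longrightarrow> f 1 0 = f 2 0" "g 1 1 \<and> g 2 1 \<longrightarrow> f 1 1 = f 2 1" "g 1 2 \<and> g 2 2 \<longrightarrow> f 1 2 = f 2 2"
    using H[of 0] H[of 1] by (auto simp: numeral_2_eq_2)
  have V': "g 0 0 \<and> g 0 1 \<longrightarrow> f 0 0 = f 0 1" "g 1 0 \<and> g 1 1 \<longrightarrow> f 1 0 = f 1 1" "g 2 0 \<and> g 2 1 \<longrightarrow> f 2 0 = f 2 1"
    "g 0 1 \<and> g 0 2 \<longrightarrow> f 0 1 = f 0 2" "g 1 1 \<and> g 1 2 \<longrightarrow> f 1 1 = f 1 2" "g 2 1 \<and> g 2 2 \<longrightarrow> f 2 1 = f 2 2"
    using V[of _ 0] V[of _ 1] by (auto simp: numeral_2_eq_2)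
  have others: "g a' b'" if "\<not> g c d" "a' < 3" "b' < 3" "c < 3" "d < 3" "(a', b') \<noteq> (c, d)" for a' b' c d
    using one[of a' b' c d] that by blast
  show ?thesis
  proof (cases "\<exists>c d. c < 3 \<and> d < 3 \<and> \<not> g c d")
    case True
    then obtain c d where c: "c < 3" "d < 3" "\<not> g c d" by blast
    have g: "g a' b' \<longleftrightarrow> (a', b') \<noteq> (c, d)" if "a' < 3" "b' < 3" for a' b'
      using others[OF c(3)] c that by blast
    have G: "g 0 0 \<longleftrightarrow> (0, 0) \<noteq> (c, d)" "g 0 1 \<longleftrightarrow> (0, 1) \<noteq> (c, d)" "g 0 2 \<longleftrightarrow> (0, 2) \<noteq> (c, d)"
      "g 1 0 \<longleftrightarrow> (1, 0) \<noteq> (c, d)" "g 1 1 \<longleftrightarrow> (1, 1) \<noteq> (c, d)" "g 1 2 \<longleftrightarrow> (1, 2) \<noteq> (c, d)"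
      "g 2 0 \<longleftrightarrow> (2, 0) \<noteq> (c, d)" "g 2 1 \<longleftrightarrow> (2, 1) \<noteq> (c, d)" "g 2 2 \<longleftrightarrow> (2, 2) \<noteq> (c, d)"
      by (rule g; simp)+
    show ?thesis
      using c(1,2) ab H' V' unfolding less_3_cases G g[OF ab(1,2)]
      by (elim disjE) simp_all
  next
    case False
    then have "g a' b'" if "a' < 3" "b' < 3" for a' b' using that by blast
    then have G: "g 0 0" "g 0 1" "g 0 2" "g 1 0" "g 1 1" "g 1 2" "g 2 0" "g 2 1" "g 2 2"
      by auto
    show ?thesis
      using ab H' V' G unfolding less_3_cases by (elim disjE) simp_all
  qed
qed

context
  fixes occ :: "nat \<Rightarrow> nat \<Rightarrow> bool" and cl :: "nat \<Rightarrow> nat \<Rightarrow> 'c"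
  assumes right: "\<And>i j. occ i j \<Longrightarrow> occ (i + 1) j \<Longrightarrow> cl i j = cl (i + 1) j"
    and up: "\<And>i j. occ i j \<Longrightarrow> occ i (j + 1) \<Longrightarrow> cl i j = cl i (j + 1)"
begin

lemma label_step:
  assumes "\<And>i j. good occ n i j \<Longrightarrow> good occ n (i + 1) j \<Longrightarrow> label occ cl n i j = label occ cl n (i + 1) j"
    and "\<And>i j. good occ n i j \<Longrightarrow> good occ n i (j + 1) \<Longrightarrow> label occ cl n i j = label occ cl n i (j + 1)"
    and "good occ (Suc n) i j" "a < 3" "b < 3" "good occ n (3 * i + a) (3 * j + b)"
  shows "label occ cl n (3 * i + a) (3 * j + b) = label occ cl (Suc n) i j"
  using grid_minus_one_connected[of "\<lambda>a b. good occ n (3 * i + a) (3 * j + b)" "\<lambda>a b. label occ cl n (3 * i + a) (3 * j + b)" a b]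
    assms by (simp add: add.assoc[symmetric])

text \<open>Two adjacent blocks face each other along three pairs of sub-blocks. Each block spoils
  at most one pair, so some facing pair is good on both sides and transmits the label; within each
  block all good sub-blocks share its label.\<close>

lemma label_adjacent:
  "(good occ n i j \<longrightarrow> good occ n (i + 1) j \<longrightarrow> label occ cl n i j = label occ cl n (i + 1) j) \<and>
   (good occ n i j \<longrightarrow> good occ n i (j + 1) \<longrightarrow> label occ cl n i j = label occ cl n i (j + 1))"
proof (induction n arbitrary: i j)
  case 0
  show ?case using right up by simp
next
  case (Suc n)
  have R: "good occ n i j \<Longrightarrow> good occ n (i + 1) j \<Longrightarrow> label occ cl n i j = label occ cl n (i + 1) j"
    and U: "good occ n i j \<Longrightarrow> good occ n i (j + 1) \<Longrightarrow> label occ cl n i j = label occ cl n i (j + 1)" for i j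
    using Suc by blast+
  note step = label_step[OF R U]
  have two: "\<exists>b<3. P b \<and> P' b"
    if "\<And>b b'. b < 3 \<Longrightarrow> b' < 3 \<Longrightarrow> b \<noteq> b' \<Longrightarrow> P b \<or> P b'" "\<And>b b'. b < 3 \<Longrightarrow> b' < 3 \<Longrightarrow> b \<noteq> b' \<Longrightarrow> P' b \<or> P' b'"
    for P P' :: "nat \<Rightarrow> bool"
  proof -
    have "P 0 \<or> P 1" "P 0 \<or> P 2" "P 1 \<or> P 2" "P' 0 \<or> P' 1" "P' 0 \<or> P' 2" "P' 1 \<or> P' 2"
      using that by simp_all
    then show ?thesis unfolding less_3_cases by blast
  qed
  show ?case
  proof (intro conjI impI)
    assume g: "good occ (Suc n) i j" "good occ (Suc n) (i + 1) j"
    obtain b where b: "b < 3" "good occ n (3 * i + 2) (3 * j + b)" "good occ n (3 * (i + 1) + 0) (3 * j + b)"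
    proof -
      have "\<exists>b<3. good occ n (3 * i + 2) (3 * j + b) \<and> good occ n (3 * (i + 1) + 0) (3 * j + b)"
      proof (rule two)
        fix b b' :: nat assume "b < 3" "b' < 3" "b \<noteq> b'"
        then show "good occ n (3 * i + 2) (3 * j + b) \<or> good occ n (3 * i + 2) (3 * j + b')"
          "good occ n (3 * (i + 1) + 0) (3 * j + b) \<or> good occ n (3 * (i + 1) + 0) (3 * j + b')"
          using g(1)[unfolded good.simps, rule_format, of 2 b 2 b'] g(2)[unfolded good.simps, rule_format, of 0 b 0 b']
          by simp_all
      qed
      then show thesis using that by blast
    qed
    have "label occ cl (Suc n) i j = label occ cl n (3 * i + 2) (3 * j + b)"
      by (rule step[symmetric]) (use g b in auto)
    also have "\<dots> = label occ cl n (3 * (i + 1) + 0) (3 * j + b)"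
      using R[of "3 * i + 2" "3 * j + b"] b by (simp add: numeral_3_eq_3)
    also have "\<dots> = label occ cl (Suc n) (i + 1) j"
      by (rule step) (use g b in auto)
    finally show "label occ cl (Suc n) i j = label occ cl (Suc n) (i + 1) j" .
  next
    assume g: "good occ (Suc n) i j" "good occ (Suc n) i (j + 1)"
    obtain b where b: "b < 3" "good occ n (3 * i + b) (3 * j + 2)" "good occ n (3 * i + b) (3 * (j + 1) + 0)"
    proof -
      have "\<exists>b<3. good occ n (3 * i + b) (3 * j + 2) \<and> good occ n (3 * i + b) (3 * (j + 1) + 0)"
      proof (rule two)
        fix b b' :: nat assume "b < 3" "b' < 3" "b \<noteq> b'"
        then show "good occ n (3 * i + b) (3 * j + 2) \<or> good occ n (3 * i + b') (3 * j + 2)"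
          "good occ n (3 * i + b) (3 * (j + 1) + 0) \<or> good occ n (3 * i + b') (3 * (j + 1) + 0)"
          using g(1)[unfolded good.simps, rule_format, of b 2 b' 2] g(2)[unfolded good.simps, rule_format, of b 0 b' 0]
          by simp_all
      qed
      then show thesis using that by blast
    qed
    have "label occ cl (Suc n) i j = label occ cl n (3 * i + b) (3 * j + 2)"
      by (rule step[symmetric]) (use g b in auto)
    also have "\<dots> = label occ cl n (3 * i + b) (3 * (j + 1) + 0)"
      using U[of "3 * i + b" "3 * j + 2"] b by (simp add: numeral_3_eq_3)
    also have "\<dots> = label occ cl (Suc n) i (j + 1)"
      by (rule step) (use g b in auto)
    finally show "label occ cl (Suc n) i j = label occ cl (Suc n) i (j + 1)" .
  qed
qed

lemma label_sub_block:
  assumes "good occ (Suc n) i j" "a < 3" "b < 3" "good occ n (3 * i + a) (3 * j + b)"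
  shows "label occ cl n (3 * i + a) (3 * j + b) = label occ cl (Suc n) i j"
  using label_adjacent[of n] by (intro label_step assms) blast+

text \<open>Following the sub-block that gave the block its label ends at an occupied site. Only the
  first coordinate is tracked, since its growth is enough to show unboundedness.\<close>

lemma label_representative:
  "good occ n i j \<Longrightarrow> \<exists>i' j'. occ i' j' \<and> cl i' j' = label occ cl n i j \<and> i * 3 ^ n \<le> i'"
proof (induction n arbitrary: i j)
  case 0
  then show ?case by auto
next
  case (Suc n)
  have "good occ n (3 * i + 0) (3 * j + 0) \<or> good occ n (3 * i + 0) (3 * j + 1)"
    using Suc.prems unfolding good.simps by (elim allE[where x = 0] allE[where x = 1] impE) auto
  then obtain b where b: "good occ n (3 * i) b" "label occ cl (Suc n) i j = label occ cl n (3 * i) b"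
    using that[of "3 * j"] that[of "3 * j + 1"] by (cases "good occ n (3 * i) (3 * j)") auto
  from Suc.IH[OF b(1)] b(2) show ?case by (auto simp: mult_ac)
qed

text \<open>As the corner blocks are good at all levels, each inherits the label of the site
  \<open>(0, 0)\<close>. The corner block of level \<open>N + 1\<close> has a good sub-block in its
  last column, and the representative of that one has first coordinate at least
  \<open>2 * 3 ^ N\<close>.\<close>

lemma good_blocks_infinite_label:
  assumes "\<And>n. good occ n 0 0"
  shows "occ 0 0" "\<exists>i\<ge>N. \<exists>j. occ i j \<and> cl i j = cl 0 0"
proof -
  show "occ 0 0" using assms[of 0] by simp
  have l: "label occ cl n 0 0 = cl 0 0" for n
  proof (induction n)
    case (Suc n)
    then show ?case using assms[of n] by simp
  qed simp
  have N: "N \<le> 2 * 3 ^ N"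
    using less_exp[of N] power_mono[of 2 "3::nat" N] by linarith
  have "good occ N (3 * 0 + 2) (3 * 0 + 0) \<or> good occ N (3 * 0 + 2) (3 * 0 + 1)"
    using assms[of "Suc N"] unfolding good.simps
    by (elim allE[where x = 2] allE[where x = 0] allE[where x = 1] impE) auto
  then obtain b where b: "b < 3" "good occ N (3 * 0 + 2) (3 * 0 + b)"
    by (metis one_less_numeral_iff semiring_norm(77) zero_less_numeral)
  have "label occ cl N (3 * 0 + 2) (3 * 0 + b) = cl 0 0"
    using label_sub_block[OF assms[of "Suc N"] _ b(1,2)] l[of "Suc N"] by simp
  with label_representative[OF b(2)] N show "\<exists>i\<ge>N. \<exists>j. occ i j \<and> cl i j = cl 0 0"
    by (metis add_0 mult_0_right order_trans)
qed

end

section \<open>A planar lattice of sites in the space\<close>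

definition site :: "real \<Rightarrow> 'a \<Rightarrow> 'a \<Rightarrow> nat \<Rightarrow> nat \<Rightarrow> 'a::euclidean_space" where
  "site r b b' i j = (r * real i) *\<^sub>R b + (r * real j) *\<^sub>R b'"

text \<open>Centres near adjacent sites are less than \<open>r / 2 + r + r / 2\<close> apart, a gap
  that two radii above \<open>r\<close> bridge. The balls of radius \<open>r / 2\<close> around
  distinct sites are disjoint, which makes occupations independent.\<close>

definition occupied :: "real \<Rightarrow> 'a \<Rightarrow> 'a \<Rightarrow> ('a::euclidean_space \<times> real) set \<Rightarrow> nat \<Rightarrow> nat \<Rightarrow> bool" where
  "occupied r b b' \<Phi> i j \<longleftrightarrow> \<Phi> \<inter> (ball (site r b b' i j) (r / 2) \<times> {r<..}) \<noteq> {}"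

definition block :: "real \<Rightarrow> 'a \<Rightarrow> 'a \<Rightarrow> nat \<Rightarrow> nat \<Rightarrow> nat \<Rightarrow> 'a::euclidean_space set" where
  "block r b b' n i j = (\<Union>(k, l)\<in>{(k, l). k div 3 ^ n = i \<and> l div 3 ^ n = j}. ball (site r b b' k l) (r / 2))"

context
  fixes r :: real and b b' :: "'a::euclidean_space"
  assumes r: "0 < r" and b: "b \<in> Basis" "b' \<in> Basis" "b \<noteq> b'"
begin

lemma site_inner: "site r b b' i j \<bullet> b = r * real i" "site r b b' i j \<bullet> b' = r * real j"
  using b by (simp_all add: site_def inner_add_left inner_not_same_Basis)

lemma site_dist:
  assumes "(i, j) \<noteq> (k, l)"
  shows "r \<le> dist (site r b b' i j) (site r b b' k l)"
proof -
  have *: "r \<le> \<bar>r * real i - r * real k\<bar>" if "i \<noteq> k" for i k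
  proof -
    have "1 \<le> \<bar>real i - real k\<bar>" using that by linarith
    then have "r * 1 \<le> r * \<bar>real i - real k\<bar>" using r by (intro mult_left_mono) auto
    also have "\<dots> = \<bar>r * real i - r * real k\<bar>" using r by (simp add: abs_mult flip: right_diff_distrib)
    finally show ?thesis by simp
  qed
  have "\<bar>r * real i - r * real k\<bar> \<le> dist (site r b b' i j) (site r b b' k l)"
    "\<bar>r * real j - r * real l\<bar> \<le> dist (site r b b' i j) (site r b b' k l)"
    using Basis_le_norm[OF b(1), of "site r b b' i j - site r b b' k l"]
      Basis_le_norm[OF b(2), of "site r b b' i j - site r b b' k l"]
    by (simp_all add: dist_norm inner_diff_left site_inner)
  with *[of i k] *[of j l] assms show ?thesis by force
qed

lemma site_adjacent:
  "dist (site r b b' i j) (site r b b' (i + 1) j) = r" "dist (site r b b' i j) (site r b b' i (j + 1)) = r"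
  using r b by (simp_all add: site_def dist_norm algebra_simps flip: scaleR_diff_left)

lemma block_disjoint:
  assumes "(i, j) \<noteq> (i', j')"
  shows "block r b b' n i j \<inter> block r b b' n i' j' = {}"
proof -
  have "ball (site r b b' k l) (r / 2) \<inter> ball (site r b b' k' l') (r / 2) = {}" if "(k, l) \<noteq> (k', l')" for k l k' l'
    using site_dist[OF that] by (intro disjoint_ballI) simp
  note * = this
  show ?thesis
  proof (rule ccontr)
    assume "block r b b' n i j \<inter> block r b b' n i' j' \<noteq> {}"
    then obtain x where "x \<in> block r b b' n i j" "x \<in> block r b b' n i' j'" by blast
    then obtain k l k' l' where kl: "k div 3 ^ n = i" "l div 3 ^ n = j" "x \<in> ball (site r b b' k l) (r / 2)"
      "k' div 3 ^ n = i'" "l' div 3 ^ n = j'" "x \<in> ball (site r b b' k' l') (r / 2)"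
      unfolding block_def by (elim UN_E CollectE case_prodE conjE) auto
    then have "(k, l) \<noteq> (k', l')" using assms by auto
    from *[OF this] kl show False by blast
  qed
qed

lemma block_Suc:
  assumes "a < 3" "c < 3"
  shows "block r b b' n (3 * i + a) (3 * j + c) \<subseteq> block r b b' (Suc n) i j"
proof -
  have "k div 3 ^ Suc n = i" if "k div 3 ^ n = 3 * i + a" "a < 3" for k i a :: nat
    using that by (simp add: div_mult2_eq[of k "3 ^ n" 3, simplified mult.commute[of "3 ^ n"]] flip: div_mult2_eq)
  then show ?thesis
    unfolding block_def using assms by blast
qed

text \<open>The class \<open>cl i j\<close> of an occupied site is the component of a chosen centre
  near it, and adjacent occupied sites share it. So the component attached to the origin contains
  points near sites with arbitrarily large first coordinate.\<close>

lemma unbounded_cluster: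
  assumes good: "\<And>n. good (occupied r b b' \<Phi>) n 0 0"
  shows "\<exists>C\<in>components (white \<Phi>). \<not> bounded C"
proof -
  let ?occ = "occupied r b b' \<Phi>"
  have "\<forall>i j. \<exists>z. ?occ i j \<longrightarrow> z \<in> \<Phi> \<inter> (ball (site r b b' i j) (r / 2) \<times> {r<..})"
    unfolding occupied_def by blast
  then obtain z where z: "\<And>i j. ?occ i j \<Longrightarrow> z i j \<in> \<Phi> \<inter> (ball (site r b b' i j) (r / 2) \<times> {r<..})"
    by metis
  define p where "p i j = fst (z i j)" for i j
  define cl where "cl i j = connected_component_set (white \<Phi>) (p i j)" for i j
  have p: "\<exists>s. (p i j, s) \<in> \<Phi> \<and> r < s \<and> dist (site r b b' i j) (p i j) < r / 2" if "?occ i j" for i j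
    using z[OF that] by (cases "z i j") (auto simp: p_def)
  have adj: "cl i j = cl k l" if occ_ij: "?occ i j" and occ_kl: "?occ k l" and dist_r: "dist (site r b b' i j) (site r b b' k l) = r" for i j k l
  proof -
    obtain s where s: "(p i j, s) \<in> \<Phi>" "r < s" "dist (site r b b' i j) (p i j) < r / 2" using p[OF occ_ij] by blast
    obtain t where t: "(p k l, t) \<in> \<Phi>" "r < t" "dist (site r b b' k l) (p k l) < r / 2" using p[OF occ_kl] by blast
    have "dist (p i j) (p k l) \<le> dist (site r b b' i j) (p i j) + dist (site r b b' i j) (site r b b' k l) + dist (site r b b' k l) (p k l)"
      using dist_triangle[of "p i j" "p k l" "site r b b' i j"] dist_triangle[of "site r b b' i j" "p k l" "site r b b' k l"]
      by (simp add: dist_commute)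
    also have "\<dots> < s + t" using s t dist_r by simp
    finally have "path_component (white \<Phi>) (p i j) (p k l)"
      using s t r by (intro path_component_centres) auto
    then have "connected_component (white \<Phi>) (p i j) (p k l)"
      using path_component_subset_connected_component[of "white \<Phi>" "p i j"] by auto
    then show ?thesis
      unfolding cl_def by (simp add: connected_component_eq_eq connected_component_in connected_component_eq)
  qed
  have R: "?occ i j \<Longrightarrow> ?occ (i + 1) j \<Longrightarrow> cl i j = cl (i + 1) j"
    and U: "?occ i j \<Longrightarrow> ?occ i (j + 1) \<Longrightarrow> cl i j = cl i (j + 1)" for i j
    using adj site_adjacent by blast+
  have in_white: "p i j \<in> white \<Phi>" if "?occ i j" for i j
    using p[OF that] r unfolding mem_white by (metis dist_self less_trans)
  have "cl 0 0 \<in> components (white \<Phi>)"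
    unfolding cl_def using in_white good[of 0] by (auto intro: componentsI)
  moreover have "\<not> bounded (cl 0 0)"
  proof
    assume "bounded (cl 0 0)"
    then obtain B where B: "\<And>x. x \<in> cl 0 0 \<Longrightarrow> norm x \<le> B"
      by (auto simp: bounded_iff)
    obtain N :: nat where N: "(B + r / 2) / r < real N" using reals_Archimedean2 by blast
    obtain i j where ij: "N \<le> i" "?occ i j" "cl i j = cl 0 0"
      using good_blocks_infinite_label(2)[of ?occ cl N, OF R U good] by blast
    have "p i j \<in> cl 0 0"
      unfolding ij(3)[symmetric] unfolding cl_def using in_white[OF ij(2)] by simp
    then have "norm (p i j) \<le> B" by (rule B)
    moreover have "r * real i - r / 2 < norm (p i j)"
    proof -
      have "r * real i = norm (r * real i)" using r by simp
      also have "\<dots> \<le> norm (site r b b' i j)"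
        using Basis_le_norm[OF b(1), of "site r b b' i j"] by (simp add: site_inner)
      also have "\<dots> < norm (p i j) + r / 2"
        using p[OF ij(2)] norm_triangle_ineq2[of "site r b b' i j" "p i j"] by (auto simp: dist_norm)
      finally show ?thesis by simp
    qed
    moreover have "B + r / 2 < r * real i"
    proof -
      have "B + r / 2 < r * real N" using N r by (simp add: field_simps)
      also have "\<dots> \<le> r * real i" using ij(1) r by simp
      finally show ?thesis .
    qed
    ultimately show False by linarith
  qed
  ultimately show ?thesis by blast
qed

text \<open>States measurability and locality together: with disjoint blocks it gives independence
  of their being bad.\<close>

lemma bad_in_conf: "{\<Phi>. \<not> good (occupied r b b' \<Phi>) n i j} \<in> sets (conf (block r b b' n i j))"
proof (induction n arbitrary: i j)
  case 0
  have "ball (site r b b' i j) (r / 2) \<times> {r<..} \<in> rects (block r b b' 0 i j)"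
    by (rule rects_Times) (auto simp: block_def)
  from void_in_conf[OF this] show ?case
    by (simp add: occupied_def void_def)
next
  case (Suc n)
  define T where "T = {(a, c, a', c') | a c a' c'. a < (3::nat) \<and> c < 3 \<and> a' < (3::nat) \<and> c' < (3::nat) \<and> (a, c) \<noteq> (a', c' :: nat)}"
  have "T \<subseteq> {..<3} \<times> {..<3} \<times> {..<3} \<times> {..<3}" by (auto simp: T_def)
  then have fin: "finite T" by (rule finite_subset) auto
  have sub: "{\<Phi>. \<not> good (occupied r b b' \<Phi>) n (3 * i + a) (3 * j + c)} \<in> sets (conf (block r b b' (Suc n) i j))"
    if "a < 3" "c < 3" for a c
    using Suc.IH[of "3 * i + a" "3 * j + c"] sets_conf_mono[OF block_Suc[OF that]] by blast
  have "{\<Phi>. \<not> good (occupied r b b' \<Phi>) (Suc n) i j} = (\<Union>(a, c, a', c')\<in>T.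
    {\<Phi>. \<not> good (occupied r b b' \<Phi>) n (3 * i + a) (3 * j + c)} \<inter>
    {\<Phi>. \<not> good (occupied r b b' \<Phi>) n (3 * i + a') (3 * j + c')})"
    unfolding good.simps T_def by blast
  also have "\<dots> \<in> sets (conf (block r b b' (Suc n) i j))"
    using fin by (intro sets.finite_UN) (auto simp: T_def intro!: sets.Int sub)
  finally show ?case .
qed

end

text \<open>A block of the next level is bad only if two of its nine sub-blocks are; there are at most 81 pairs.\<close>

fun bad_bound :: "real \<Rightarrow> nat \<Rightarrow> real" where
  "bad_bound q 0 = q"
| "bad_bound q (Suc n) = 81 * (bad_bound q n)\<^sup>2"

lemma bad_bound_nonneg: "0 \<le> q \<Longrightarrow> 0 \<le> bad_bound q n"
  by (cases n) auto

text \<open>The sequence \<open>81 * bad_bound q n\<close> is squared at each step, and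
  \<open>324 = 4 * 81\<close> makes it start at most at \<open>1 / 4\<close>.\<close>

lemma bad_bound_le:
  assumes "0 \<le> q" "q \<le> 1 / 324"
  shows "bad_bound q n \<le> (1 / 4) ^ Suc n / 81"
proof (induction n)
  case (Suc n)
  have "bad_bound q (Suc n) \<le> 81 * ((1 / 4) ^ Suc n / 81)\<^sup>2"
    using Suc bad_bound_nonneg[OF assms(1)] by (simp add: power_mono)
  also have "\<dots> = (1 / 4) ^ Suc n * (1 / 4) ^ Suc n / 81"
    by (simp add: power2_eq_square)
  also have "\<dots> \<le> (1 / 4) * (1 / 4) ^ Suc n / 81"
    using power_le_one[of "1 / 4 :: real" n] by (intro divide_right_mono mult_right_mono) auto
  finally show ?case by simp
qed (use assms in simp)

section \<open>Probabilities of bad blocks\<close>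

context poisson_law
begin

text \<open>Distinct sub-blocks depend on disjoint windows, so two simultaneous bad ones cost the
  square of the previous bound; at level 0 the probability is a void probability.\<close>

lemma prob_bad_le:
  fixes b b' :: 'a
  assumes r: "0 < r" and b: "b \<in> Basis" "b' \<in> Basis" "b \<noteq> b'"
  shows "prob {\<Phi>. \<not> good (occupied r b b' \<Phi>) n i j} \<le>
    bad_bound (exp (- lam * (measure lborel (ball (0::'a) (r / 2)) * measure nu {r<..}))) n"
proof (induction n arbitrary: i j)
  case 0
  let ?D = "ball (site r b b' i j) (r / 2) \<times> {r<..}"
  have "prob (void ?D) = exp (- lam * measure (lborel \<Otimes>\<^sub>M nu) ?D)"
    by (rule void_prob) (rule rects_Times; simp)
  also have "measure (lborel \<Otimes>\<^sub>M nu) ?D = measure lborel (ball (0::'a) (r / 2)) * measure nu {r<..}"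
    using r by (simp add: measure_rects_Times measure_lborel_ball)
  finally show ?case by (simp add: occupied_def void_def)
next
  case (Suc n)
  let ?q = "bad_bound (exp (- lam * (measure lborel (ball (0::'a) (r / 2)) * measure nu {r<..}))) n"
  define T where "T = {(a, c, a', c') | a c a' c'. a < (3::nat) \<and> c < 3 \<and> a' < (3::nat) \<and> c' < (3::nat) \<and> (a, c) \<noteq> (a', c' :: nat)}"
  have T: "T \<subseteq> {..<3} \<times> {..<3} \<times> {..<3} \<times> {..<3}" by (auto simp: T_def)
  then have fin: "finite T" by (rule finite_subset) auto
  have "card T \<le> 81" using card_mono[OF _ T] by simp
  define B where "B a c = {\<Phi>. \<not> good (occupied r b b' \<Phi>) n (3 * i + a) (3 * j + c)}" for a c
  have conf: "B a c \<in> sets (conf (block r b b' n (3 * i + a) (3 * j + c)))" for a c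
    unfolding B_def by (rule bad_in_conf[OF r b])
  have ev: "B a c \<in> events" for a c using in_events[OF conf] .
  have "{\<Phi>. \<not> good (occupied r b b' \<Phi>) (Suc n) i j} = (\<Union>(a, c, a', c')\<in>T. B a c \<inter> B a' c')"
    unfolding good.simps T_def B_def by blast
  also have "prob \<dots> \<le> (\<Sum>t\<in>T. prob (case t of (a, c, a', c') \<Rightarrow> B a c \<inter> B a' c'))"
    using fin ev by (intro finite_measure_subadditive_finite) auto
  also have "\<dots> \<le> (\<Sum>t\<in>T. ?q\<^sup>2)"
  proof (rule sum_mono)
    fix t assume "t \<in> T"
    then obtain a c a' c' where t: "t = (a, c, a', c')" "(a, c) \<noteq> (a', c')" by (auto simp: T_def)
    have "block r b b' n (3 * i + a) (3 * j + c) \<inter> block r b b' n (3 * i + a') (3 * j + c') = {}"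
      using t(2) by (intro block_disjoint[OF r b]) auto
    from conf_indep[OF this conf conf] have "prob (B a c \<inter> B a' c') = prob (B a c) * prob (B a' c')" .
    also have "\<dots> \<le> ?q * ?q"
      using Suc.IH by (intro mult_mono bad_bound_nonneg) (auto simp: B_def)
    finally show "prob (case t of (a, c, a', c') \<Rightarrow> B a c \<inter> B a' c') \<le> ?q\<^sup>2"
      by (simp add: t power2_eq_square)
  qed
  also have "\<dots> \<le> 81 * ?q\<^sup>2"
    using \<open>card T \<le> 81\<close> by (simp add: mult_right_mono)
  finally show ?case by simp
qed

lemma prob_all_good:
  fixes b b' :: 'a
  assumes r: "0 < r" and b: "b \<in> Basis" "b' \<in> Basis" "b \<noteq> b'"
    and small: "exp (- lam * (measure lborel (ball (0::'a) (r / 2)) * measure nu {r<..})) \<le> 1 / 324"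
  shows "\<not> (AE \<Phi> in Q. \<Phi> \<in> {\<Phi>. \<exists>n. \<not> good (occupied r b b' \<Phi>) n 0 0})"
proof
  assume AE: "AE \<Phi> in Q. \<Phi> \<in> {\<Phi>. \<exists>n. \<not> good (occupied r b b' \<Phi>) n 0 0}"
  let ?B = "\<lambda>n. {\<Phi>. \<not> good (occupied r b b' \<Phi>) n 0 0}"
  have ev: "?B n \<in> events" for n
    using in_events[OF bad_in_conf[OF r b]] .
  have le: "prob (?B n) \<le> (1 / 4) ^ Suc n / 81" for n
    using prob_bad_le[OF r b, of n 0 0] bad_bound_le[OF _ small, of n] by simp
  \<comment> \<open>The sum is \<open>(1 / 324) / (1 - 1 / 4) = 1 / 243\<close>; being below 1, it
    leaves positive probability for all corner blocks to be good.\<close>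
  have summ: "(\<lambda>n. (1 / 4) ^ Suc n / 81) sums (1 / 243 :: real)"
    using sums_mult[OF geometric_sums[of "1 / 4 :: real"], of "1 / 324"] by simp
  have summB: "summable (\<lambda>n. prob (?B n))"
    by (rule summable_comparison_test'[OF sums_summable[OF summ], of 0]) (use le in simp)
  have "AE \<Phi> in Q. \<Phi> \<in> (\<Union>n. ?B n)"
    using AE by eventually_elim auto
  then have "prob (\<Union>n. ?B n) = 1"
    using ev by (subst prob_eq_1) auto
  moreover have "prob (\<Union>n. ?B n) \<le> (\<Sum>n. prob (?B n))"
    using ev by (intro finite_measure_subadditive_countably summB) auto
  moreover have "\<dots> \<le> (\<Sum>n. (1 / 4) ^ Suc n / 81)"
    by (intro suminf_le le summB sums_summable[OF summ])
  ultimately show False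
    using sums_unique[OF summ] by simp
qed

end

text \<open>Almost surely the radius is positive, hence exceeds some \<open>1 / (n + 1)\<close>;
  these countably many events cannot all be null.\<close>

lemma radius_law_exceeds:
  assumes "radius_law nu"
  obtains r where "0 < r" "0 < measure nu {r<..}"
proof -
  interpret prob_space nu using assms by (simp add: radius_law_def)
  have nu: "sets nu = sets borel" "AE r in nu. 0 < r" using assms by (auto simp: radius_law_def)
  note sp = sets_eq_imp_space_eq[OF nu(1)]
  show thesis
  proof (rule ccontr)
    assume "\<not> thesis"
    then have "\<not> 0 < measure nu {1 / real (Suc n)<..}" for n
      using that[of "1 / real (Suc n)"] by auto
    then have zero: "measure nu {1 / real (Suc n)<..} = 0" for n
      using measure_nonneg[of nu "{1 / real (Suc n)<..}"] by (simp add: less_le)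
    have "AE r in nu. r \<notin> {1 / real (Suc n)<..}" for n
      using zero[of n] nu(1) prob_eq_0[of "{1 / real (Suc n)<..}"] by simp
    then have "AE r in nu. \<forall>n. r \<notin> {1 / real (Suc n)<..}"
      unfolding AE_all_countable by blast
    with nu(2) have "AE r in nu. False"
    proof eventually_elim
      case (elim r)
      then obtain n where "1 / real (Suc n) < r" using nat_approx_posE by blast
      with elim show False by auto
    qed
    then show False by simp
  qed
qed

text \<open>Each intensity from \<open>L\<close> on is excluded from the supremum because an actual
  model of it has an unbounded component with positive probability.\<close>

lemma critical_density_finite:
  assumes "DIM('a::euclidean_space) \<ge> 2" and nu: "radius_law nu"
  shows "critical_density TYPE('a) nu < \<infinity>"
proof -
  obtain r where r: "0 < r" "0 < measure nu {r<..}" using radius_law_exceeds[OF nu] by blast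
  obtain b b' :: 'a where b: "b \<in> Basis" "b' \<in> Basis" "b \<noteq> b'"
  proof -
    have "\<not> (\<forall>b\<in>Basis. \<forall>b'\<in>(Basis :: 'a set). b = b')"
      using assms(1) card_le_Suc0_iff_eq[of "Basis :: 'a set"] by auto
    then show ?thesis using that by blast
  qed
  define a where "a = measure lborel (ball (0::'a) (r / 2)) * measure nu {r<..}"
  have a: "0 < a" using r by (simp add: a_def measure_lborel_ball)
  \<comment> \<open>From this intensity on, a site is vacant with probability
    \<open>exp (- lam * a) \<le> 1 / 324\<close>, the threshold of the block recursion.\<close>
  define L where "L = ln 324 / a"
  have L: "0 < L" using a by (simp add: L_def)
  have "\<not> as_no_unbounded_white TYPE('a) nu lam" if lam: "L \<le> lam" for lam
  proof
    assume as: "as_no_unbounded_white TYPE('a) nu lam"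
    have "ln 324 \<le> lam * a" using lam a by (simp add: L_def field_simps)
    then have "exp (- (lam * a)) \<le> exp (- ln 324)" by simp
    then have small: "exp (- lam * a) \<le> 1 / 324" by (simp add: exp_minus)
    \<comment> \<open>The existence of a model turns the universally quantified assumption
      \<open>as\<close> into an actual almost sure statement.\<close>
    obtain P :: "'a marked_sequence measure" and K and X :: "nat \<Rightarrow> 'a marked_sequence \<Rightarrow> 'a" and rho
      where bm: "boolean_model P lam K X nu rho"
      by (rule boolean_model_exists[of lam nu]) (use lam L nu in \<open>auto simp: radius_law_def intro: that\<close>)
    interpret boolean_model P lam K X nu rho by fact
    interpret Q: poisson_law "distr P (conf UNIV) (marked_points K X rho)" lam nu
      by (rule poisson_law_marked_points)
    let ?E = "{\<Phi> :: ('a \<times> real) set. \<exists>n. \<not> good (occupied r b b' \<Phi>) n 0 0}"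
    have E: "?E \<in> sets (conf UNIV)"
    proof -
      have "?E = (\<Union>n. {\<Phi>. \<not> good (occupied r b b' \<Phi>) n 0 0})" by auto
      also have "\<dots> \<in> sets (conf UNIV)"
        using bad_in_conf[OF r(1) b] sets_conf_mono[of _ UNIV] by (intro sets.countable_nat_UN) blast
      finally show ?thesis .
    qed
    have "AE \<omega> in P. no_unbounded_white (boolean_colouring K X rho \<omega>)"
      using as bm unfolding as_no_unbounded_white_def by blast
    then have "AE \<omega> in P. marked_points K X rho \<omega> \<in> ?E"
    proof eventually_elim
      case (elim \<omega>)
      then show ?case
        using unbounded_cluster[OF r(1) b, of "marked_points K X rho \<omega>"]
        by (auto simp: no_unbounded_white_def boolean_colouring_white)
    qed
    then have "AE \<Phi> in distr P (conf UNIV) (marked_points K X rho). \<Phi> \<in> ?E"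
      using E by (subst AE_distr_iff[OF poisson_law_marked_points(1)]) auto
    then show False
      using Q.prob_all_good[OF r(1) b] small by (simp add: a_def)
  qed
  then have "critical_density TYPE('a) nu \<le> ennreal L"
    unfolding critical_density_def by (intro SUP_least ennreal_leI) (metis (mono_tags, lifting) linear mem_Collect_eq)
  then show ?thesis using ennreal_less_top[of L] by (simp only: infinity_ennreal_def)
qed

section \<open>The critical density\<close>


lemma power_diff_le:
  fixes a b :: real
  assumes "0 \<le> b" "b \<le> a"
  shows "a ^ Suc n - b ^ Suc n \<le> real (Suc n) * a ^ n * (a - b)"
proof (induction n)
  case (Suc n)
  have "a ^ Suc (Suc n) - b ^ Suc (Suc n) = a * (a ^ Suc n - b ^ Suc n) + b ^ Suc n * (a - b)"
    by (simp add: algebra_simps)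
  also have "\<dots> \<le> a * (real (Suc n) * a ^ n * (a - b)) + a ^ Suc n * (a - b)"
    using assms Suc by (intro add_mono mult_left_mono mult_right_mono power_mono) auto
  finally show ?case by (simp add: algebra_simps)
qed simp

text \<open>The balls of radius \<open>1 / 2\<close> around the points are disjoint and lie in the
  shell \<open>S\<close> of thickness 1, whose volume is of order \<open>R ^ (d - 1)\<close>; a full
  ball would only give \<open>R ^ d\<close>.\<close>

lemma separated_sphere_card:
  fixes F :: "'a::euclidean_space set"
  assumes F: "finite F" "F \<subseteq> sphere 0 R" and R: "1 \<le> R"
    and sep: "\<And>x y. x \<in> F \<Longrightarrow> y \<in> F \<Longrightarrow> x \<noteq> y \<Longrightarrow> 1 \<le> dist x y"
  shows "real (card F) \<le> real DIM('a) * 4 ^ DIM('a) * R ^ (DIM('a) - 1)"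
proof -
  let ?d = "DIM('a)" and ?v = "unit_ball_vol (real DIM('a))"
  obtain n where d: "?d = Suc n" using DIM_positive[where 'a = 'a] gr0_implies_Suc by blast
  have v: "0 < ?v" by simp
  define S :: "'a set" where "S = ball 0 (R + 1 / 2) - ball 0 (R - 1 / 2)"
  have disj: "disjoint_family_on (\<lambda>x. ball x (1 / 2)) F"
    unfolding disjoint_family_on_def using sep by (auto intro!: disjoint_ballI)
  have sub: "(\<Union>x\<in>F. ball x (1 / 2)) \<subseteq> S"
  proof
    fix y assume "y \<in> (\<Union>x\<in>F. ball x (1 / 2))"
    then obtain x where x: "x \<in> F" "norm (x - y) < 1 / 2" by (auto simp: dist_norm)
    then have "norm x = R" using F(2) by auto
    then show "y \<in> S"
      using x(2) norm_triangle_ineq3[of x y] by (auto simp: S_def abs_less_iff)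
  qed
  have S: "S \<in> fmeasurable lborel"
    using emeasure_bounded_finite[of S] bounded_subset[OF bounded_ball, of S 0 "R + 1 / 2"]
    by (intro fmeasurableI) (auto simp: S_def)
  have finb: "emeasure lborel (ball x (1 / 2)) \<noteq> \<infinity>" for x :: 'a
    using emeasure_bounded_finite[OF bounded_ball[of x "1 / 2"]] by simp
  have "real (card F) * (?v * (1 / 2) ^ ?d) = (\<Sum>x\<in>F. measure lborel (ball x (1 / 2)))"
    by (simp add: measure_lborel_ball)
  also have "\<dots> = measure lborel (\<Union>x\<in>F. ball x (1 / 2))"
    using F(1) disj finb by (intro measure_finite_Union[symmetric]) auto
  also have "\<dots> \<le> measure lborel S"
    using S sub F(1) by (intro measure_mono_fmeasurable) auto
  also have "\<dots> = measure lborel (ball (0::'a) (R + 1 / 2)) - measure lborel (ball (0::'a) (R - 1 / 2))"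
    unfolding S_def using emeasure_bounded_finite[OF bounded_ball[of "0::'a"]]
    by (intro measure_Diff) (auto simp: less_top)
  also have "\<dots> = ?v * ((R + 1 / 2) ^ ?d - (R - 1 / 2) ^ ?d)"
    using R by (simp add: measure_lborel_ball right_diff_distrib)
  also have "\<dots> \<le> ?v * (real ?d * (2 * R) ^ n)"
  proof -
    have "(R + 1 / 2) ^ ?d - (R - 1 / 2) ^ ?d \<le> real ?d * (R + 1 / 2) ^ n * ((R + 1 / 2) - (R - 1 / 2))"
      unfolding d using R by (intro power_diff_le) auto
    also have "\<dots> = real ?d * (R + 1 / 2) ^ n" by simp
    also have "\<dots> \<le> real ?d * (2 * R) ^ n"
      using R by (intro mult_left_mono power_mono) auto
    finally show ?thesis using v by simp
  qed
  finally have "real (card F) * (1 / 2) ^ ?d \<le> real ?d * (2 * R) ^ n"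
    using v by (simp add: mult.left_commute)
  then have "real (card F) \<le> real ?d * (2 * R) ^ n * 2 ^ ?d"
    by (simp add: power_divide field_simps)
  also have "\<dots> = real ?d * R ^ n * (2 ^ n * 2 ^ ?d)" by (simp add: power_mult_distrib)
  also have "\<dots> \<le> real ?d * R ^ n * (2 ^ ?d * 2 ^ ?d)"
    using R by (intro mult_left_mono mult_right_mono power_increasing) (auto simp: d)
  also have "(2::real) ^ ?d * 2 ^ ?d = 4 ^ ?d" by (simp flip: power_mult_distrib)
  finally show ?thesis by (simp add: d mult_ac)
qed

text \<open>A 1-separated set of greatest cardinality covers: a point at distance at least 1 from
  all its members could be added. The volume bound makes a greatest cardinality exist.\<close>

lemma sphere_unit_cover:
  assumes R: "1 \<le> R"
  obtains F :: "'a::euclidean_space set" where "finite F" "F \<subseteq> sphere 0 R"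
    "real (card F) \<le> real DIM('a) * 4 ^ DIM('a) * R ^ (DIM('a) - 1)"
    "\<And>p. p \<in> sphere 0 R \<Longrightarrow> \<exists>c\<in>F. dist c p < 1"
proof -
  define sep where "sep F \<longleftrightarrow> finite F \<and> F \<subseteq> sphere (0::'a) R \<and> (\<forall>x\<in>F. \<forall>y\<in>F. x \<noteq> y \<longrightarrow> 1 \<le> dist x y)" for F
  have card: "real (card F) \<le> real DIM('a) * 4 ^ DIM('a) * R ^ (DIM('a) - 1)" if "sep F" for F
    using that R by (intro separated_sphere_card) (auto simp: sep_def)
  obtain B :: nat where B: "real DIM('a) * 4 ^ DIM('a) * R ^ (DIM('a) - 1) \<le> real B"
    using real_arch_simple by blast
  have "sep {}" by (simp add: sep_def)
  moreover have "\<forall>F. sep F \<longrightarrow> card F < Suc B"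
    using card B by (meson le_imp_less_Suc of_nat_le_iff order_trans)
  ultimately have "\<exists>F. sep F \<and> (\<forall>G. sep G \<longrightarrow> card G \<le> card F)"
    by (rule ex_has_greatest_nat[where P = sep and k = "{}" and f = card and b = "Suc B"])
  then obtain F where F: "sep F" "\<And>G. sep G \<Longrightarrow> card G \<le> card F"
    by blast
  show thesis
  proof
    show "finite F" "F \<subseteq> sphere 0 R" using F(1) by (auto simp: sep_def)
    show "real (card F) \<le> real DIM('a) * 4 ^ DIM('a) * R ^ (DIM('a) - 1)" by (rule card[OF F(1)])
    fix p :: 'a assume p: "p \<in> sphere 0 R"
    show "\<exists>c\<in>F. dist c p < 1"
    proof (rule ccontr)
      assume "\<not> ?thesis"
      then have far: "1 \<le> dist c p" if "c \<in> F" for c using that by force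
      then have "p \<notin> F" by force
      moreover have "sep (insert p F)"
        using F(1) p far by (auto simp: sep_def dist_commute)
      ultimately show False using F(2)[of "insert p F"] F(1) by (simp add: sep_def)
    qed
  qed
qed

context poisson_law
begin

text \<open>A crossing starts at some \<open>p\<close> within 1 of a centre \<open>c\<close> of the
  cover and ends at distance at least \<open>R\<close> from \<open>c\<close>, so it contains a
  translate of the crossing from the unit sphere to radius \<open>R\<close>. Union bound over the
  cover.\<close>

lemma crossp_le_one_arm:
  assumes R: "1 \<le> R"
  shows "crossp Q R \<le> real DIM('a) * 4 ^ DIM('a) * R ^ (DIM('a) - 1) * prob {\<Phi>. joined \<Phi> (sphere 0 1) (sphere 0 R)}"
proof -
  let ?a = "prob {\<Phi>. joined \<Phi> (sphere (0::'a) 1) (sphere 0 R)}"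
  obtain F :: "'a set" where F: "finite F" "F \<subseteq> sphere 0 R"
    "real (card F) \<le> real DIM('a) * 4 ^ DIM('a) * R ^ (DIM('a) - 1)"
    "\<And>p. p \<in> sphere 0 R \<Longrightarrow> \<exists>c\<in>F. dist c p < 1"
    by (rule sphere_unit_cover[OF R]) (rule that; assumption)
  have ev: "{\<Phi>. joined \<Phi> (sphere c 1) (sphere c R)} \<in> events" for c :: 'a
    using in_events[OF joined_UNIV_in_conf] .
  have pr: "prob {\<Phi>. joined \<Phi> (sphere c 1) (sphere c R)} = ?a" for c :: 'a
    using prob_joined_translate[of UNIV c "sphere 0 1" "sphere 0 R"]
    by (simp add: sphere_translate surj_plus_right)
  have "{\<Phi>. cross 0 R \<Phi>} \<subseteq> (\<Union>c\<in>F. {\<Phi>. joined \<Phi> (sphere c 1) (sphere c R)})"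
  proof
    fix \<Phi> :: "('a \<times> real) set" assume "\<Phi> \<in> {\<Phi>. cross 0 R \<Phi>}"
    then have "joined \<Phi> (sphere 0 R) (sphere 0 (2 * R))"
      unfolding cross_def by (auto intro: joined_mono)
    then obtain p q where pq: "norm p = R" "norm q = 2 * R" "path_component (white \<Phi>) p q"
      by (auto simp: joined_def)
    then obtain c where c: "c \<in> F" "dist c p < 1" using F(4)[of p] by auto
    have "norm c = R" using c F(2) by auto
    then have "R \<le> dist c q"
      using pq norm_triangle_ineq2[of q c] by (simp add: dist_norm norm_minus_commute)
    then have "joined (\<Phi> \<inter> (UNIV \<times> UNIV)) (sphere c 1) (sphere c R)"
      using c R by (intro joined_annulus[OF pq(3)]) auto
    with c(1) show "\<Phi> \<in> (\<Union>c\<in>F. {\<Phi>. joined \<Phi> (sphere c 1) (sphere c R)})" by auto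
  qed
  then have "crossp Q R \<le> prob (\<Union>c\<in>F. {\<Phi>. joined \<Phi> (sphere c 1) (sphere c R)})"
    unfolding crossp_def using ev F(1) by (intro finite_measure_mono sets.finite_UN) auto
  also have "\<dots> \<le> (\<Sum>c\<in>F. prob {\<Phi>. joined \<Phi> (sphere c 1) (sphere c R)})"
    using ev F(1) by (intro finite_measure_subadditive_finite) auto
  also have "\<dots> = (\<Sum>c\<in>F. ?a)" by (rule sum.cong[OF refl pr])
  also have "\<dots> = real (card F) * ?a" by simp
  also have "\<dots> \<le> real DIM('a) * 4 ^ DIM('a) * R ^ (DIM('a) - 1) * ?a"
    using F(3) by (intro mult_right_mono) auto
  finally show ?thesis .
qed

lemma ball_UNIV_rects: "ball c r \<times> UNIV \<in> rects (UNIV :: 'a set)"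
  by (rule rects_Times) auto

lemma prob_hits_ball_le:
  "prob {\<Phi>. \<Phi> \<inter> (ball (0::'a) r \<times> UNIV) \<noteq> {}} \<le> lam * measure lborel (ball (0::'a) r)"
proof -
  interpret nu: prob_space nu by (rule prob_space_nu)
  have "measure nu UNIV = 1"
    using nu.prob_space sets_eq_imp_space_eq[OF sets_nu] by simp
  then show ?thesis
    using prob_hits_le[OF ball_UNIV_rects, of 0 r] measure_rects_Times[of "ball (0::'a) r" UNIV] by simp
qed

text \<open>A crossing needs at least one point in the window; this makes \<open>crossp\<close>
  small at a fixed scale as the intensity tends to 0.\<close>

lemma crossp_le_intensity: "crossp Q R \<le> lam * measure lborel (ball (0::'a) (4 * R))"
proof -
  have "{\<Phi>. cross 0 R \<Phi>} \<subseteq> {\<Phi>. \<Phi> \<inter> (ball (0::'a) (4 * R) \<times> UNIV) \<noteq> {}}"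
    unfolding cross_def using joined_hits by blast
  then have "crossp Q R \<le> prob {\<Phi>. \<Phi> \<inter> (ball (0::'a) (4 * R) \<times> UNIV) \<noteq> {}}"
    unfolding crossp_def by (intro finite_measure_mono hits_event[OF ball_UNIV_rects])
  with prob_hits_ball_le[of "4 * R"] show ?thesis by simp
qed

end

text \<open>A model of intensity \<open>lam + e\<close> has the law of a superposition of independent models of
  intensities \<open>lam\<close> and \<open>e\<close>, and the second one has no point near the origin with high probability.\<close>

lemma crossp_add_intensity:
  fixes Q Q' :: "('a::euclidean_space \<times> real) set measure"
  assumes Q: "poisson_law Q lam nu" and Q': "poisson_law Q' (lam + e) nu" and e: "0 < e"
  shows "crossp Q' R \<le> crossp Q R + e * measure lborel (ball (0::'a) (4 * R))"
proof -
  interpret Q: poisson_law Q lam nu by fact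
  obtain P :: "'a marked_sequence measure" and K and X :: "nat \<Rightarrow> 'a marked_sequence \<Rightarrow> 'a" and rho
    where bm: "boolean_model P e K X nu rho"
    by (rule boolean_model_exists[OF e Q.prob_space_nu Q.sets_nu])
  define E where "E = distr P (conf UNIV) (marked_points K X rho)"
  interpret E: poisson_law E e nu
    unfolding E_def by (rule boolean_model.poisson_law_marked_points(2)[OF bm])
  interpret QE: pair_prob_space Q E ..
  let ?u = "\<lambda>(\<Phi>, \<Psi>). \<Phi> \<union> \<Psi> :: ('a \<times> real) set"
  let ?H = "{\<Phi>. \<Phi> \<inter> (ball (0::'a) (4 * R) \<times> UNIV) \<noteq> {}}"
  note sup = poisson_law_superposition[OF Q E.poisson_law_axioms]
  have Q'_eq: "Q' = distr (Q \<Otimes>\<^sub>M E) (conf UNIV) ?u"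
    by (rule poisson_law_unique[OF Q' sup(2)])
  have evC: "{\<Phi>. cross 0 R \<Phi>} \<in> sets Q" by (rule Q.cross_event)
  have evH: "?H \<in> sets E" by (rule E.hits_event[OF E.ball_UNIV_rects])
  have C: "{\<Phi>. cross (0::'a) R \<Phi>} \<in> sets (conf UNIV)"
    using cross_in_conf sets_conf_mono[of _ UNIV] by blast
  have "crossp Q' R = measure (Q \<Otimes>\<^sub>M E) (?u -` {\<Phi>. cross 0 R \<Phi>} \<inter> space (Q \<Otimes>\<^sub>M E))"
    unfolding crossp_def Q'_eq by (rule measure_distr[OF sup(1) C])
  also have "\<dots> \<le> measure (Q \<Otimes>\<^sub>M E) ({\<Phi>. cross 0 R \<Phi>} \<times> UNIV \<union> UNIV \<times> ?H)"
  proof (rule QE.finite_measure_mono)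
    show "?u -` {\<Phi>. cross 0 R \<Phi>} \<inter> space (Q \<Otimes>\<^sub>M E) \<subseteq> {\<Phi>. cross 0 R \<Phi>} \<times> UNIV \<union> UNIV \<times> ?H"
    proof
      fix z assume "z \<in> ?u -` {\<Phi>. cross 0 R \<Phi>} \<inter> space (Q \<Otimes>\<^sub>M E)"
      then obtain \<Phi> \<Psi> where z: "z = (\<Phi>, \<Psi>)" "cross 0 R (\<Phi> \<union> \<Psi>)" by (cases z) auto
      show "z \<in> {\<Phi>. cross 0 R \<Phi>} \<times> UNIV \<union> UNIV \<times> ?H"
      proof (cases "\<Psi> \<in> ?H")
        case False
        then have "(\<Phi> \<union> \<Psi>) \<inter> (ball 0 (4 * R) \<times> UNIV) = \<Phi> \<inter> (ball 0 (4 * R) \<times> UNIV)" by blast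
        with z show ?thesis by (simp add: cross_def)
      qed (simp add: z)
    qed
    show "{\<Phi>. cross 0 R \<Phi>} \<times> UNIV \<union> UNIV \<times> ?H \<in> sets (Q \<Otimes>\<^sub>M E)"
      using evC evH Q.space_Q E.space_Q sets.top[of Q] sets.top[of E]
      by (intro sets.Un pair_measureI) auto
  qed
  also have "\<dots> \<le> measure (Q \<Otimes>\<^sub>M E) ({\<Phi>. cross 0 R \<Phi>} \<times> UNIV) + measure (Q \<Otimes>\<^sub>M E) (UNIV \<times> ?H)"
    using evC evH Q.space_Q E.space_Q sets.top[of Q] sets.top[of E]
    by (intro measure_Un_le pair_measureI) auto
  also have "measure (Q \<Otimes>\<^sub>M E) ({\<Phi>. cross 0 R \<Phi>} \<times> UNIV) = crossp Q R"
  proof -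
    have "emeasure (Q \<Otimes>\<^sub>M E) ({\<Phi>. cross 0 R \<Phi>} \<times> UNIV) = emeasure Q {\<Phi>. cross 0 R \<Phi>} * emeasure E (space E)"
      using evC sets.top[of E] by (subst E.emeasure_pair_measure_Times) auto
    then show ?thesis by (simp only: E.emeasure_space_1) (simp add: measure_def crossp_def)
  qed
  also have "measure (Q \<Otimes>\<^sub>M E) (UNIV \<times> ?H) = measure E ?H"
  proof -
    have "emeasure (Q \<Otimes>\<^sub>M E) (UNIV \<times> ?H) = emeasure Q (space Q) * emeasure E ?H"
      using evH sets.top[of Q] by (subst E.emeasure_pair_measure_Times) auto
    then show ?thesis by (simp only: Q.emeasure_space_1) (simp add: measure_def)
  qed
  also have "measure E ?H \<le> e * measure lborel (ball (0::'a) (4 * R))"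
    by (rule E.prob_hits_ball_le)
  finally show ?thesis by simp
qed

section \<open>Bounds at and below the critical density\<close>

lemma critical_density_upper:
  "as_no_unbounded_white TYPE('a::euclidean_space) nu lam \<Longrightarrow> 0 \<le> lam \<Longrightarrow> ennreal lam \<le> critical_density TYPE('a) nu"
  unfolding critical_density_def by (intro SUP_upper) auto

lemma critical_density_pos:
  assumes tail: "exp_small_tail nu"
  shows "0 < critical_density TYPE('a::euclidean_space) nu"
proof -
  obtain C R0 where CR: "1 \<le> C" "1 \<le> R0"
    "\<forall>lam R. lam \<le> 1 \<longrightarrow> R0 \<le> R \<longrightarrow>
      (\<forall>Q :: ('a \<times> real) set measure. poisson_law Q lam nu \<longrightarrow> C * crossp Q R \<le> 1 / 4) \<longrightarrow>
      as_no_unbounded_white TYPE('a) nu lam"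
    by (rule subcritical_criterion[OF tail zero_le_one, where 'a = 'a]) (rule that; assumption)
  define m where "m = measure lborel (ball (0::'a) (4 * R0))"
  have m: "0 < m" using CR(2) by (simp add: m_def measure_lborel_ball)
  \<comment> \<open>The scale \<open>R0\<close> is fixed and only the intensity is reduced: this
    value gives \<open>C * (lam * m) \<le> 1 / 4\<close>, and the minimum with 1 stays in the range
    of the criterion.\<close>
  define lam where "lam = min 1 (1 / (4 * C * m))"
  have lam: "0 < lam" "lam \<le> 1" "lam \<le> 1 / (4 * C * m)" using CR(1) m by (auto simp: lam_def)
  have "as_no_unbounded_white TYPE('a) nu lam"
  proof (rule CR(3)[rule_format, OF lam(2) order_refl])
    fix Q :: "('a \<times> real) set measure" assume "poisson_law Q lam nu"
    then interpret poisson_law Q lam nu .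
    have "C * crossp Q R0 \<le> C * (lam * m)"
      using crossp_le_intensity[of R0] CR(1) by (intro mult_left_mono) (auto simp: m_def)
    also have "\<dots> \<le> C * (1 / (4 * C * m) * m)"
      using lam(3) CR(1) m by (intro mult_left_mono mult_right_mono) auto
    also have "\<dots> = 1 / 4" using CR(1) m by simp
    finally show "C * crossp Q R0 \<le> 1 / 4" .
  qed
  from critical_density_upper[OF this] lam(1) have "ennreal lam \<le> critical_density TYPE('a) nu" by simp
  moreover have "0 < ennreal lam" using lam(1) by simp
  ultimately show ?thesis by (rule order.strict_trans2[rotated])
qed

text \<open>The bound 1 can be used without any smallness, because \<eta> turns it into
  \<open>R powr (- \<eta>)\<close> after the covering. One scale \<open>R\<close> where the
  criterion holds with a margin is enough, and the intensity is raised at that scale.\<close>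

lemma critical_one_arm:
  fixes Q :: "('a::euclidean_space \<times> real) set measure"
  assumes tail: "exp_small_tail nu" and Q: "poisson_law Q l nu" and l: "critical_density TYPE('a) nu = ennreal l"
    and \<eta>: "0 < \<eta>"
  shows "\<not> (\<forall>\<^sub>F R in at_top. R powr (real DIM('a) - 1 + \<eta>) * measure Q {\<Phi>. joined \<Phi> (sphere 0 1) (sphere 0 R)} < 1)"
proof
  assume ev: "\<forall>\<^sub>F R in at_top. R powr (real DIM('a) - 1 + \<eta>) * measure Q {\<Phi>. joined \<Phi> (sphere 0 1) (sphere 0 R)} < 1"
  interpret Q: poisson_law Q l nu by fact
  have l0: "0 \<le> l" by (rule Q.lam_nonneg)
  then have l1: "0 \<le> l + 1" by simp
  obtain C R0 where CR: "1 \<le> C" "1 \<le> R0"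
    "\<forall>lam R. lam \<le> l + 1 \<longrightarrow> R0 \<le> R \<longrightarrow>
      (\<forall>Q :: ('a \<times> real) set measure. poisson_law Q lam nu \<longrightarrow> C * crossp Q R \<le> 1 / 4) \<longrightarrow>
      as_no_unbounded_white TYPE('a) nu lam"
    by (rule subcritical_criterion[OF tail l1, where 'a = 'a]) (rule that; assumption)
  define B where "B = real DIM('a) * 4 ^ DIM('a)"
  have B: "0 < B" by (simp add: B_def)
  \<comment> \<open>The target \<open>1 / 8\<close> is half of the threshold \<open>1 / 4\<close>;
    the other half is spent on the added intensity.\<close>
  have "((\<lambda>R. C * B * R powr (- \<eta>)) \<longlongrightarrow> C * B * 0) at_top"
    using \<eta> by (intro tendsto_intros tendsto_neg_powr filterlim_ident) auto
  then have "\<forall>\<^sub>F R in at_top. C * B * R powr (- \<eta>) < 1 / 8"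
    by (rule order_tendstoD(2)) simp
  with ev have "\<forall>\<^sub>F R in at_top. R powr (real DIM('a) - 1 + \<eta>) * measure Q {\<Phi>. joined \<Phi> (sphere 0 1) (sphere 0 R)} < 1
      \<and> C * B * R powr (- \<eta>) < 1 / 8 \<and> R0 \<le> R"
    using eventually_ge_at_top[of R0] by eventually_elim simp
  then obtain R where R: "R powr (real DIM('a) - 1 + \<eta>) * measure Q {\<Phi>. joined \<Phi> (sphere 0 1) (sphere 0 R)} < 1"
      "C * B * R powr (- \<eta>) < 1 / 8" "R0 \<le> R"
    by (auto simp: eventually_at_top_linorder)
  have R1: "1 \<le> R" using R(3) CR(2) by simp
  let ?p = "measure Q {\<Phi>. joined \<Phi> (sphere (0::'a) 1) (sphere 0 R)}"
  have "R ^ (DIM('a) - 1) * ?p \<le> R powr (- \<eta>)"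
  proof -
    have "R ^ (DIM('a) - 1) = R powr (real DIM('a) - 1)"
      using R1 DIM_positive[where 'a = 'a] by (simp add: powr_realpow[symmetric] of_nat_diff Suc_leI)
    also have "\<dots> = R powr (- \<eta>) * R powr (real DIM('a) - 1 + \<eta>)"
      by (simp flip: powr_add)
    finally have "R ^ (DIM('a) - 1) * ?p = R powr (- \<eta>) * (R powr (real DIM('a) - 1 + \<eta>) * ?p)" by simp
    also have "\<dots> \<le> R powr (- \<eta>) * 1"
      using R(1) by (intro mult_left_mono) auto
    finally show ?thesis by simp
  qed
  then have "B * (R ^ (DIM('a) - 1) * ?p) \<le> B * R powr (- \<eta>)"
    using B by (intro mult_left_mono) auto
  moreover have "crossp Q R \<le> B * (R ^ (DIM('a) - 1) * ?p)"
    using Q.crossp_le_one_arm[OF R1] by (simp only: B_def mult.assoc)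
  ultimately have "crossp Q R \<le> B * R powr (- \<eta>)"
    by (rule order_trans[rotated])
  then have "C * crossp Q R \<le> C * B * R powr (- \<eta>)"
    using CR(1) by (simp add: mult.assoc)
  with R(2) have small: "C * crossp Q R \<le> 1 / 8" by simp
  define m where "m = measure lborel (ball (0::'a) (4 * R))"
  have m: "0 < m" using R1 by (simp add: m_def measure_lborel_ball)
  \<comment> \<open>Chosen after \<open>R\<close>, since \<open>m\<close> grows with
    \<open>R\<close>: the added intensity costs at most \<open>C * (e * m) \<le> 1 / 8\<close>, and
    \<open>e \<le> 1\<close> keeps \<open>l + e\<close> below the bound for which \<open>C\<close>
    and \<open>R0\<close> were obtained.\<close>
  define e where "e = min 1 (1 / (8 * C * m))"
  have e: "0 < e" "e \<le> 1" "e \<le> 1 / (8 * C * m)" using CR(1) m by (auto simp: e_def)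
  have "as_no_unbounded_white TYPE('a) nu (l + e)"
  proof (rule CR(3)[rule_format, OF _ R(3)])
    show "l + e \<le> l + 1" using e by simp
    fix Q' :: "('a \<times> real) set measure" assume Q': "poisson_law Q' (l + e) nu"
    have "C * crossp Q' R \<le> C * (crossp Q R + e * m)"
      using crossp_add_intensity[OF Q Q' e(1)] CR(1) by (intro mult_left_mono) (auto simp: m_def)
    also have "\<dots> = C * crossp Q R + C * (e * m)" by (simp add: distrib_left)
    also have "C * (e * m) \<le> C * (1 / (8 * C * m) * m)"
      using e(3) CR(1) m by (intro mult_left_mono mult_right_mono) auto
    also have "\<dots> = 1 / 8" using CR(1) m by simp
    finally show "C * crossp Q' R \<le> 1 / 4" using small by simp
  qed
  from critical_density_upper[OF this] l0 e(1) have "ennreal (l + e) \<le> ennreal l"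
    by (simp add: l)
  then show False using l0 e(1) by (simp add: ennreal_le_iff)
qed

theorem corollary3p15:
  fixes M :: "'w measure"
    and nu :: "real measure"
    and K :: "'w \<Rightarrow> enat"
    and X :: "nat \<Rightarrow> 'w \<Rightarrow> 'a::euclidean_space"
    and rho :: "nat \<Rightarrow> 'w \<Rightarrow> real"
  assumes "DIM('a) \<ge> 2"
    and "radius_law nu"
    and "exp_small_tail nu"
    and "boolean_model M (enn2real (critical_density TYPE('a) nu)) K X nu rho"
  shows "0 < critical_density TYPE('a) nu \<and> critical_density TYPE('a) nu < \<infinity> \<and>
    (\<forall>\<eta>>0. Limsup at_top (\<lambda>R::real.
        ereal (R powr (real DIM('a) - 1 + \<eta>) *
          measure M {\<omega> \<in> space M. white_crossing (boolean_colouring K X rho \<omega>) R})) > 0)"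
proof (intro conjI allI impI)
  show "0 < critical_density TYPE('a) nu" by (rule critical_density_pos[OF assms(3)])
  show fin: "critical_density TYPE('a) nu < \<infinity>" by (rule critical_density_finite[OF assms(1,2)])
  fix \<eta> :: real assume \<eta>: "0 < \<eta>"
  interpret boolean_model M "enn2real (critical_density TYPE('a) nu)" K X nu rho by fact
  define Q where "Q = distr M (conf UNIV) (marked_points K X rho)"
  have Q: "poisson_law Q (enn2real (critical_density TYPE('a) nu)) nu"
    unfolding Q_def by (rule poisson_law_marked_points)
  have meas: "measure M {\<omega> \<in> space M. white_crossing (boolean_colouring K X rho \<omega>) R} =
    measure Q {\<Phi>. joined \<Phi> (sphere 0 1) (sphere 0 R)}" for R
    unfolding Q_def white_crossing_iff
    by (subst measure_distr[OF poisson_law_marked_points(1) joined_UNIV_in_conf])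
      (auto intro!: arg_cong[where f = prob])
  \<comment> \<open>Finiteness is used here: \<open>enn2real\<close> would send an infinite critical
    density to 0.\<close>
  have l: "critical_density TYPE('a) nu = ennreal (enn2real (critical_density TYPE('a) nu))"
    using fin by simp
  show "0 < Limsup at_top (\<lambda>R::real. ereal (R powr (real DIM('a) - 1 + \<eta>) *
          measure M {\<omega> \<in> space M. white_crossing (boolean_colouring K X rho \<omega>) R}))"
  proof (rule ccontr)
    assume "\<not> ?thesis"
    \<comment> \<open>A limit superior at most 0 is below 1, so the scaled crossing probability is
      eventually below 1.\<close>
    then have "Limsup at_top (\<lambda>R::real. ereal (R powr (real DIM('a) - 1 + \<eta>) *
          measure M {\<omega> \<in> space M. white_crossing (boolean_colouring K X rho \<omega>) R})) < ereal 1"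
      by (simp add: not_less order.strict_trans1[of _ 0])
    then have "\<forall>\<^sub>F R in at_top. ereal (R powr (real DIM('a) - 1 + \<eta>) *
          measure M {\<omega> \<in> space M. white_crossing (boolean_colouring K X rho \<omega>) R}) < ereal 1"
      by (rule Limsup_lessD)
    then show False
      using critical_one_arm[OF assms(3) Q l \<eta>] by (simp add: meas)
  qed
qed

end
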